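(* Consider the following potentials in $\mathbb{C}[x_1,x_2]$: $V^{(\mathrm{A}_{d-1})}=x_1^d+x_2^2$ ($d\ge2$), $V^{(\mathrm{D}_{d+1})}=x_1^d+x_1x_2^2$ ($d\ge3$), $V^{(\mathrm{E}_6)}=x_1^3+x_2^4$, $V^{(\mathrm{E}_7)}=x_1^3+x_1x_2^3$, $V^{(\mathrm{E}_8)}=x_1^3+x_2^5$. Restricted to this set, the orbifold equivalence classes are exactly: $\{V^{(\mathrm{A}_{d-1})}\}$ for $d$ odd; $\{V^{(\mathrm{A}_{d-1})}\}$ for $d\in\{2,4\}$; $\{V^{(\mathrm{A}_{d-1})},V^{(\mathrm{D}_{d/2+1})}\}$ for $d$ even, $d\ge6$, $d\notin\{12,18,30\}$; and $\{V^{(\mathrm{A}_{11})},V^{(\mathrm{D}_7)},V^{(\mathrm{E}_6)}\}$, $\{V^{(\mathrm{A}_{17})},V^{(\mathrm{D}_{10})},V^{(\mathrm{E}_7)}\}$, $\{V^{(\mathrm{A}_{29})},V^{(\mathrm{D}_{16})},V^{(\mathrm{E}_8)}\}$.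
   Context: Work over $k=\mathbb{C}$. Each listed polynomial is a homogeneous potential: the variables carry degrees in $\mathbb{Q}_{>0}$ (uniquely determined) such that the polynomial has degree $2$, i.e. $V(\lambda^{|x_1|}x_1,\lambda^{|x_2|}x_2)=\lambda^2V$. For potentials $V(x)\in\mathbb{C}[x_1,\dots,x_m]$, $W(y)\in\mathbb{C}[y_1,\dots,y_n]$ in disjoint variables, a finite-rank graded matrix factorisation of $W-V$ is a $\mathbb{Z}_2$-graded free module $X=X^0\oplus X^1$ over $\mathbb{C}[x,y]$ of finite rank, with $X^0,X^1$ also $\mathbb{Q}$-graded so that each variable acts with its degree, and an odd $\mathbb{C}[x,y]$-linear map $d_X$ of $\mathbb{Q}$-degree 1 with $d_X^2=(W-V)\cdot1$. Its quantum dimensions are $\dim_{\mathrm{l}}(X)=(-1)^{\binom{m+1}{2}}\operatorname{Res}\big[\operatorname{str}(\partial_{x_1}d_X\cdots\partial_{x_m}d_X\partial_{y_1}d_X\cdots\partial_{y_n}d_X)\,\mathrm{d}y/(\partial_{y_1}W,\dots,\partial_{y_n}W)\big]$ and $\dim_{\mathrm{r}}(X)=(-1)^{\binom{n+1}{2}}\operatorname{Res}\big[\operatorname{str}(\text{same product})\,\mathrm{d}x/(\partial_{x_1}V,\dots,\partial_{x_m}V)\big]$, with entrywise derivatives, supertrace $\operatorname{str}$ and Grothendieck residue. $V$ and $W$ are orbifold equivalent if such an $X$ exists with both quantum dimensions non-zero; this is an equivalence relation. *)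

theory Defs
  imports Complex_Main "HOL-Library.Poly_Mapping" "HOL-Combinatorics.Permutations"
begin

text \<open>A polynomial over C in the variables indexed by natural numbers is a finitely
supported map from monomials (finitely supported exponent vectors nat =>0 nat) to
coefficients; multiplication is the convolution product of Poly_Mapping.\<close>

type_synonym mpoly = "(nat \<Rightarrow>\<^sub>0 nat) \<Rightarrow>\<^sub>0 complex"

definition mono :: "complex \<Rightarrow> (nat \<Rightarrow>\<^sub>0 nat) \<Rightarrow> mpoly" where
  "mono c a = Poly_Mapping.single a c"

definition Var :: "nat \<Rightarrow> mpoly" where
  "Var i = mono 1 (Poly_Mapping.single i 1)"

definition vars :: "mpoly \<Rightarrow> nat set" where
  "vars p = \<Union> (Poly_Mapping.keys ` Poly_Mapping.keys p)"

definition pd :: "nat \<Rightarrow> mpoly \<Rightarrow> mpoly" where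
  "pd i p = (\<Sum>a\<in>Poly_Mapping.keys p. mono (of_nat (Poly_Mapping.lookup (a::nat \<Rightarrow>\<^sub>0 nat) i) * Poly_Mapping.lookup p a) (a - Poly_Mapping.single i 1))"

text \<open>Renaming variable i to i + k (used to put W into variables disjoint from those of V).\<close>
definition shift_mon :: "nat \<Rightarrow> (nat \<Rightarrow>\<^sub>0 nat) \<Rightarrow> (nat \<Rightarrow>\<^sub>0 nat)" where
  "shift_mon k a = (\<Sum>i\<in>Poly_Mapping.keys a. Poly_Mapping.single (i + k) (Poly_Mapping.lookup a i))"

definition shift :: "nat \<Rightarrow> mpoly \<Rightarrow> mpoly" where
  "shift k p = (\<Sum>a\<in>Poly_Mapping.keys p. mono (Poly_Mapping.lookup p a) (shift_mon k a))"

definition wdeg :: "(nat \<Rightarrow> rat) \<Rightarrow> (nat \<Rightarrow>\<^sub>0 nat) \<Rightarrow> rat" where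
  "wdeg w a = (\<Sum>i\<in>Poly_Mapping.keys a. w i * of_nat (Poly_Mapping.lookup a i))"

definition homog :: "(nat \<Rightarrow> rat) \<Rightarrow> rat \<Rightarrow> mpoly \<Rightarrow> bool" where
  "homog w c p \<longleftrightarrow> (\<forall>a\<in>Poly_Mapping.keys p. wdeg w a = c)"

definition detn :: "nat \<Rightarrow> (nat \<Rightarrow> nat \<Rightarrow> 'a::comm_ring_1) \<Rightarrow> 'a" where
  "detn n a = (\<Sum>p\<in>{p. p permutes {..<n}}. of_int (sign p) * (\<Prod>i<n. a i (p i)))"

text \<open>Coefficient extraction: for h in C[x][y] (ys = the list of y-variables),
the C[x]-coefficient of y_1^(N-1) ... y_n^(N-1) in h.  This is the residue
Res[h dy/(y_1^N, ..., y_n^N)].\<close>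
definition coeff_ext :: "nat list \<Rightarrow> nat \<Rightarrow> mpoly \<Rightarrow> mpoly" where
  "coeff_ext ys N h =
     (\<Sum>a\<in>{a\<in>Poly_Mapping.keys h. \<forall>j<length ys. Poly_Mapping.lookup a (ys ! j) = N - 1}.
        mono (Poly_Mapping.lookup h a) (a - (\<Sum>j<length ys. Poly_Mapping.single (ys ! j) (N - 1))))"

text \<open>Grothendieck residue Res[f dy/(g_1,...,g_n)] relative to the variables ys
(f in C[x,y], g_j in C[y]), defined through the transformation law: whenever
y_j^N = sum_k a_jk g_k with a_jk in C[y], the residue equals
Res[f det(a) dy/(y_1^N,...,y_n^N)].  (Such a representation exists when
the g_j have only the origin as common zero, e.g. partial derivatives of a
quasi-homogeneous potential with isolated singularity, and the value does not
depend on it.)\<close>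
definition residue :: "nat list \<Rightarrow> mpoly list \<Rightarrow> mpoly \<Rightarrow> mpoly" where
  "residue ys gs f = (THE r. \<forall>N a.
      (N \<ge> 1 \<and> (\<forall>j<length ys. \<forall>k<length ys. vars (a j k) \<subseteq> set ys) \<and>
       (\<forall>j<length ys. Var (ys ! j) ^ N = (\<Sum>k<length ys. a j k * gs ! k)))
      \<longrightarrow> r = coeff_ext ys N (f * detn (length ys) a))"

text \<open>Matrices over mpoly of size r x r are functions nat => nat => mpoly, only
entries with indices < r matter.\<close>

definition matmul :: "nat \<Rightarrow> (nat \<Rightarrow> nat \<Rightarrow> mpoly) \<Rightarrow> (nat \<Rightarrow> nat \<Rightarrow> mpoly) \<Rightarrow> (nat \<Rightarrow> nat \<Rightarrow> mpoly)" where
  "matmul r A B = (\<lambda>i j. \<Sum>k<r. A i k * B k j)"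

definition idmat :: "nat \<Rightarrow> nat \<Rightarrow> mpoly" where
  "idmat = (\<lambda>i j. if i = j then 1 else 0)"

fun matprod :: "nat \<Rightarrow> (nat \<Rightarrow> nat \<Rightarrow> mpoly) list \<Rightarrow> (nat \<Rightarrow> nat \<Rightarrow> mpoly)" where
  "matprod r [] = idmat"
| "matprod r (M # Ms) = matmul r M (matprod r Ms)"

definition dmat :: "nat \<Rightarrow> (nat \<Rightarrow> nat \<Rightarrow> mpoly) \<Rightarrow> (nat \<Rightarrow> nat \<Rightarrow> mpoly)" where
  "dmat v D = (\<lambda>i j. pd v (D i j))"

text \<open>Supertrace: basis vectors with index < r0 span X^0 (even), those with
r0 <= index < r span X^1 (odd).\<close>
definition str :: "nat \<Rightarrow> nat \<Rightarrow> (nat \<Rightarrow> nat \<Rightarrow> mpoly) \<Rightarrow> mpoly" where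
  "str r0 r M = (\<Sum>i<r0. M i i) - (\<Sum>i\<in>{r0..<r}. M i i)"

text \<open>Setting: V in C[x_1..x_m] uses variable indices 0..m-1; W in C[y_1..y_n] is
given in variable indices 0..n-1 and is moved to indices m..m+n-1 by shift m.
X is the free module with homogeneous basis e_0..e_(r-1), e_i even iff i < r0,
deg e_i = q i; the differential is d(e_j) = sum_i D i j e_i.  w is the grading
of the variables.\<close>
definition graded_mf ::
  "nat \<Rightarrow> mpoly \<Rightarrow> nat \<Rightarrow> mpoly \<Rightarrow> (nat \<Rightarrow> rat) \<Rightarrow> nat \<Rightarrow> nat \<Rightarrow> (nat \<Rightarrow> rat)
     \<Rightarrow> (nat \<Rightarrow> nat \<Rightarrow> mpoly) \<Rightarrow> bool" where
  "graded_mf m V n W w r0 r q D \<longleftrightarrow>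
     r0 \<le> r \<and>
     (\<forall>i<r. \<forall>j<r. vars (D i j) \<subseteq> {..<m+n}) \<and>
     (\<forall>i<r. \<forall>j<r. (i < r0 \<longleftrightarrow> j < r0) \<longrightarrow> D i j = 0) \<and>
     (\<forall>i<r. \<forall>j<r. homog w (1 + q j - q i) (D i j)) \<and>
     (\<forall>i<r. \<forall>j<r. matmul r D D i j = (if i = j then shift m W - V else 0))"

definition dprod :: "nat \<Rightarrow> nat \<Rightarrow> nat \<Rightarrow> (nat \<Rightarrow> nat \<Rightarrow> mpoly) \<Rightarrow> (nat \<Rightarrow> nat \<Rightarrow> mpoly)" where
  "dprod m n r D = matprod r (map (\<lambda>v. dmat v D) [0..<m+n])"

definition qdim_l :: "nat \<Rightarrow> mpoly \<Rightarrow> nat \<Rightarrow> mpoly \<Rightarrow> nat \<Rightarrow> nat \<Rightarrow> (nat \<Rightarrow> nat \<Rightarrow> mpoly) \<Rightarrow> mpoly" where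
  "qdim_l m V n W r0 r D =
     (-1) ^ ((m + 1) choose 2) *
     residue [m..<m+n] (map (\<lambda>v. pd v (shift m W)) [m..<m+n]) (str r0 r (dprod m n r D))"

definition qdim_r :: "nat \<Rightarrow> mpoly \<Rightarrow> nat \<Rightarrow> mpoly \<Rightarrow> nat \<Rightarrow> nat \<Rightarrow> (nat \<Rightarrow> nat \<Rightarrow> mpoly) \<Rightarrow> mpoly" where
  "qdim_r m V n W r0 r D =
     (-1) ^ ((n + 1) choose 2) *
     residue [0..<m] (map (\<lambda>v. pd v V) [0..<m]) (str r0 r (dprod m n r D))"

definition orb_equiv :: "nat \<Rightarrow> mpoly \<Rightarrow> nat \<Rightarrow> mpoly \<Rightarrow> bool" where
  "orb_equiv m V n W \<longleftrightarrow>
     vars V \<subseteq> {..<m} \<and> vars W \<subseteq> {..<n} \<and>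
     (\<exists>w r0 r q D.
        (\<forall>i<m+n. w i > 0) \<and> homog w 2 V \<and> homog w 2 (shift m W) \<and>
        graded_mf m V n W w r0 r q D \<and>
        qdim_l m V n W r0 r D \<noteq> 0 \<and> qdim_r m V n W r0 r D \<noteq> 0)"

section \<open>The simple singularities in two variables (x_1 = Var 0, x_2 = Var 1)\<close>

definition VA :: "nat \<Rightarrow> mpoly" where
  "VA d = Var 0 ^ d + Var 1 ^ 2"

definition VD :: "nat \<Rightarrow> mpoly" where
  "VD d = Var 0 ^ d + Var 0 * Var 1 ^ 2"

definition VE6 :: mpoly where "VE6 = Var 0 ^ 3 + Var 1 ^ 4"
definition VE7 :: mpoly where "VE7 = Var 0 ^ 3 + Var 0 * Var 1 ^ 3"
definition VE8 :: mpoly where "VE8 = Var 0 ^ 3 + Var 1 ^ 5"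

definition ADE_set :: "mpoly set" where
  "ADE_set = {VA d | d. d \<ge> 2} \<union> {VD d | d. d \<ge> 3} \<union> {VE6, VE7, VE8}"

definition ADE_classes :: "mpoly set set" where
  "ADE_classes =
      {{VA d} | d. d \<ge> 2 \<and> odd d}
    \<union> {{VA 2}, {VA 4}}
    \<union> {{VA d, VD (d div 2)} | d. even d \<and> d \<ge> 6 \<and> d \<notin> {12, 18, 30}}
    \<union> {{VA 12, VD 6, VE6}, {VA 18, VD 9, VE7}, {VA 30, VD 15, VE8}}"

end

theory Submission
  imports Defs
begin

text \<open>
  Write \<open>c(V)\<close> for the sum of \<open>1 - |x|\<close> over the variables; it equals \<open>1 - 2 / h\<close> for the Coxeter
  number \<open>h\<close>. The left quantum dimension is a quasi-homogeneous polynomial of degree \<open>c(V) - c(W)\<close>, the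
  right one of degree \<open>c(W) - c(V)\<close>, so if both are non-zero then \<open>V\<close> and \<open>W\<close> have the same \<open>h\<close>.

  Conversely, a matrix \<open>P\<close> with \<open>P\<^sup>2 = W - u\<^sup>h\<close> gives the factorisation with blocks \<open>P - v\<close> and \<open>P + v\<close>
  of \<open>W - u\<^sup>h - v\<^sup>2\<close>. For \<open>E\<^sub>6\<close> and \<open>E\<^sub>7\<close> such a \<open>P\<close> comes from a polynomial section of the elliptic
  fibration \<open>v\<^sup>2 = W - u\<^sup>h\<close>: if \<open>W(l, y) - u\<^sup>h = Q\<^sup>2\<close> then \<open>W - u\<^sup>h = (x - l) (\<dots>) + Q\<^sup>2\<close>. For \<open>E\<^sub>8\<close> the section
  has a pole along \<open>u = 0\<close>; it becomes polynomial in \<open>s = y / u\<close>, and restricting scalars from \<open>s\<close> to the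
  variable \<open>x\<close>, which is quadratic in \<open>s\<close>, doubles the rank. Type D is obtained from type A by
  putting \<open>v = u q\<close> and restricting scalars from \<open>u\<close> to \<open>p = u\<^sup>2\<close>. As the quantum dimensions have
  degree 0, their non-vanishing can be tested by evaluating the supertrace at one or two points.
\<close>

text \<open>A non-zero polynomial in variables of positive weight has degree at least 0, so two
  non-zero quantum dimensions of opposite degrees both have degree 0. Every pair of types with a
  common Coxeter number gets its own factorisation, D with E included. To serve A and D together,
  \<open>P\<close> is split as \<open>P0 + u P1\<close> with \<open>P0\<close>, \<open>P1\<close>
  polynomial in \<open>p = u^2\<close>. Reading this over \<open>u\<close> gives type A, over
  \<open>p\<close> type D. Restriction to \<open>p\<close> keeps only the part of the trace that is
  even in \<open>u\<close>, hence the hypotheses on \<open>hE\<close>. The sections come from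
  undetermined coefficients: homogeneity leaves finitely many of them, and comparing powers of
  \<open>y\<close> (for E8, of \<open>y / u\<close>) determines them up to conjugation, with some
  constant \<open>K\<close> in front of \<open>u^h\<close> that is scaled away afterwards. The
  solutions have degree 2, 3 and 4 over the rationals for E6, E7 and E8, so each case ends with
  arithmetic in a number field proving that \<open>K\<close> and one trace value are non-zero. The
  residue is a definite description; its value is pinned down by a syzygy argument in two
  variables.\<close>

lemma mpoly_eq_sum_mono: "(p::mpoly) = (\<Sum>a\<in>Poly_Mapping.keys p. mono (Poly_Mapping.lookup p a) a)"
proof (rule poly_mapping_eqI)
  fix k
  have "Poly_Mapping.lookup (\<Sum>a\<in>Poly_Mapping.keys p. mono (Poly_Mapping.lookup p a) a) k
      = (\<Sum>a\<in>Poly_Mapping.keys p. if a = k then Poly_Mapping.lookup p k else 0)"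
    unfolding lookup_sum by (intro sum.cong) (auto simp: mono_def lookup_single when_def)
  also have "\<dots> = Poly_Mapping.lookup p k"
    by (simp add: sum.delta in_keys_iff)
  finally show "Poly_Mapping.lookup p k
      = Poly_Mapping.lookup (\<Sum>a\<in>Poly_Mapping.keys p. mono (Poly_Mapping.lookup p a) a) k" by simp
qed

lemma mono_0 [simp]: "mono 0 a = 0"
  by (simp add: mono_def)

lemma mono_mult: "mono c a * mono d b = mono (c * d) (a + b)"
  by (simp add: mono_def mult_single)

lemma mono_add: "mono (c + d) a = mono c a + mono d a"
  by (simp add: mono_def single_add)

lemma lookup_mono: "Poly_Mapping.lookup (mono c a) b = (if a = b then c else 0)"
  by (simp add: mono_def lookup_single when_def)

lemma mpoly_mono_induct [case_names mono add]:
  assumes "\<And>c a. P (mono c a)" "\<And>p q. P p \<Longrightarrow> P q \<Longrightarrow> P (p + q)"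
  shows "P (p::mpoly)"
proof -
  have "P (\<Sum>a\<in>A. mono (Poly_Mapping.lookup p a) a)" if "finite A" for A
    using that
  proof (induction A rule: finite_induct)
    case empty
    show ?case using assms(1)[of 0 0] by simp
  next
    case (insert x F)
    then show ?case using assms by simp
  qed
  from this[of "Poly_Mapping.keys p"] show ?thesis
    using mpoly_eq_sum_mono[of p] by simp
qed

section \<open>Constant polynomials and induction over polynomials\<close>

definition Cst :: "complex \<Rightarrow> mpoly" where
  "Cst c = mono c 0"

lemma Cst_0 [simp]: "Cst 0 = 0" and Cst_1 [simp]: "Cst 1 = 1"
  by (simp_all add: Cst_def mono_def)

lemma Cst_add: "Cst (a + b) = Cst a + Cst b"
  and Cst_mult: "Cst (a * b) = Cst a * Cst b"
  and Cst_minus: "Cst (- a) = - Cst a"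
  by (simp_all add: Cst_def mono_add mono_mult) (simp add: mono_def single_uminus)

lemma Cst_diff: "Cst (a - b) = Cst a - Cst b"
  using Cst_add[of a "- b"] by (simp add: Cst_minus)

lemma Cst_numeral [simp]: "Cst (numeral n) = numeral n"
  by (simp add: Cst_def mono_def)

lemma Cst_of_nat: "Cst (of_nat n) = of_nat n"
  by (simp add: Cst_def mono_def)

lemma Cst_power: "Cst (a ^ n) = Cst a ^ n"
  by (induction n) (simp_all add: Cst_mult)

text \<open>Maps that are additive and obey a product rule, such as substitutions and derivatives,
  can thus be compared on constants and on one factor \<open>Var i\<close> at a time. A monomial is
  reached by raising one exponent after another.\<close>

lemma mpoly_induct [case_names Cst add mult]:
  assumes C: "\<And>c. P (Cst c)" and A: "\<And>p q. P p \<Longrightarrow> P q \<Longrightarrow> P (p + q)"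
    and M: "\<And>p i. P p \<Longrightarrow> P (p * Var i)"
  shows "P (p::mpoly)"
proof (induction p rule: mpoly_mono_induct)
  case (mono c a)
  show ?case
  proof (induction a rule: update_induct)
    case const
    then show ?case using C[of c] by (simp add: Cst_def)
  next
    case (update a i n)
    have *: "P (mono c (a + Poly_Mapping.single i n))" for n
    proof (induction n)
      case 0
      then show ?case using update by simp
    next
      case (Suc n)
      have "mono c (a + Poly_Mapping.single i (Suc n)) = mono c (a + Poly_Mapping.single i n) * Var i"
        by (simp add: Var_def mono_mult single_add[symmetric] add.assoc)
      then show ?case using M[OF Suc] by simp
    qed
    have "Poly_Mapping.update i n a = a + Poly_Mapping.single i n"
      by (rule poly_mapping_eqI)
        (use update in \<open>auto simp: lookup_update lookup_add lookup_single when_def in_keys_iff\<close>)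
    with * show ?case by simp
  qed
next
  case (add p q)
  then show ?case by (rule A)
qed

section \<open>Evaluation and substitution\<close>

text \<open>Evaluation at a point (\<open>g = id\<close>) and substitution of polynomials
  (\<open>g = Cst\<close>) are one construction; both inherit their homomorphism laws from
  here.\<close>

locale coeff_hom =
  fixes g :: "complex \<Rightarrow> 'b::comm_ring_1"
  assumes hom_add: "g (a + b) = g a + g b" and hom_mult: "g (a * b) = g a * g b"
    and hom_one: "g 1 = 1"
begin

lemma hom_zero: "g 0 = 0"
  using hom_add[of 0 0] by simp

end

definition mpow :: "(nat \<Rightarrow> 'b::comm_ring_1) \<Rightarrow> (nat \<Rightarrow>\<^sub>0 nat) \<Rightarrow> 'b" where
  "mpow s a = (\<Prod>i\<in>Poly_Mapping.keys a. s i ^ Poly_Mapping.lookup a i)"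

lemma mpow_superset:
  assumes "finite S" "Poly_Mapping.keys a \<subseteq> S"
  shows "mpow s a = (\<Prod>i\<in>S. s i ^ Poly_Mapping.lookup a i)"
  unfolding mpow_def
  by (rule prod.mono_neutral_left) (use assms in \<open>auto simp: in_keys_iff\<close>)

lemma mpow_add: "mpow s (a + b) = mpow s a * mpow s b"
proof -
  let ?S = "Poly_Mapping.keys a \<union> Poly_Mapping.keys b"
  have "mpow s (a + b) = (\<Prod>i\<in>?S. s i ^ Poly_Mapping.lookup (a + b) i)"
    by (rule mpow_superset) (simp_all add: keys_add)
  also have "\<dots> = (\<Prod>i\<in>?S. s i ^ Poly_Mapping.lookup a i) * (\<Prod>i\<in>?S. s i ^ Poly_Mapping.lookup b i)"
    by (simp add: lookup_add power_add prod.distrib)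
  also have "\<dots> = mpow s a * mpow s b"
    by (subst (1 2) mpow_superset[of ?S]) auto
  finally show ?thesis .
qed

lemma mpow_0 [simp]: "mpow s 0 = 1"
  by (simp add: mpow_def)

lemma mpow_single [simp]: "mpow s (Poly_Mapping.single i n) = s i ^ n"
  by (cases "n = 0") (simp_all add: mpow_def)

definition ins :: "(complex \<Rightarrow> 'b::comm_ring_1) \<Rightarrow> (nat \<Rightarrow> 'b) \<Rightarrow> mpoly \<Rightarrow> 'b" where
  "ins g s p = (\<Sum>a\<in>Poly_Mapping.keys p. g (Poly_Mapping.lookup p a) * mpow s a)"

context coeff_hom
begin

lemma ins_superset:
  assumes "finite S" "Poly_Mapping.keys p \<subseteq> S"
  shows "ins g s p = (\<Sum>a\<in>S. g (Poly_Mapping.lookup p a) * mpow s a)"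
  unfolding ins_def
  by (rule sum.mono_neutral_left) (use assms in \<open>auto simp: in_keys_iff hom_zero\<close>)

lemma ins_add: "ins g s (p + q) = ins g s p + ins g s q"
proof -
  let ?S = "Poly_Mapping.keys p \<union> Poly_Mapping.keys q"
  have "ins g s (p + q) = (\<Sum>a\<in>?S. g (Poly_Mapping.lookup (p + q) a) * mpow s a)"
    by (rule ins_superset) (simp_all add: keys_add)
  also have "\<dots> = (\<Sum>a\<in>?S. g (Poly_Mapping.lookup p a) * mpow s a) + (\<Sum>a\<in>?S. g (Poly_Mapping.lookup q a) * mpow s a)"
    by (simp add: lookup_add hom_add distrib_right sum.distrib)
  also have "\<dots> = ins g s p + ins g s q"
    by (subst (1 2) ins_superset[of ?S]) auto
  finally show ?thesis .
qed

lemma ins_mono: "ins g s (mono c a) = g c * mpow s a"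
  by (subst ins_superset[of "{a}"]) (auto simp: mono_def)

lemma ins_mult: "ins g s (p * q) = ins g s p * ins g s q"
proof (induction p rule: mpoly_mono_induct)
  case (mono c a)
  show ?case
    by (induction q rule: mpoly_mono_induct)
      (simp_all add: mono_mult ins_mono hom_mult mpow_add ins_add distrib_left mult_ac)
qed (simp_all add: ins_add distrib_right)

lemma ins_Cst: "ins g s (Cst c) = g c"
  by (simp add: Cst_def ins_mono)

lemma ins_Var: "ins g s (Var i) = s i"
  by (simp add: Var_def ins_mono hom_one)

lemma ins_0: "ins g s 0 = 0"
  by (simp add: ins_def)

lemma ins_1: "ins g s 1 = 1"
  using ins_Cst[of s 1] by (simp add: hom_one)

lemma ins_uminus: "ins g s (- p) = - ins g s p"
  using ins_add[of s p "- p"] by (simp add: ins_0 add_eq_0_iff)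

lemma ins_diff: "ins g s (p - q) = ins g s p - ins g s q"
  using ins_add[of s p "- q"] by (simp add: ins_uminus)

lemma ins_numeral: "ins g s (numeral n) = numeral n"
proof (induction n)
  case One
  then show ?case by (simp add: ins_1)
next
  case (Bit0 n)
  then show ?case by (metis ins_add numeral_Bit0)
next
  case (Bit1 n)
  then show ?case by (metis ins_add ins_1 numeral_Bit1)
qed

lemma ins_power: "ins g s (p ^ n) = ins g s p ^ n"
  by (induction n) (simp_all add: ins_1 ins_mult)

lemma ins_sum: "ins g s (sum f A) = (\<Sum>x\<in>A. ins g s (f x))"
  by (induction A rule: infinite_finite_induct) (simp_all add: ins_0 ins_add)

lemmas ins_simps = ins_0 ins_1 ins_numeral ins_Cst ins_Var ins_add ins_diff ins_uminus ins_mult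
  ins_power ins_sum

end

definition ev :: "(nat \<Rightarrow> complex) \<Rightarrow> mpoly \<Rightarrow> complex" where
  "ev = ins id"

definition subst :: "(nat \<Rightarrow> mpoly) \<Rightarrow> mpoly \<Rightarrow> mpoly" where
  "subst = ins Cst"

interpretation id_hom: coeff_hom "id :: complex \<Rightarrow> complex"
  by unfold_locales simp_all

interpretation Cst_hom: coeff_hom Cst
  by unfold_locales (simp_all add: Cst_add Cst_mult)

lemmas ev_simps [simp] = id_hom.ins_simps[folded ev_def, unfolded id_apply]
lemmas subst_simps [simp] = Cst_hom.ins_simps[folded subst_def]

lemma ev_subst: "ev s (subst t p) = ev (\<lambda>i. ev s (t i)) p"
  by (induction p rule: mpoly_induct) simp_all

section \<open>Derivatives\<close>

lemma pd_superset:
  assumes "finite S" "Poly_Mapping.keys p \<subseteq> S"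
  shows "pd i p = (\<Sum>a\<in>S. mono (of_nat (Poly_Mapping.lookup a i) * Poly_Mapping.lookup p a) (a - Poly_Mapping.single i 1))"
  unfolding pd_def
  by (rule sum.mono_neutral_left) (use assms in \<open>auto simp: in_keys_iff\<close>)

lemma pd_add [simp]: "pd i (p + q) = pd i p + pd i q"
proof -
  let ?S = "Poly_Mapping.keys p \<union> Poly_Mapping.keys q"
  let ?f = "\<lambda>p a. mono (of_nat (Poly_Mapping.lookup a i) * Poly_Mapping.lookup p a) (a - Poly_Mapping.single i 1)"
  have "pd i (p + q) = (\<Sum>a\<in>?S. ?f (p + q) a)"
    by (rule pd_superset) (simp_all add: keys_add)
  also have "\<dots> = (\<Sum>a\<in>?S. ?f p a) + (\<Sum>a\<in>?S. ?f q a)"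
    by (simp add: lookup_add distrib_left mono_add sum.distrib)
  also have "\<dots> = pd i p + pd i q"
    by (subst (1 2) pd_superset[of ?S]) auto
  finally show ?thesis .
qed

lemma pd_mono: "pd i (mono c a) = mono (of_nat (Poly_Mapping.lookup a i) * c) (a - Poly_Mapping.single i 1)"
  by (subst pd_superset[of "{a}"]) (simp_all add: lookup_mono, simp add: mono_def)

lemma minus_single_add:
  fixes a b :: "nat \<Rightarrow>\<^sub>0 nat"
  assumes "Poly_Mapping.lookup a i \<noteq> 0"
  shows "a - Poly_Mapping.single i 1 + b = a + b - Poly_Mapping.single i 1"
  by (rule poly_mapping_eqI)
    (use assms in \<open>auto simp: lookup_add lookup_minus lookup_single when_def\<close>)

lemma pd_mult [simp]: "pd i (p * q) = pd i p * q + p * pd i q"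
proof (induction p rule: mpoly_mono_induct)
  case (mono c a)
  show ?case
  proof (induction q rule: mpoly_mono_induct)
    case (mono d b)
    let ?e = "a + b - Poly_Mapping.single i 1"
    have 1: "mono (of_nat (Poly_Mapping.lookup a i) * c) (a - Poly_Mapping.single i 1) * mono d b
        = mono (of_nat (Poly_Mapping.lookup a i) * c * d) ?e"
      using minus_single_add[of a i b] by (cases "Poly_Mapping.lookup a i = 0") (simp_all add: mono_mult)
    have 2: "mono c a * mono (of_nat (Poly_Mapping.lookup b i) * d) (b - Poly_Mapping.single i 1)
        = mono (of_nat (Poly_Mapping.lookup b i) * c * d) ?e"
      using minus_single_add[of b i a] by (cases "Poly_Mapping.lookup b i = 0") (simp_all add: mono_mult add.commute mult_ac)
    have 3: "pd i (mono c a * mono d b) = mono (of_nat (Poly_Mapping.lookup (a + b) i) * (c * d)) ?e"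
      by (simp only: mono_mult pd_mono)
    show ?case
      unfolding 3 unfolding pd_mono 1 2 mono_add[symmetric] by (simp add: lookup_add algebra_simps)
  qed (simp_all add: distrib_left add_ac)
qed (simp_all add: distrib_right add_ac)

lemma pd_Cst [simp]: "pd i (Cst c) = 0"
  by (simp add: Cst_def pd_mono)

lemma pd_Var [simp]: "pd i (Var j) = (if i = j then 1 else 0)"
  by (auto simp: Var_def pd_mono lookup_single when_def) (simp add: mono_def)

lemma pd_0 [simp]: "pd i 0 = 0" and pd_1 [simp]: "pd i 1 = 0"
  using pd_Cst[of i 0] pd_Cst[of i 1] by (simp_all del: pd_Cst)

lemma pd_numeral [simp]: "pd i (numeral n) = 0"
  using pd_Cst[of i "numeral n"] by (simp del: pd_Cst)

lemma pd_uminus [simp]: "pd i (- p) = - pd i p"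
  using pd_add[of i p "- p"] by (simp add: add_eq_0_iff del: pd_add)

lemma pd_diff [simp]: "pd i (p - q) = pd i p - pd i q"
  using pd_add[of i p "- q"] by (simp del: pd_add)

lemma pd_power: "pd i (p ^ n) = of_nat n * p ^ (n - 1) * pd i p"
proof (induction n)
  case (Suc n)
  then show ?case by (cases n) (simp_all add: algebra_simps)
qed simp

lemma pd_sum: "pd i (sum f A) = (\<Sum>x\<in>A. pd i (f x))"
  by (induction A rule: infinite_finite_induct) simp_all

section \<open>Variables and homogeneity\<close>

lemma vars_add: "vars (p + q) \<subseteq> vars p \<union> vars q"
  using keys_add[of p q] by (auto simp: vars_def)

lemma vars_mult: "vars (p * q) \<subseteq> vars p \<union> vars q"
proof
  fix i assume "i \<in> vars (p * q)"
  then obtain c where c: "c \<in> Poly_Mapping.keys (p * q)" "i \<in> Poly_Mapping.keys c"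
    by (auto simp: vars_def)
  then obtain a b where "a \<in> Poly_Mapping.keys p" "b \<in> Poly_Mapping.keys q" "c = a + b"
    using keys_mult[of p q] by auto
  then show "i \<in> vars p \<union> vars q"
    using c keys_add[of a b] by (auto simp: vars_def)
qed

lemma vars_Cst [simp]: "vars (Cst c) = {}"
  by (auto simp: vars_def Cst_def mono_def)

lemma vars_0 [simp]: "vars 0 = {}" and vars_1 [simp]: "vars 1 = {}"
  and vars_numeral [simp]: "vars (numeral n) = {}"
  using vars_Cst[of 0] vars_Cst[of 1] vars_Cst[of "numeral n"] by (simp_all del: vars_Cst)

lemma vars_Var [simp]: "vars (Var i) = {i}"
  by (simp add: vars_def Var_def mono_def)

lemma vars_uminus [simp]: "vars (- p) = vars p"
  by (simp add: vars_def)

lemma vars_subI: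
  "vars 0 \<subseteq> S" "vars 1 \<subseteq> S" "vars (numeral n) \<subseteq> S" "vars (Cst c) \<subseteq> S"
  "i \<in> S \<Longrightarrow> vars (Var i) \<subseteq> S"
  "vars p \<subseteq> S \<Longrightarrow> vars (- p) \<subseteq> S"
  "vars p \<subseteq> S \<Longrightarrow> vars q \<subseteq> S \<Longrightarrow> vars (p + q) \<subseteq> S"
  "vars p \<subseteq> S \<Longrightarrow> vars q \<subseteq> S \<Longrightarrow> vars (p - q) \<subseteq> S"
  "vars p \<subseteq> S \<Longrightarrow> vars q \<subseteq> S \<Longrightarrow> vars (p * q) \<subseteq> S"
  using vars_add[of p q] vars_add[of p "- q"] vars_mult[of p q] by auto

lemma vars_power_subI: "vars p \<subseteq> S \<Longrightarrow> vars (p ^ n) \<subseteq> S"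
  by (induction n) (simp_all add: vars_subI)

lemma vars_sum_subI: "(\<And>x. x \<in> A \<Longrightarrow> vars (f x) \<subseteq> S) \<Longrightarrow> vars (sum f A) \<subseteq> S"
  by (induction A rule: infinite_finite_induct) (simp_all add: vars_subI)

lemma subst_eq_sum: "subst s p = (\<Sum>a\<in>Poly_Mapping.keys p. Cst (Poly_Mapping.lookup p a) * mpow s a)"
  by (simp add: subst_def ins_def)

lemma vars_subst_subI:
  assumes "\<And>i. i \<in> vars p \<Longrightarrow> vars (s i) \<subseteq> S"
  shows "vars (subst s p) \<subseteq> S"
  unfolding subst_eq_sum
proof (intro vars_sum_subI vars_subI(9))
  fix a assume a: "a \<in> Poly_Mapping.keys p"
  have "vars (\<Prod>i\<in>A. s i ^ Poly_Mapping.lookup a i) \<subseteq> S" if "A \<subseteq> Poly_Mapping.keys a" for A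
    using finite_subset[OF that finite_keys] that
  proof (induction A rule: finite_induct)
    case (insert x F)
    then have "vars (s x) \<subseteq> S" using a by (intro assms) (auto simp: vars_def)
    with insert show ?case by (simp add: vars_subI vars_power_subI)
  qed simp
  then show "vars (mpow s a) \<subseteq> S" by (simp add: mpow_def)
qed simp

lemma wdeg_superset:
  assumes "finite S" "Poly_Mapping.keys a \<subseteq> S"
  shows "wdeg w a = (\<Sum>i\<in>S. w i * of_nat (Poly_Mapping.lookup a i))"
  unfolding wdeg_def
  by (rule sum.mono_neutral_left) (use assms in \<open>auto simp: in_keys_iff\<close>)

lemma wdeg_add: "wdeg w (a + b) = wdeg w a + wdeg w b"
proof -
  let ?S = "Poly_Mapping.keys a \<union> Poly_Mapping.keys b"
  have "wdeg w (a + b) = (\<Sum>i\<in>?S. w i * of_nat (Poly_Mapping.lookup (a + b) i))"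
    by (rule wdeg_superset) (simp_all add: keys_add)
  also have "\<dots> = (\<Sum>i\<in>?S. w i * of_nat (Poly_Mapping.lookup a i)) + (\<Sum>i\<in>?S. w i * of_nat (Poly_Mapping.lookup b i))"
    by (simp add: lookup_add algebra_simps sum.distrib)
  also have "\<dots> = wdeg w a + wdeg w b"
    by (subst (1 2) wdeg_superset[of ?S]) auto
  finally show ?thesis .
qed

lemma wdeg_0 [simp]: "wdeg w 0 = 0"
  by (simp add: wdeg_def)

lemma wdeg_single [simp]: "wdeg w (Poly_Mapping.single i n) = w i * of_nat n"
  by (cases "n = 0") (simp_all add: wdeg_def)

lemma homog_0: "homog w c 0"
  by (simp add: homog_def)

lemma homog_mono: "wdeg w a = c \<Longrightarrow> homog w c (mono k a)"
  by (cases "k = 0") (simp_all add: homog_def mono_def)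

lemma homog_Cst: "c = 0 \<Longrightarrow> homog w c (Cst k)"
  by (simp add: Cst_def homog_mono)

lemma homog_Var: "c = w i \<Longrightarrow> homog w c (Var i)"
  by (simp add: Var_def homog_mono)

lemma homog_add: "homog w c p \<Longrightarrow> homog w c q \<Longrightarrow> homog w c (p + q)"
  using keys_add[of p q] by (auto simp: homog_def)

lemma homog_uminus: "homog w c p \<Longrightarrow> homog w c (- p)"
  by (simp add: homog_def)

lemma homog_diff: "homog w c p \<Longrightarrow> homog w c q \<Longrightarrow> homog w c (p - q)"
  using homog_add[of w c p "- q"] by (simp add: homog_uminus)

lemma homog_mult: "homog w c p \<Longrightarrow> homog w d q \<Longrightarrow> e = c + d \<Longrightarrow> homog w e (p * q)"
  using keys_mult[of p q] by (auto simp: homog_def wdeg_add)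

lemma homog_sum: "(\<And>x. x \<in> A \<Longrightarrow> homog w c (f x)) \<Longrightarrow> homog w c (sum f A)"
  by (induction A rule: infinite_finite_induct) (simp_all add: homog_0 homog_add)

lemma homog_1: "c = 0 \<Longrightarrow> homog w c 1"
  using homog_Cst[of c w 1] by simp

lemma homog_numeral: "c = 0 \<Longrightarrow> homog w c (numeral n)"
  using homog_Cst[of c w "numeral n"] by simp

lemma homog_power: "homog w c p \<Longrightarrow> e = of_nat n * c \<Longrightarrow> homog w e (p ^ n)"
proof (induction n arbitrary: e)
  case (Suc n)
  then show ?case by (auto intro!: homog_mult simp: algebra_simps)
qed (simp add: homog_1)

lemma homog_pd:
  assumes "homog w c p" "e = c - w i"
  shows "homog w e (pd i p)"
  unfolding pd_def
proof (rule homog_sum)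
  fix a assume a: "a \<in> Poly_Mapping.keys p"
  show "homog w e (mono (of_nat (Poly_Mapping.lookup a i) * Poly_Mapping.lookup p a) (a - Poly_Mapping.single i 1))"
  proof (cases "Poly_Mapping.lookup a i = 0")
    case False
    then have "a = a - Poly_Mapping.single i 1 + Poly_Mapping.single i 1"
      by (intro poly_mapping_eqI) (auto simp: lookup_add lookup_minus lookup_single when_def)
    then have "wdeg w a = wdeg w (a - Poly_Mapping.single i 1) + w i"
      using wdeg_add[of w "a - Poly_Mapping.single i 1" "Poly_Mapping.single i 1"] by simp
    then show ?thesis using assms a by (intro homog_mono) (simp add: homog_def)
  qed (simp add: homog_0)
qed

lemma homog_subst:
  assumes "homog w c p" "\<And>i. homog w' (w i) (s i)"
  shows "homog w' c (subst s p)"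
  unfolding subst_eq_sum
proof (rule homog_sum)
  fix a assume a: "a \<in> Poly_Mapping.keys p"
  have "homog w' (\<Sum>i\<in>A. w i * of_nat (Poly_Mapping.lookup a i)) (\<Prod>i\<in>A. s i ^ Poly_Mapping.lookup a i)" if "finite A" for A
    using that
    by (induction A rule: finite_induct)
      (auto intro!: homog_1 homog_mult homog_power assms(2))
  from this[of "Poly_Mapping.keys a"] have "homog w' (wdeg w a) (mpow s a)"
    by (simp add: mpow_def wdeg_def)
  then show "homog w' c (Cst (Poly_Mapping.lookup p a) * mpow s a)"
    using assms(1) a by (intro homog_mult[of _ 0 _ c]) (auto simp: homog_def[of w] intro: homog_Cst)
qed

section \<open>Shift as a substitution\<close>

lemma mpow_Var: "mpow (\<lambda>i. Var (i + k)) a = mono 1 (shift_mon k a)"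
proof -
  have "(\<Prod>i\<in>A. Var (i + k) ^ f i) = mono 1 (\<Sum>i\<in>A. Poly_Mapping.single (i + k) (f i))" if "finite A" for A and f :: "nat \<Rightarrow> nat"
    using that
  proof (induction A rule: finite_induct)
    case empty
    show ?case by (simp add: mono_def)
  next
    case (insert x F)
    have "Var j ^ n = mono 1 (Poly_Mapping.single j n)" for j n
      by (induction n) (simp_all add: Var_def mono_mult single_add[symmetric], simp add: mono_def)
    with insert show ?case by (simp add: mono_mult)
  qed
  then show ?thesis by (simp add: mpow_def shift_mon_def)
qed

lemma shift_eq_subst: "shift k p = subst (\<lambda>i. Var (i + k)) p"
  by (simp add: shift_def subst_eq_sum mpow_Var Cst_def mono_mult)

section \<open>Grothendieck residues in two variables\<close>

lemma Var_power: "Var i ^ n = mono 1 (Poly_Mapping.single i n)"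
  by (induction n) (simp_all add: Var_def mono_mult single_add[symmetric], simp add: mono_def)

lemma lookup_mono_mult_add:
  "Poly_Mapping.lookup (mono c t * h) (m + t) = c * Poly_Mapping.lookup h m"
proof (induction h rule: mpoly_mono_induct)
  case (mono d b)
  have "t + b = m + t \<longleftrightarrow> b = m" by (metis add.commute add_left_cancel)
  then show ?case by (simp add: mono_mult lookup_mono)
qed (simp_all add: distrib_left lookup_add)

lemma lookup_mono_mult_0:
  assumes "Poly_Mapping.lookup k i < Poly_Mapping.lookup t i"
  shows "Poly_Mapping.lookup (mono c t * h) k = 0"
proof (induction h rule: mpoly_mono_induct)
  case (mono d b)
  have "t + b \<noteq> k" using assms by (auto simp: lookup_add)
  then show ?case by (simp add: mono_mult lookup_mono)
qed (simp_all add: distrib_left lookup_add)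

lemma lookup_coeff_ext:
  assumes "i \<noteq> j"
  shows "Poly_Mapping.lookup (coeff_ext [i, j] N h) m =
    (if Poly_Mapping.lookup m i = 0 \<and> Poly_Mapping.lookup m j = 0
     then Poly_Mapping.lookup h (m + (Poly_Mapping.single i (N - 1) + Poly_Mapping.single j (N - 1)))
     else 0)"
proof -
  let ?A = "{a\<in>Poly_Mapping.keys h. \<forall>l<length [i, j]. Poly_Mapping.lookup a ([i, j] ! l) = N - 1}"
  define t where "t = Poly_Mapping.single i (N - 1) + Poly_Mapping.single j (N - 1)"
  have t: "(\<Sum>l<length [i, j]. Poly_Mapping.single ([i, j] ! l) (N - 1)) = t"
    by (simp add: t_def lessThan_Suc add.commute)
  have A: "?A = {a\<in>Poly_Mapping.keys h. Poly_Mapping.lookup a i = N - 1 \<and> Poly_Mapping.lookup a j = N - 1}"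
    by (auto simp: less_Suc_eq)
  have lt: "Poly_Mapping.lookup t k = (if k = i \<or> k = j then N - 1 else 0)" for k
    using assms by (auto simp: t_def lookup_add lookup_single when_def)
  have eq: "a - t = m \<longleftrightarrow> Poly_Mapping.lookup m i = 0 \<and> Poly_Mapping.lookup m j = 0 \<and> a = m + t" if "a \<in> ?A" for a
  proof
    assume "a - t = m"
    then show "Poly_Mapping.lookup m i = 0 \<and> Poly_Mapping.lookup m j = 0 \<and> a = m + t"
      using that unfolding A by (auto simp: lookup_minus lt lookup_add intro!: poly_mapping_eqI)
  qed (simp add: lookup_minus)
  have "Poly_Mapping.lookup (coeff_ext [i, j] N h) m
      = (\<Sum>a\<in>?A. if a - t = m then Poly_Mapping.lookup h a else 0)"
    unfolding coeff_ext_def t by (simp add: lookup_sum lookup_mono)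
  also have "\<dots> = (\<Sum>a\<in>?A. if a = m + t then (if Poly_Mapping.lookup m i = 0 \<and> Poly_Mapping.lookup m j = 0
      then Poly_Mapping.lookup h (m + t) else 0) else 0)"
    by (intro sum.cong) (auto simp: eq)
  also have "\<dots> = (if Poly_Mapping.lookup m i = 0 \<and> Poly_Mapping.lookup m j = 0
      then Poly_Mapping.lookup h (m + t) else 0)"
    unfolding A by (subst sum.delta) (auto simp: lookup_add lt in_keys_iff)
  finally show ?thesis by (simp add: t_def)
qed

section \<open>Independence of the residue from the chosen representation\<close>

lemma detn_2: "detn 2 a = a 0 0 * a 1 1 - a 0 1 * a 1 0"
proof -
  have "{..<2::nat} = {0, 1}" by auto
  then have "{p. p permutes {..<2::nat}} = {id, Transposition.transpose 0 1}"
    by (auto simp: permutes_doubleton_iff)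
  moreover have "id \<noteq> Transposition.transpose 0 (1::nat)"
    by (metis id_apply transpose_apply_first zero_neq_one)
  ultimately show ?thesis
    by (simp add: detn_def sign_swap_id numeral_2_eq_2 lessThan_Suc)
qed

text \<open>Powers of different variables are coprime, so \<open>Var j ^ L\<close> divides \<Delta>.
  The divisibility is phrased as vanishing of coefficients, the form in which coefficient extraction
  uses it.\<close>

lemma lookup_eq_0_of_power_dvd:
  assumes "i \<noteq> j" "Var i ^ L * \<Delta> = Var j ^ L * h" "Poly_Mapping.lookup k j < L"
  shows "Poly_Mapping.lookup \<Delta> k = 0"
proof -
  have "Poly_Mapping.lookup \<Delta> k = Poly_Mapping.lookup (Var i ^ L * \<Delta>) (k + Poly_Mapping.single i L)"
    by (simp add: Var_power lookup_mono_mult_add)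
  also have "\<dots> = 0"
    unfolding assms(2) unfolding Var_power
    by (rule lookup_mono_mult_0[where i = j]) (use assms(1,3) in \<open>simp add: lookup_add lookup_single when_def\<close>)
  finally show ?thesis .
qed

lemma lookup_mult_eq_0:
  assumes "\<And>k. Poly_Mapping.lookup k j < L \<Longrightarrow> Poly_Mapping.lookup \<Delta> k = 0"
    and "Poly_Mapping.lookup k j < L"
  shows "Poly_Mapping.lookup (f * \<Delta> :: mpoly) k = 0"
proof (rule ccontr)
  assume "Poly_Mapping.lookup (f * \<Delta>) k \<noteq> 0"
  then have "k \<in> Poly_Mapping.keys (f * \<Delta>)" by (simp add: in_keys_iff)
  then obtain a b where "b \<in> Poly_Mapping.keys \<Delta>" "k = a + b"
    using keys_mult[of f \<Delta>] by auto
  then show False using assms(1)[of b] assms(2) by (auto simp: in_keys_iff lookup_add)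
qed

text \<open>Cramer's rule: if the rows \<open>(c0, c1)\<close> and \<open>(a10, a11)\<close> send \<open>(g1, g2)\<close> to
  \<open>0\<close> and \<open>Q\<close>, then \<open>(g1, g2)\<close> times the determinant is a multiple of \<open>Q\<close>.\<close>
lemma det_syzygy:
  fixes g1 :: mpoly
  assumes "c0 * g1 + c1 * g2 = 0" "Q = a10 * g1 + a11 * g2" "P = a00 * g1 + a01 * g2"
  shows "P * (c0 * a11 - c1 * a10) = Q * (a01 * c0 - a00 * c1)"
proof -
  have "P * (c0 * a11 - c1 * a10) - Q * (a01 * c0 - a00 * c1)
      = (a00 * a11 - a01 * a10) * (c0 * g1 + c1 * g2)"
    unfolding assms(2,3) by (simp add: algebra_simps)
  then show ?thesis using assms(1) by simp
qed

text \<open>The two rows are exchanged one at a time. Each exchange changes the determinant by one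
  that has a syzygy of \<open>(g1, g2)\<close> as a row; by \<open>det_syzygy\<close> the first
  change is divisible by \<open>Var j ^ L\<close>, the second by \<open>Var i ^ L\<close>, and
  neither reaches a coefficient with both exponents below \<open>L\<close>.\<close>

lemma lookup_det_independent:
  assumes ij: "i \<noteq> j"
    and a: "Var i ^ L = a00 * g1 + a01 * g2" "Var j ^ L = a10 * g1 + a11 * g2"
    and b: "Var i ^ L = b00 * g1 + b01 * g2" "Var j ^ L = b10 * g1 + b11 * g2"
    and k: "Poly_Mapping.lookup k i < L" "Poly_Mapping.lookup k j < L"
  shows "Poly_Mapping.lookup (f * (a00 * a11 - a01 * a10)) k = Poly_Mapping.lookup (f * (b00 * b11 - b01 * b10)) k"
proof -
  define \<Delta>1 where "\<Delta>1 = (a00 - b00) * a11 - (a01 - b01) * a10"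
  define \<Delta>2 where "\<Delta>2 = (a10 - b10) * b01 - (a11 - b11) * b00"
  have z: "(a00 - b00) * g1 + (a01 - b01) * g2 = 0" "(a10 - b10) * g1 + (a11 - b11) * g2 = 0"
    using a b by (simp_all add: algebra_simps)
  have "Poly_Mapping.lookup (f * \<Delta>1) k = 0"
    by (rule lookup_mult_eq_0[OF lookup_eq_0_of_power_dvd[OF ij] k(2)],
        unfold \<Delta>1_def, rule det_syzygy[OF z(1) a(2) a(1)])
  moreover have "Poly_Mapping.lookup (f * \<Delta>2) k = 0"
    by (rule lookup_mult_eq_0[OF lookup_eq_0_of_power_dvd[OF ij[symmetric]] k(1)],
        unfold \<Delta>2_def, rule det_syzygy[OF z(2) b(1) a(2)])
  moreover have "f * (a00 * a11 - a01 * a10) = f * \<Delta>1 - f * \<Delta>2 + f * (b00 * b11 - b01 * b10)"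
    by (simp add: \<Delta>1_def \<Delta>2_def algebra_simps)
  ultimately show ?thesis by (simp add: lookup_add lookup_minus)
qed

text \<open>Multiplying the rows of a representing matrix by \<open>Var i ^ M\<close> and
  \<open>Var j ^ M\<close> raises the exponent \<open>N\<close> by \<open>M\<close> and multiplies
  the determinant by both factors, so the extracted coefficient stays the same.\<close>

lemma coeff_ext_scale:
  assumes "i \<noteq> j" "N \<ge> 1"
  shows "coeff_ext [i, j] (N + M) (h * (Var i ^ M * Var j ^ M)) = coeff_ext [i, j] N h"
proof (rule poly_mapping_eqI)
  fix m
  let ?t = "\<lambda>N. Poly_Mapping.single i N + Poly_Mapping.single j N"
  have "m + ?t (N + M - 1) = (m + ?t (N - 1)) + ?t M"
    using assms by (intro poly_mapping_eqI) (auto simp: lookup_add lookup_single when_def)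
  then have "Poly_Mapping.lookup (h * (Var i ^ M * Var j ^ M)) (m + ?t (N + M - 1)) = Poly_Mapping.lookup h (m + ?t (N - 1))"
    using lookup_mono_mult_add[of 1 "?t M" h "m + ?t (N - 1)"]
    by (simp add: Var_power mono_mult mult.commute)
  then show "Poly_Mapping.lookup (coeff_ext [i, j] (N + M) (h * (Var i ^ M * Var j ^ M))) m
      = Poly_Mapping.lookup (coeff_ext [i, j] N h) m"
    by (simp add: lookup_coeff_ext[OF assms(1)])
qed

text \<open>Both representations are brought to the common exponent \<open>N + M\<close>, where
  \<open>lookup_det_independent\<close> compares them.\<close>

lemma coeff_ext_independent:
  assumes ij: "i \<noteq> j" and NM: "N \<ge> 1" "M \<ge> 1"
    and a: "Var i ^ N = a00 * g1 + a01 * g2" "Var j ^ N = a10 * g1 + a11 * g2"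
    and b: "Var i ^ M = b00 * g1 + b01 * g2" "Var j ^ M = b10 * g1 + b11 * g2"
  shows "coeff_ext [i, j] N (f * (a00 * a11 - a01 * a10)) = coeff_ext [i, j] M (f * (b00 * b11 - b01 * b10))"
proof -
  have "coeff_ext [i, j] N (f * (a00 * a11 - a01 * a10))
      = coeff_ext [i, j] (N + M) (f * (a00 * a11 - a01 * a10) * (Var i ^ M * Var j ^ M))"
    using coeff_ext_scale[OF ij NM(1)] by simp
  also have "\<dots> = coeff_ext [i, j] (M + N) (f * (b00 * b11 - b01 * b10) * (Var i ^ N * Var j ^ N))"
  proof (rule poly_mapping_eqI)
    fix m
    \<comment> \<open>The extracted exponents are \<open>N + M - 1\<close>, just below the bound
      \<open>N + M\<close> of \<open>lookup_det_independent\<close>.\<close>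
    let ?k = "m + (Poly_Mapping.single i (N + M - 1) + Poly_Mapping.single j (N + M - 1))"
    have "Poly_Mapping.lookup (f * ((Var i ^ M * a00) * (Var j ^ M * a11) - (Var i ^ M * a01) * (Var j ^ M * a10))) ?k
      = Poly_Mapping.lookup (f * ((Var i ^ N * b00) * (Var j ^ N * b11) - (Var i ^ N * b01) * (Var j ^ N * b10))) ?k"
      if "Poly_Mapping.lookup m i = 0" "Poly_Mapping.lookup m j = 0"
    proof (rule lookup_det_independent[OF ij, of "N + M" _ g1 _ g2])
      have *: "Z ^ (N + M) = Z ^ M * x * g1 + Z ^ M * y * g2" if "Z ^ N = x * g1 + y * g2" for Z x y :: mpoly
        unfolding power_add that by (simp only: algebra_simps)
      have **: "Z ^ (N + M) = Z ^ N * x * g1 + Z ^ N * y * g2" if "Z ^ M = x * g1 + y * g2" for Z x y :: mpoly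
        unfolding power_add that by (simp only: algebra_simps)
      show "Var i ^ (N + M) = Var i ^ M * a00 * g1 + Var i ^ M * a01 * g2"
        "Var j ^ (N + M) = Var j ^ M * a10 * g1 + Var j ^ M * a11 * g2"
        "Var i ^ (N + M) = Var i ^ N * b00 * g1 + Var i ^ N * b01 * g2"
        "Var j ^ (N + M) = Var j ^ N * b10 * g1 + Var j ^ N * b11 * g2"
        by (rule *[OF a(1)] *[OF a(2)] **[OF b(1)] **[OF b(2)])+
      show "Poly_Mapping.lookup ?k i < N + M" "Poly_Mapping.lookup ?k j < N + M"
        using that ij NM by (simp_all add: lookup_add lookup_single when_def)
    qed
    moreover have "f * (x * w - y * z) * (p * q) = f * ((p * x) * (q * w) - (p * y) * (q * z))" for x y z w p q :: mpoly
      by (simp only: algebra_simps)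
    ultimately show "Poly_Mapping.lookup (coeff_ext [i, j] (N + M) (f * (a00 * a11 - a01 * a10) * (Var i ^ M * Var j ^ M))) m
      = Poly_Mapping.lookup (coeff_ext [i, j] (M + N) (f * (b00 * b11 - b01 * b10) * (Var i ^ N * Var j ^ N))) m"
      unfolding add.commute[of M N] by (simp only: lookup_coeff_ext[OF ij] if_True split: if_splits) simp
  qed
  also have "\<dots> = coeff_ext [i, j] M (f * (b00 * b11 - b01 * b10))"
    using coeff_ext_scale[OF ij NM(2)] by simp
  finally show ?thesis .
qed

text \<open>The description in \<open>residue\<close> quantifies over all exponents and matrices:
  that the value satisfies it is \<open>coeff_ext_independent\<close>, and uniqueness follows by
  instantiating it with the given representation.\<close>

theorem residue_eq:
  assumes ij: "i \<noteq> j" and N: "N \<ge> 1"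
    and a: "Var i ^ N = a00 * g1 + a01 * g2" "Var j ^ N = a10 * g1 + a11 * g2"
    and v: "vars a00 \<subseteq> {i, j}" "vars a01 \<subseteq> {i, j}" "vars a10 \<subseteq> {i, j}" "vars a11 \<subseteq> {i, j}"
  shows "residue [i, j] [g1, g2] f = coeff_ext [i, j] N (f * (a00 * a11 - a01 * a10))"
  unfolding residue_def
proof (rule the_equality)
  show "\<forall>M b. M \<ge> 1 \<and> (\<forall>l<length [i, j]. \<forall>k<length [i, j]. vars (b l k) \<subseteq> set [i, j]) \<and>
       (\<forall>l<length [i, j]. Var ([i, j] ! l) ^ M = (\<Sum>k<length [i, j]. b l k * [g1, g2] ! k))
      \<longrightarrow> coeff_ext [i, j] N (f * (a00 * a11 - a01 * a10)) = coeff_ext [i, j] M (f * detn (length [i, j]) b)"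
  proof (intro allI impI)
    fix M and b :: "nat \<Rightarrow> nat \<Rightarrow> mpoly"
    assume H: "M \<ge> 1 \<and> (\<forall>l<length [i, j]. \<forall>k<length [i, j]. vars (b l k) \<subseteq> set [i, j]) \<and>
       (\<forall>l<length [i, j]. Var ([i, j] ! l) ^ M = (\<Sum>k<length [i, j]. b l k * [g1, g2] ! k))"
    have len: "length [i, j] = 2" by simp
    have b: "Var i ^ M = b 0 0 * g1 + b 0 1 * g2" "Var j ^ M = b 1 0 * g1 + b 1 1 * g2"
      using H by (auto simp: less_Suc_eq lessThan_Suc add.commute)
    show "coeff_ext [i, j] N (f * (a00 * a11 - a01 * a10)) = coeff_ext [i, j] M (f * detn (length [i, j]) b)"
      unfolding len detn_2 using H by (intro coeff_ext_independent[OF ij N _ a b]) simp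
  qed
next
  fix r
  assume "\<forall>M b. M \<ge> 1 \<and> (\<forall>l<length [i, j]. \<forall>k<length [i, j]. vars (b l k) \<subseteq> set [i, j]) \<and>
       (\<forall>l<length [i, j]. Var ([i, j] ! l) ^ M = (\<Sum>k<length [i, j]. b l k * [g1, g2] ! k))
      \<longrightarrow> r = coeff_ext [i, j] M (f * detn (length [i, j]) b)"
  note H = this[rule_format, of N "\<lambda>l k. if l = 0 then (if k = 0 then a00 else a01) else (if k = 0 then a10 else a11)"]
  have len: "length [i, j] = 2" by simp
  show "r = coeff_ext [i, j] N (f * (a00 * a11 - a01 * a10))"
    using H unfolding len detn_2 using N a v by (auto simp: less_2_cases_iff numeral_2_eq_2 lessThan_Suc add.commute)
qed

text \<open>Against a monomial with exponents \<open>N - 1 - k\<close> and \<open>N - 1 - l\<close>,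
  the coefficient at \<open>(N - 1, N - 1)\<close> of the product is the coefficient of
  \<open>x^k y^l\<close> in \<open>f\<close>. A determinant with few terms therefore turns the
  residue into a short list of coefficients.\<close>

lemma residue_eq_lookup:
  assumes ij: "i \<noteq> j" and N: "N \<ge> 1"
    and a: "Var i ^ N = a00 * g1 + a01 * g2" "Var j ^ N = a10 * g1 + a11 * g2"
    and v: "vars a00 \<subseteq> {i, j}" "vars a01 \<subseteq> {i, j}" "vars a10 \<subseteq> {i, j}" "vars a11 \<subseteq> {i, j}"
    and det: "a00 * a11 - a01 * a10 = (\<Sum>(c, k, l)\<leftarrow>cs. mono c (Poly_Mapping.single i (N - 1 - k) + Poly_Mapping.single j (N - 1 - l)))"
    and cs: "\<forall>(c, k, l)\<in>set cs. k < N \<and> l < N"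
  shows "Poly_Mapping.lookup (residue [i, j] [g1, g2] f) m =
    (if Poly_Mapping.lookup m i = 0 \<and> Poly_Mapping.lookup m j = 0
     then \<Sum>(c, k, l)\<leftarrow>cs. c * Poly_Mapping.lookup f (m + (Poly_Mapping.single i k + Poly_Mapping.single j l))
     else 0)"
proof -
  let ?t = "Poly_Mapping.single i (N - 1) + Poly_Mapping.single j (N - 1)"
  have "Poly_Mapping.lookup (f * (\<Sum>(c, k, l)\<leftarrow>cs. mono c (Poly_Mapping.single i (N - 1 - k) + Poly_Mapping.single j (N - 1 - l)))) (m + ?t)
    = (\<Sum>(c, k, l)\<leftarrow>cs. c * Poly_Mapping.lookup f (m + (Poly_Mapping.single i k + Poly_Mapping.single j l)))"
    using cs
  proof (induction cs)
    case (Cons x cs)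
    obtain c k l where x: "x = (c, k, l)" by (cases x)
    with Cons have kl: "k < N" "l < N" by auto
    have "m + ?t = (m + (Poly_Mapping.single i k + Poly_Mapping.single j l)) +
        (Poly_Mapping.single i (N - 1 - k) + Poly_Mapping.single j (N - 1 - l))"
      using kl by (intro poly_mapping_eqI) (auto simp: lookup_add lookup_single when_def)
    then have "Poly_Mapping.lookup (f * mono c (Poly_Mapping.single i (N - 1 - k) + Poly_Mapping.single j (N - 1 - l))) (m + ?t)
        = c * Poly_Mapping.lookup f (m + (Poly_Mapping.single i k + Poly_Mapping.single j l))"
      by (simp only: mult.commute[of f] lookup_mono_mult_add)
    then show ?case using Cons x by (simp add: distrib_left lookup_add)
  qed simp
  then show ?thesis
    by (simp add: residue_eq[OF ij N a v] det lookup_coeff_ext[OF ij])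
qed

text \<open>For pure powers the representing matrix is diagonal, and the exponent
  \<open>k + l\<close> suits both rows. The one-element list has the shape of
  \<open>socle\<close>.\<close>

lemma residue_diag:
  assumes ij: "i \<noteq> j" and nz: "\<alpha> \<noteq> 0" "\<beta> \<noteq> 0" and kl: "k \<ge> 1" "l \<ge> 1"
  shows "Poly_Mapping.lookup (residue [i, j] [Cst \<alpha> * Var i ^ k, Cst \<beta> * Var j ^ l] f) m =
    (if Poly_Mapping.lookup m i = 0 \<and> Poly_Mapping.lookup m j = 0
     then \<Sum>(c, k, l)\<leftarrow>[(1 / (\<alpha> * \<beta>), k - 1, l - 1)]. c * Poly_Mapping.lookup f (m + (Poly_Mapping.single i k + Poly_Mapping.single j l))
     else 0)"
proof (rule residue_eq_lookup[OF ij, of "k + l" "Cst (1 / \<alpha>) * Var i ^ l" _ 0 _ 0 "Cst (1 / \<beta>) * Var j ^ k"])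
  have C: "Cst (1 / \<alpha>) * Cst \<alpha> = 1" "Cst (1 / \<beta>) * Cst \<beta> = 1"
    using nz by (simp_all flip: Cst_mult)
  have "Cst (1 / \<alpha>) * Var i ^ l * (Cst \<alpha> * Var i ^ k) = (Cst (1 / \<alpha>) * Cst \<alpha>) * Var i ^ (k + l)"
    by (simp add: power_add mult_ac)
  then show "Var i ^ (k + l) = Cst (1 / \<alpha>) * Var i ^ l * (Cst \<alpha> * Var i ^ k) + 0 * (Cst \<beta> * Var j ^ l)"
    by (simp add: C)
  have "Cst (1 / \<beta>) * Var j ^ k * (Cst \<beta> * Var j ^ l) = (Cst (1 / \<beta>) * Cst \<beta>) * Var j ^ (k + l)"
    by (simp add: power_add mult_ac)
  then show "Var j ^ (k + l) = 0 * (Cst \<alpha> * Var i ^ k) + Cst (1 / \<beta>) * Var j ^ k * (Cst \<beta> * Var j ^ l)"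
    by (simp add: C)
  have "k + l - Suc (k - Suc 0) = l" "k + l - Suc (l - Suc 0) = k" using kl by auto
  then show "Cst (1 / \<alpha>) * Var i ^ l * (Cst (1 / \<beta>) * Var j ^ k) - 0 * 0 =
    (\<Sum>(c, k', l')\<leftarrow>[(1 / (\<alpha> * \<beta>), k - 1, l - 1)].
       mono c (Poly_Mapping.single i (k + l - 1 - k') + Poly_Mapping.single j (k + l - 1 - l')))"
    by (simp add: Var_power Cst_def mono_mult)
qed (use kl in \<open>simp_all add: vars_subI vars_power_subI, linarith\<close>)

section \<open>The simple singularities and their residues\<close>

datatype ade = TA nat | TD nat | TE6 | TE7 | TE8

fun valid :: "ade \<Rightarrow> bool" where
  "valid (TA d) \<longleftrightarrow> d \<ge> 2"
| "valid (TD d) \<longleftrightarrow> d \<ge> 3"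
| "valid _ \<longleftrightarrow> True"

fun pot :: "ade \<Rightarrow> mpoly \<Rightarrow> mpoly \<Rightarrow> mpoly" where
  "pot (TA d) X Y = X ^ d + Y ^ 2"
| "pot (TD d) X Y = X ^ d + X * Y ^ 2"
| "pot TE6 X Y = X ^ 3 + Y ^ 4"
| "pot TE7 X Y = X ^ 3 + X * Y ^ 3"
| "pot TE8 X Y = X ^ 3 + Y ^ 5"

text \<open>The Coxeter number \<open>h\<close>; the central charge of the singularity is \<open>1 - 2 / h\<close>.\<close>
fun cox :: "ade \<Rightarrow> nat" where
  "cox (TA d) = d"
| "cox (TD d) = 2 * d"
| "cox TE6 = 12"
| "cox TE7 = 18"
| "cox TE8 = 30"

fun wtx :: "ade \<Rightarrow> rat" where
  "wtx (TA d) = 2 / of_nat d"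
| "wtx (TD d) = 2 / of_nat d"
| "wtx _ = 2 / 3"

fun wty :: "ade \<Rightarrow> rat" where
  "wty (TA d) = 1"
| "wty (TD d) = 1 - 1 / of_nat d"
| "wty TE6 = 1 / 2"
| "wty TE7 = 4 / 9"
| "wty TE8 = 2 / 5"

text \<open>The residue is the linear functional that sends \<open>f\<close> to the sum of \<open>c\<close> times the
  coefficient of \<open>x\<^sup>k y\<^sup>l\<close> in \<open>f\<close>, over the triples \<open>(c, k, l)\<close> listed here.\<close>
fun socle :: "ade \<Rightarrow> (complex \<times> nat \<times> nat) list" where
  "socle (TA d) = [(1 / (2 * of_nat d), d - 2, 0)]"
| "socle (TD d) = [(- 1 / 2, 0, 2), (1 / (2 * of_nat d), d - 1, 0)]"
| "socle TE6 = [(1 / 12, 1, 2)]"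
| "socle TE7 = [(- 1 / 3, 0, 4), (1 / 9, 2, 1)]"
| "socle TE8 = [(1 / 15, 1, 3)]"

lemma subst_pot: "subst s (pot t X Y) = pot t (subst s X) (subst s Y)"
  by (cases t) simp_all

lemma shift_pot: "shift 2 (pot t (Var 0) (Var 1)) = pot t (Var 2) (Var 3)"
  by (simp add: shift_eq_subst subst_pot numeral_2_eq_2 numeral_3_eq_3)

lemma vars_pot: "vars (pot t (Var i) (Var j)) \<subseteq> {i, j}"
  by (cases t) (simp_all add: vars_subI vars_power_subI)

lemma single_neq: "i \<noteq> j \<Longrightarrow> n \<noteq> 0 \<Longrightarrow> Poly_Mapping.single i n \<noteq> Poly_Mapping.single j (m::nat)"
  by (metis lookup_single_eq lookup_single_not_eq)

text \<open>The two monomials of the potential give two independent linear equations for the two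
  weights.\<close>

lemma homog_potD:
  assumes "valid t" "i \<noteq> j" "homog w 2 (pot t (Var i) (Var j))"
  shows "w i = wtx t \<and> w j = wty t"
proof -
  have *: "wdeg w a = 2" if "Poly_Mapping.lookup (pot t (Var i) (Var j)) a \<noteq> 0" for a
    using assms(3) that by (auto simp: homog_def in_keys_iff)
  have ne: "Poly_Mapping.single i n \<noteq> Poly_Mapping.single i m + Poly_Mapping.single j k" if "k \<noteq> 0" for n m k :: nat
  proof
    assume "Poly_Mapping.single i n = Poly_Mapping.single i m + Poly_Mapping.single j k"
    then have "Poly_Mapping.lookup (Poly_Mapping.single i n) j = Poly_Mapping.lookup (Poly_Mapping.single i m + Poly_Mapping.single j k) j"
      by simp
    then show False using that assms(2) by (simp add: lookup_add lookup_single when_def)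
  qed
  have e1: "Var i * mono 1 (Poly_Mapping.single j n) = mono 1 (Poly_Mapping.single i 1 + Poly_Mapping.single j n)" for n
    by (simp add: Var_def mono_mult)
  note ss = e1 Var_power lookup_add lookup_mono wdeg_add single_neq ne ne[symmetric] assms(2) assms(2)[symmetric]
  show ?thesis
  proof (cases t)
    case (TA d)
    then show ?thesis using assms(1) *[of "Poly_Mapping.single i d"] *[of "Poly_Mapping.single j 2"]
      by (simp add: ss field_simps)
  next
    case (TD d)
    then have 1: "w i * of_nat d = 2" "w i + w j * 2 = 2"
      using assms(1) *[of "Poly_Mapping.single i d"] *[of "Poly_Mapping.single i 1 + Poly_Mapping.single j 2"]
      by (simp_all add: ss)
    then have "w i = 2 / of_nat d" using assms(1) TD by (simp add: field_simps)
    moreover from this have "w j = 1 - 1 / of_nat d" using 1(2) by simp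
    ultimately show ?thesis using TD by simp
  next
    case TE6
    then show ?thesis using assms(1) *[of "Poly_Mapping.single i 3"] *[of "Poly_Mapping.single j 4"]
      by (simp add: ss field_simps)
  next
    case TE7
    then show ?thesis using assms(1) *[of "Poly_Mapping.single i 3"] *[of "Poly_Mapping.single i 1 + Poly_Mapping.single j 3"]
      by (simp add: ss field_simps)
  next
    case TE8
    then show ?thesis using assms(1) *[of "Poly_Mapping.single i 3"] *[of "Poly_Mapping.single j 5"]
      by (simp add: ss field_simps)
  qed
qed

lemma homog_potI:
  assumes "valid t" "w i = wtx t" "w j = wty t"
  shows "homog w 2 (pot t (Var i) (Var j))"
proof (cases t)
  case (TD d)
  have "of_nat d * w i = 2" "w i + of_nat 2 * w j = 2"
    using assms TD by (simp_all add: right_diff_distrib)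
  then show ?thesis using TD
    by (auto intro!: homog_add homog_power[OF homog_Var[OF refl]] homog_mult[OF homog_Var[OF refl] homog_power[OF homog_Var[OF refl] refl]])
qed (use assms in \<open>auto intro!: homog_add homog_power[OF homog_Var[OF refl]] homog_mult[OF homog_Var[OF refl] homog_power[OF homog_Var[OF refl] refl]]\<close>)

lemma wt_pos: "valid t \<Longrightarrow> wtx t > 0 \<and> wty t > 0"
  by (cases t) (auto simp: field_simps)

lemma central_charge:
  assumes "valid t"
  shows "(1 - wtx t) + (1 - wty t) = 1 - 2 / of_nat (cox t)"
  by (cases t) (use assms in \<open>auto simp: field_simps\<close>)

text \<open>The listed monomials have the degree of the Hessian determinant: the sum of
  \<open>2 - 2|x|\<close> over the variables, which is twice the central charge.\<close>

lemma socle_degree: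
  assumes "valid t" "(c, k, l) \<in> set (socle t)"
  shows "wtx t * of_nat k + wty t * of_nat l = 2 * (1 - 2 / of_nat (cox t))"
  by (cases t) (use assms in \<open>auto simp: field_simps of_nat_diff\<close>)

lemma residue_pot:
  assumes "valid t" and ij: "i \<noteq> j"
  shows "Poly_Mapping.lookup (residue [i, j] [pd i (pot t (Var i) (Var j)), pd j (pot t (Var i) (Var j))] f) m =
    (if Poly_Mapping.lookup m i = 0 \<and> Poly_Mapping.lookup m j = 0
     then \<Sum>(c, k, l)\<leftarrow>socle t. c * Poly_Mapping.lookup f (m + (Poly_Mapping.single i k + Poly_Mapping.single j l))
     else 0)"
proof (cases t)
  case (TA d)
  have "pd i (pot t (Var i) (Var j)) = Cst (of_nat d) * Var i ^ (d - 1)"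
    "pd j (pot t (Var i) (Var j)) = Cst 2 * Var j ^ 1"
    using ij by (simp_all add: TA pd_power Cst_of_nat)
  then show ?thesis
    using residue_diag[OF ij, of "of_nat d" 2 "d - 1" 1 f m] assms(1) by (simp add: TA mult.commute numeral_2_eq_2)
next
  case TE6
  have "pd i (pot t (Var i) (Var j)) = Cst 3 * Var i ^ 2"
    "pd j (pot t (Var i) (Var j)) = Cst 4 * Var j ^ 3"
    using ij by (simp_all add: TE6 pd_power)
  then show ?thesis
    using residue_diag[OF ij, of 3 4 2 3 f m] by (simp add: TE6)
next
  case TE8
  have "pd i (pot t (Var i) (Var j)) = Cst 3 * Var i ^ 2"
    "pd j (pot t (Var i) (Var j)) = Cst 5 * Var j ^ 4"
    using ij by (simp_all add: TE8 pd_power)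
  then show ?thesis
    using residue_diag[OF ij, of 3 5 2 4 f m] by (simp add: TE8)
next
  case TE7
  let ?X = "Var i" and ?Y = "Var j"
  have pd: "pd i (pot t ?X ?Y) = 3 * ?X ^ 2 + ?Y ^ 3" "pd j (pot t ?X ?Y) = 3 * ?X * ?Y ^ 2"
    using ij by (simp_all add: TE7 pd_power)
  have C: "Cst (1 / 3) * 3 = 1" "Cst (- (1 / 9)) * 3 = - Cst (1 / 3)"
    by (simp_all flip: Cst_mult Cst_numeral Cst_minus)
  \<comment> \<open>The rows express \<open>x^5\<close> and \<open>y^5\<close> through the partial
    derivatives; the mixed terms \<open>x^3 y^3\<close> and \<open>x^2 y^2\<close> cancel. The
    determinant \<open>- x^4 / 3 + x^2 y^3 / 9\<close> is complementary, with respect to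
    \<open>x^4 y^4\<close>, to \<open>y^4\<close> and \<open>x^2 y\<close>.\<close>
  show ?thesis unfolding pd
  proof (rule residue_eq_lookup[OF ij, of 5 "Cst (1 / 3) * ?X ^ 3" _ "Cst (- 1 / 9) * ?X ^ 2 * ?Y" _ "?Y ^ 2" "- ?X"])
    have "Cst (1 / 3) * ?X ^ 3 * (3 * ?X ^ 2 + ?Y ^ 3) + Cst (- 1 / 9) * ?X ^ 2 * ?Y * (3 * ?X * ?Y ^ 2)
      = (Cst (1 / 3) * 3) * ?X ^ 5 + (Cst (1 / 3) + Cst (- 1 / 9) * 3) * ?X ^ 3 * ?Y ^ 3"
      by algebra
    then show "?X ^ 5 = Cst (1 / 3) * ?X ^ 3 * (3 * ?X ^ 2 + ?Y ^ 3) + Cst (- 1 / 9) * ?X ^ 2 * ?Y * (3 * ?X * ?Y ^ 2)"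
      by (simp add: C)
    show "?Y ^ 5 = ?Y ^ 2 * (3 * ?X ^ 2 + ?Y ^ 3) + - ?X * (3 * ?X * ?Y ^ 2)"
      by algebra
    have "Cst (1 / 3) * ?X ^ 3 * - ?X - Cst (- 1 / 9) * ?X ^ 2 * ?Y * ?Y ^ 2
      = Cst (- 1 / 3) * ?X ^ 4 + Cst (1 / 9) * ?X ^ 2 * ?Y ^ 3"
      by (simp add: Cst_minus eval_nat_numeral algebra_simps)
    then show "Cst (1 / 3) * ?X ^ 3 * - ?X - Cst (- 1 / 9) * ?X ^ 2 * ?Y * ?Y ^ 2 =
       (\<Sum>(c, k, l)\<leftarrow>socle t. mono c (Poly_Mapping.single i (5 - 1 - k) + Poly_Mapping.single j (5 - 1 - l)))"
      by (simp add: TE7 Var_power Cst_def mono_mult)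
  qed (simp_all add: TE7 vars_subI vars_power_subI)
next
  case (TD d)
  let ?X = "Var i" and ?Y = "Var j"
  obtain n where d: "d = n + 3" using assms(1) TD by (metis add.commute le_Suc_ex valid.simps(2))
  define e :: complex where "e = of_nat d"
  have e: "e \<noteq> 0" by (simp add: e_def d del: of_nat_add)
  have pd: "pd i (pot t ?X ?Y) = Cst e * ?X ^ (n + 2) + ?Y ^ 2" "pd j (pot t ?X ?Y) = 2 * ?X * ?Y"
    using ij by (simp_all add: TD pd_power d e_def Cst_of_nat Cst_add)
  have C: "Cst (1 / e) * Cst e = 1" "Cst (- (1 / (2 * e))) * 2 = - Cst (1 / e)" "Cst (- (e / 2)) * 2 = - Cst e"
    "Cst (1 / e) * Cst (- e / 2) = Cst (- 1 / 2)" "Cst (- 1 / (2 * e)) = - Cst (1 / (2 * e))"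
    using e by (simp_all flip: Cst_mult Cst_numeral Cst_minus)
  \<comment> \<open>Here \<open>N = d\<close>. The determinant is a combination of
    \<open>x^(d-1) y^(d-3)\<close> and \<open>y^(d-1)\<close>, complementary to \<open>y^2\<close>
    and \<open>x^(d-1)\<close>.\<close>
  show ?thesis unfolding pd
  proof (rule residue_eq_lookup[OF ij, of d "Cst (1 / e) * ?X" _ "Cst (- 1 / (2 * e)) * ?Y" _ "?Y ^ (n + 1)" "Cst (- e / 2) * ?X ^ (n + 1) * ?Y ^ n"])
    have "Cst (1 / e) * ?X * (Cst e * ?X ^ (n + 2) + ?Y ^ 2) + Cst (- 1 / (2 * e)) * ?Y * (2 * ?X * ?Y)
      = (Cst (1 / e) * Cst e) * ?X ^ (n + 3) + (Cst (1 / e) + Cst (- 1 / (2 * e)) * 2) * (?X * ?Y ^ 2)"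
      by (simp add: power_add power2_eq_square power3_eq_cube algebra_simps)
    then show "?X ^ d = Cst (1 / e) * ?X * (Cst e * ?X ^ (n + 2) + ?Y ^ 2) + Cst (- 1 / (2 * e)) * ?Y * (2 * ?X * ?Y)"
      by (simp add: C(1,2) d)
    have "?Y ^ (n + 1) * (Cst e * ?X ^ (n + 2) + ?Y ^ 2) + Cst (- e / 2) * ?X ^ (n + 1) * ?Y ^ n * (2 * ?X * ?Y)
      = ?Y ^ (n + 3) + (Cst e + Cst (- e / 2) * 2) * (?X ^ (n + 2) * ?Y ^ (n + 1))"
      by (simp add: power_add power2_eq_square power3_eq_cube algebra_simps)
    then show "?Y ^ d = ?Y ^ (n + 1) * (Cst e * ?X ^ (n + 2) + ?Y ^ 2) + Cst (- e / 2) * ?X ^ (n + 1) * ?Y ^ n * (2 * ?X * ?Y)"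
      by (simp add: C(3) d)
    have "Cst (1 / e) * ?X * (Cst (- e / 2) * ?X ^ (n + 1) * ?Y ^ n) - Cst (- 1 / (2 * e)) * ?Y * ?Y ^ (n + 1)
      = (Cst (1 / e) * Cst (- e / 2)) * ?X ^ (n + 2) * ?Y ^ n - Cst (- 1 / (2 * e)) * ?Y ^ (n + 2)"
      by (simp add: power_add power2_eq_square algebra_simps)
    also have "\<dots> = Cst (- 1 / 2) * ?X ^ (n + 2) * ?Y ^ n + Cst (1 / (2 * e)) * ?Y ^ (n + 2)"
      unfolding C(4,5) by simp
    also have "\<dots> = mono (- 1 / 2) (Poly_Mapping.single i (n + 2) + Poly_Mapping.single j n)
        + mono (1 / (2 * e)) (Poly_Mapping.single j (n + 2))"
      by (simp only: Var_power Cst_def mono_mult mult_1_right add_0)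
    finally show "Cst (1 / e) * ?X * (Cst (- e / 2) * ?X ^ (n + 1) * ?Y ^ n) - Cst (- 1 / (2 * e)) * ?Y * ?Y ^ (n + 1) =
       (\<Sum>(c, k, l)\<leftarrow>socle t. mono c (Poly_Mapping.single i (d - 1 - k) + Poly_Mapping.single j (d - 1 - l)))"
      by (simp add: TD d e_def del: of_nat_add power_Suc)
  qed (use d in \<open>simp_all add: TD vars_subI vars_power_subI\<close>)
qed

section \<open>Supertraces and homogeneity\<close>

lemma str_alt: "r0 \<le> r \<Longrightarrow> str r0 r M = (\<Sum>i<r. (if i < r0 then 1 else - 1) * M i i)"
proof -
  assume "r0 \<le> r"
  then have "{..<r} = {..<r0} \<union> {r0..<r}" by auto
  then have "(\<Sum>i<r. (if i < r0 then 1 else - 1) * M i i)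
      = (\<Sum>i<r0. (if i < r0 then 1 else - 1) * M i i) + (\<Sum>i\<in>{r0..<r}. (if i < r0 then 1 else - 1) * M i i)"
    by (simp add: sum.union_disjoint ivl_disj_int)
  also have "(\<Sum>i<r0. (if i < r0 then 1 else - 1) * M i i) = (\<Sum>i<r0. M i i)"
    by (rule sum.cong) auto
  also have "(\<Sum>i\<in>{r0..<r}. (if i < r0 then 1 else - 1) * M i i) = - (\<Sum>i\<in>{r0..<r}. M i i)"
    by (simp add: sum_negf[symmetric])
  finally show "str r0 r M = (\<Sum>i<r. (if i < r0 then 1 else - 1) * M i i)"
    by (simp add: str_def)
qed

definition evenmat :: "nat \<Rightarrow> nat \<Rightarrow> (nat \<Rightarrow> nat \<Rightarrow> mpoly) \<Rightarrow> bool" where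
  "evenmat r0 r M \<longleftrightarrow> (\<forall>i<r. \<forall>j<r. (i < r0) \<noteq> (j < r0) \<longrightarrow> M i j = 0)"

text \<open>A non-zero entry \<open>X i k\<close> of an even matrix forces \<open>i\<close> and
  \<open>k\<close> to have the same parity, so no sign arises when the factors are
  exchanged.\<close>

lemma str_cyclic:
  assumes "r0 \<le> r" "evenmat r0 r X"
  shows "str r0 r (matmul r X Y) = str r0 r (matmul r Y X)"
proof -
  let ?s = "\<lambda>i. if i < r0 then 1 else - 1 :: mpoly"
  have "str r0 r (matmul r X Y) = (\<Sum>i<r. \<Sum>k<r. ?s i * (X i k * Y k i))"
    using assms(1) by (simp add: str_alt matmul_def sum_distrib_left)
  also have "\<dots> = (\<Sum>k<r. \<Sum>i<r. ?s i * (X i k * Y k i))"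
    by (rule sum.swap)
  also have "\<dots> = (\<Sum>k<r. \<Sum>i<r. ?s k * (Y k i * X i k))"
  proof (intro sum.cong refl)
    fix i k assume "i \<in> {..<r}" "k \<in> {..<r}"
    then show "?s i * (X i k * Y k i) = ?s k * (Y k i * X i k)"
      using assms(2) by (cases "X i k = 0") (auto simp: evenmat_def mult_ac)
  qed
  also have "\<dots> = str r0 r (matmul r Y X)"
    using assms(1) by (simp add: str_alt matmul_def sum_distrib_left)
  finally show ?thesis .
qed

lemma matmul_assoc: "matmul r (matmul r X Y) Z = matmul r X (matmul r Y Z)"
proof (intro ext)
  fix i j
  have "matmul r (matmul r X Y) Z i j = (\<Sum>k<r. \<Sum>l<r. X i l * Y l k * Z k j)"
    by (simp add: matmul_def sum_distrib_right)
  also have "\<dots> = (\<Sum>l<r. \<Sum>k<r. X i l * Y l k * Z k j)"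
    by (rule sum.swap)
  also have "\<dots> = matmul r X (matmul r Y Z) i j"
    by (simp add: matmul_def sum_distrib_left mult.assoc)
  finally show "matmul r (matmul r X Y) Z i j = matmul r X (matmul r Y Z) i j" .
qed

lemma matmul_cong:
  "(\<And>k. k < r \<Longrightarrow> X i k = X' i k) \<Longrightarrow> (\<And>k. k < r \<Longrightarrow> Y k j = Y' k j) \<Longrightarrow> matmul r X Y i j = matmul r X' Y' i j"
  by (simp add: matmul_def)

lemma matmul_idmat: "j < r \<Longrightarrow> matmul r X idmat i j = X i j"
  by (simp add: matmul_def idmat_def if_distrib[of "(*) _"] cong: if_cong)

text \<open>The common numerator of both quantum dimensions for two variables on each side.\<close>

definition hmat :: "nat \<Rightarrow> nat \<Rightarrow> (nat \<Rightarrow> nat \<Rightarrow> mpoly) \<Rightarrow> mpoly" where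
  "hmat r0 r D = str r0 r (matmul r (dmat 0 D) (matmul r (dmat 1 D) (matmul r (dmat 2 D) (dmat 3 D))))"

lemma str_dprod:
  assumes "r0 \<le> r"
  shows "str r0 r (dprod 2 2 r D) = hmat r0 r D"
proof -
  have l: "[0..<2 + 2::nat] = [0, 1, 2, 3]" by (simp add: upt_rec)
  have "dprod 2 2 r D i j = matmul r (dmat 0 D) (matmul r (dmat 1 D) (matmul r (dmat 2 D) (dmat 3 D))) i j"
    if "i < r" "j < r" for i j
    unfolding dprod_def l using that
    by (simp) (intro matmul_cong refl matmul_idmat that)
  then show ?thesis
    using assms by (simp add: hmat_def str_def)
qed

definition gmat :: "(nat \<Rightarrow> rat) \<Rightarrow> (nat \<Rightarrow> rat) \<Rightarrow> nat \<Rightarrow> rat \<Rightarrow> (nat \<Rightarrow> nat \<Rightarrow> mpoly) \<Rightarrow> bool" where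
  "gmat w q r c M \<longleftrightarrow> (\<forall>i<r. \<forall>j<r. homog w (c + q j - q i) (M i j))"

lemma gmat_matmul: "gmat w q r c X \<Longrightarrow> gmat w q r d Y \<Longrightarrow> gmat w q r (c + d) (matmul r X Y)"
  unfolding gmat_def matmul_def
proof (intro allI impI homog_sum)
  fix i j k assume H: "\<forall>i<r. \<forall>j<r. homog w (c + q j - q i) (X i j)"
    "\<forall>i<r. \<forall>j<r. homog w (d + q j - q i) (Y i j)" "i < r" "j < r" "k \<in> {..<r}"
  show "homog w (c + d + q j - q i) (X i k * Y k j)"
    by (rule homog_mult[of w "c + q k - q i" _ "d + q j - q k"]) (use H in auto)
qed

lemma gmat_dmat: "gmat w q r c X \<Longrightarrow> gmat w q r (c - w v) (dmat v X)"
  by (auto simp: gmat_def dmat_def intro!: homog_pd)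

lemma homog_str: "r0 \<le> r \<Longrightarrow> gmat w q r c M \<Longrightarrow> homog w c (str r0 r M)"
proof -
  assume "r0 \<le> r" and M: "gmat w q r c M"
  have "homog w c (M i i)" if "i < r" for i
    using M that unfolding gmat_def by (metis add_diff_cancel_right')
  then show ?thesis
    using \<open>r0 \<le> r\<close> by (auto simp: str_def intro!: homog_sum homog_diff)
qed

text \<open>Differentiating the degree 1 map \<open>D\<close> by a variable \<open>x\<close> leaves
  degree \<open>1 - |x|\<close>, and degrees add along the product. The total is the sum of the two
  central charges.\<close>

lemma homog_hmat:
  assumes "gmat w q r 1 D" "r0 \<le> r"
  shows "homog w ((1 - w 0) + (1 - w 1) + ((1 - w 2) + (1 - w 3))) (hmat r0 r D)"
proof -
  note * = gmat_dmat[OF assms(1)]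
  have "(1 - w 0) + (1 - w 1) + ((1 - w 2) + (1 - w 3)) = (1 - w 0) + ((1 - w 1) + ((1 - w 2) + (1 - w 3)))"
    by simp
  then show ?thesis
    using homog_str[OF assms(2) gmat_matmul[OF *[of 0] gmat_matmul[OF *[of 1] gmat_matmul[OF *[of 2] *[of 3]]]]]
    by (simp only: hmat_def)
qed

section \<open>Orbifold equivalent singularities have equal Coxeter numbers\<close>

abbreviation PX :: "ade \<Rightarrow> mpoly" where "PX t \<equiv> pot t (Var 0) (Var 1)"
abbreviation PY :: "ade \<Rightarrow> mpoly" where "PY t \<equiv> pot t (Var 2) (Var 3)"

lemma qdim_l_pot:
  assumes "r0 \<le> r"
  shows "qdim_l 2 (PX t1) 2 (PX t2) r0 r D = - residue [2, 3] [pd 2 (PY t2), pd 3 (PY t2)] (hmat r0 r D)"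
proof -
  have l: "[2..<2 + 2::nat] = [2, 3]" by (simp add: upt_rec)
  have b: "(2 + 1 :: nat) choose 2 = 3" by (simp add: choose_two)
  show ?thesis
    unfolding qdim_l_def l shift_pot str_dprod[OF assms] b by simp
qed

lemma qdim_r_pot:
  assumes "r0 \<le> r"
  shows "qdim_r 2 (PX t1) 2 (PX t2) r0 r D = - residue [0, 1] [pd 0 (PX t1), pd 1 (PX t1)] (hmat r0 r D)"
proof -
  have l: "[0..<2::nat] = [0, 1]" by (simp add: upt_rec)
  have b: "(2 + 1 :: nat) choose 2 = 3" by (simp add: choose_two)
  show ?thesis
    unfolding qdim_r_def l str_dprod[OF assms] b by simp
qed

lemma wdeg_nonneg: "(\<And>i. i \<in> Poly_Mapping.keys a \<Longrightarrow> w i \<ge> 0) \<Longrightarrow> wdeg w a \<ge> 0"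
  unfolding wdeg_def by (intro sum_nonneg) simp

text \<open>A non-zero coefficient of the residue at \<open>m\<close> comes from a monomial of
  \<open>f\<close> that is \<open>m\<close> times a socle monomial, and \<open>m\<close> has degree
  at least 0. Positivity is asked only of the variables of \<open>f\<close>, because the grading
  leaves other indices unconstrained.\<close>

lemma residue_nonzero_degree:
  assumes t: "valid t" "i \<noteq> j" and w: "w i = wtx t" "w j = wty t"
    and hom: "homog w c f" and pos: "\<And>k. k \<in> vars f \<Longrightarrow> w k > 0"
    and nz: "residue [i, j] [pd i (pot t (Var i) (Var j)), pd j (pot t (Var i) (Var j))] f \<noteq> 0"
  shows "2 * (1 - 2 / of_nat (cox t)) \<le> c"
proof -
  obtain m where "Poly_Mapping.lookup (residue [i, j] [pd i (pot t (Var i) (Var j)), pd j (pot t (Var i) (Var j))] f) m \<noteq> 0"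
    using nz by (metis lookup_zero poly_mapping_eqI)
  then have nz': "(\<Sum>(c, k, l)\<leftarrow>socle t. c * Poly_Mapping.lookup f (m + (Poly_Mapping.single i k + Poly_Mapping.single j l))) \<noteq> 0"
    by (auto simp: residue_pot[OF t] split: if_splits)
  then obtain c' k l where kl: "(c', k, l) \<in> set (socle t)"
    and "Poly_Mapping.lookup f (m + (Poly_Mapping.single i k + Poly_Mapping.single j l)) \<noteq> 0"
  proof -
    have "\<exists>x\<in>set xs. g x \<noteq> 0" if "sum_list (map g xs) \<noteq> 0" for g :: "'x \<Rightarrow> complex" and xs
      using that by (induction xs) auto
    from this[OF nz'] show ?thesis using that by auto
  qed
  then have key: "m + (Poly_Mapping.single i k + Poly_Mapping.single j l) \<in> Poly_Mapping.keys f" (is "?a \<in> _")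
    by (simp add: in_keys_iff)
  have "c = wdeg w ?a" using hom key by (simp add: homog_def)
  also have "\<dots> = wdeg w m + 2 * (1 - 2 / of_nat (cox t))"
    using socle_degree[OF t(1) kl] by (simp add: wdeg_add w)
  finally have "c = wdeg w m + 2 * (1 - 2 / of_nat (cox t))" .
  moreover have "wdeg w m \<ge> 0"
  proof (rule wdeg_nonneg)
    fix k assume "k \<in> Poly_Mapping.keys m"
    then have "k \<in> Poly_Mapping.keys ?a" by (simp add: in_keys_iff lookup_add)
    then have "k \<in> vars f" using key by (auto simp: vars_def)
    then show "w k \<ge> 0" using pos by force
  qed
  ultimately show ?thesis by simp
qed

lemma vars_pd: "vars (pd i p) \<subseteq> vars p"
  unfolding pd_def
proof (rule vars_sum_subI)
  fix a assume "a \<in> Poly_Mapping.keys p"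
  moreover have "Poly_Mapping.keys (a - Poly_Mapping.single i 1) \<subseteq> Poly_Mapping.keys a"
    by (auto simp: in_keys_iff lookup_minus)
  ultimately show "vars (mono (of_nat (Poly_Mapping.lookup a i) * Poly_Mapping.lookup p a) (a - Poly_Mapping.single i 1)) \<subseteq> vars p"
    by (auto simp: vars_def mono_def split: if_splits)
qed

lemma vars_matmul:
  assumes "\<And>i j. i < r \<Longrightarrow> j < r \<Longrightarrow> vars (X i j) \<subseteq> S" "\<And>i j. i < r \<Longrightarrow> j < r \<Longrightarrow> vars (Y i j) \<subseteq> S" "i < r" "j < r"
  shows "vars (matmul r X Y i j) \<subseteq> S"
  unfolding matmul_def using assms by (intro vars_sum_subI vars_subI) auto

lemma vars_hmat:
  assumes "\<And>i j. i < r \<Longrightarrow> j < r \<Longrightarrow> vars (D i j) \<subseteq> S" "r0 \<le> r"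
  shows "vars (hmat r0 r D) \<subseteq> S"
proof -
  have d: "vars (dmat v D i j) \<subseteq> S" if "i < r" "j < r" for v i j
    using assms(1)[OF that] vars_pd[of v "D i j"] by (auto simp: dmat_def)
  show ?thesis
    unfolding hmat_def str_def
    by (intro vars_subI vars_sum_subI vars_matmul d) (use assms(2) in auto)
qed

text \<open>With central charges \<open>c1\<close>, \<open>c2\<close> the numerator has degree
  \<open>c1 + c2\<close>, and the two residues require \<open>2 c2 \<le> c1 + c2\<close> and
  \<open>2 c1 \<le> c1 + c2\<close>.\<close>

theorem orb_equiv_imp_cox_eq:
  assumes v: "valid t1" "valid t2" and oe: "orb_equiv 2 (PX t1) 2 (PX t2)"
  shows "cox t1 = cox t2"
proof -
  obtain w r0 r q D where pos: "\<forall>i<2+2. w i > 0" and h: "homog w 2 (PX t1)" "homog w 2 (shift 2 (PX t2))"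
    and mf: "graded_mf 2 (PX t1) 2 (PX t2) w r0 r q D"
    and nz: "qdim_l 2 (PX t1) 2 (PX t2) r0 r D \<noteq> 0" "qdim_r 2 (PX t1) 2 (PX t2) r0 r D \<noteq> 0"
    using oe unfolding orb_equiv_def by blast
  have r: "r0 \<le> r" using mf by (simp add: graded_mf_def)
  have w1: "w 0 = wtx t1" "w 1 = wty t1"
    using homog_potD[OF v(1) _ h(1)] by auto
  have w2: "w 2 = wtx t2" "w 3 = wty t2"
    using homog_potD[OF v(2) _ h(2)[unfolded shift_pot]] by auto
  have "gmat w q r 1 D" using mf by (simp add: graded_mf_def gmat_def)
  from homog_hmat[OF this r] have hom: "homog w ((1 - 2 / of_nat (cox t1)) + (1 - 2 / of_nat (cox t2))) (hmat r0 r D)"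
    unfolding w1 w2 central_charge[OF v(1)] central_charge[OF v(2)] .
  have "vars (hmat r0 r D) \<subseteq> {..<2+2}"
    by (rule vars_hmat[OF _ r]) (use mf in \<open>simp add: graded_mf_def\<close>)
  then have pos': "\<And>k. k \<in> vars (hmat r0 r D) \<Longrightarrow> w k > 0" using pos by auto
  have "2 * (1 - 2 / of_nat (cox t2)) \<le> (1 - 2 / of_nat (cox t1)) + (1 - 2 / of_nat (cox t2) :: rat)"
    by (rule residue_nonzero_degree[OF v(2) _ w2 hom pos']) (use nz(1)[unfolded qdim_l_pot[OF r]] in auto)
  moreover have "2 * (1 - 2 / of_nat (cox t1)) \<le> (1 - 2 / of_nat (cox t1)) + (1 - 2 / of_nat (cox t2) :: rat)"
    by (rule residue_nonzero_degree[OF v(1) _ w1 hom pos']) (use nz(2)[unfolded qdim_r_pot[OF r]] in auto)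
  moreover have "2 * (1 - b) \<le> (1 - a) + (1 - b) \<Longrightarrow> 2 * (1 - a) \<le> (1 - a) + (1 - b) \<Longrightarrow> a = b" for a b :: rat
    by (simp add: algebra_simps)
  ultimately have "2 / of_nat (cox t1) = (2 / of_nat (cox t2) :: rat)" by blast
  moreover have "cox t \<noteq> 0" if "valid t" for t using that by (cases t) auto
  note this[OF v(1)] this[OF v(2)]
  ultimately show ?thesis by (simp add: field_simps)
qed

section \<open>A numerical criterion for orbifold equivalence\<close>

text \<open>All other variables are set to 0: for equal Coxeter numbers the numerator has exactly
  the socle degree, so each residue is a constant that sees only monomials in its own two
  variables.\<close>

definition pt :: "nat \<Rightarrow> nat \<Rightarrow> complex \<Rightarrow> complex \<Rightarrow> nat \<Rightarrow> complex" where
  "pt i j x y k = (if k = i then x else if k = j then y else 0)"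

lemma ev_support:
  assumes "finite S" "\<And>a. a \<in> Poly_Mapping.keys p \<Longrightarrow> mpow s a \<noteq> 0 \<Longrightarrow> a \<in> S"
  shows "ev s p = (\<Sum>a\<in>S. Poly_Mapping.lookup p a * mpow s a)"
proof -
  have "ev s p = (\<Sum>a\<in>Poly_Mapping.keys p \<union> S. Poly_Mapping.lookup p a * mpow s a)"
    unfolding ev_def using id_hom.ins_superset[of "Poly_Mapping.keys p \<union> S" p s] assms(1) by simp
  also have "\<dots> = (\<Sum>a\<in>S. Poly_Mapping.lookup p a * mpow s a)"
    by (rule sum.mono_neutral_right) (use assms in \<open>auto simp: in_keys_iff\<close>)
  finally show ?thesis .
qed

text \<open>A monomial contributes only if it has the right degree and avoids every variable that
  vanishes at the point. \<open>T\<close> may be any finite set containing these exponents, as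
  further pairs contribute 0.\<close>

lemma ev_pt_homog:
  assumes "i \<noteq> j" "homog w c f" "finite T"
    and T: "\<And>k l. w i * of_nat k + w j * of_nat l = c \<Longrightarrow> (x = 0 \<Longrightarrow> k = 0) \<Longrightarrow> (y = 0 \<Longrightarrow> l = 0) \<Longrightarrow> (k, l) \<in> T"
  shows "ev (pt i j x y) f
    = (\<Sum>(k, l)\<in>T. Poly_Mapping.lookup f (Poly_Mapping.single i k + Poly_Mapping.single j l) * (x ^ k * y ^ l))"
proof -
  let ?m = "\<lambda>(k, l). Poly_Mapping.single i k + Poly_Mapping.single j l"
  have lk: "Poly_Mapping.lookup (?m kl) i = fst kl" "Poly_Mapping.lookup (?m kl) j = snd kl" for kl
    using assms(1) by (auto simp: lookup_add lookup_single when_def split: prod.splits)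
  have inj: "inj_on ?m T"
  proof (rule inj_onI)
    fix a b assume "?m a = ?m b"
    then show "a = b"
      using lk(1)[of a] lk(1)[of b] lk(2)[of a] lk(2)[of b] by (intro prod_eqI) simp_all
  qed
  have mp: "mpow (pt i j x y) (?m (k, l)) = x ^ k * y ^ l" for k l
    using assms(1) by (simp add: mpow_add pt_def)
  have "ev (pt i j x y) f = (\<Sum>a\<in>?m ` T. Poly_Mapping.lookup f a * mpow (pt i j x y) a)"
  proof (rule ev_support)
    fix a assume a: "a \<in> Poly_Mapping.keys f" "mpow (pt i j x y) a \<noteq> 0"
    have nz: "pt i j x y k \<noteq> 0" if "k \<in> Poly_Mapping.keys a" for k
    proof
      assume "pt i j x y k = 0"
      then have "mpow (pt i j x y) a = 0"
        unfolding mpow_def using that by (intro prod_zero) (auto simp: in_keys_iff)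
      with a(2) show False by simp
    qed
    let ?k = "Poly_Mapping.lookup a i" and ?l = "Poly_Mapping.lookup a j"
    have am: "a = ?m (?k, ?l)"
    proof (rule poly_mapping_eqI)
      fix k
      show "Poly_Mapping.lookup a k = Poly_Mapping.lookup (?m (?k, ?l)) k"
        using nz[of k] assms(1)
        by (cases "Poly_Mapping.lookup a k = 0") (auto simp: lookup_add lookup_single when_def in_keys_iff pt_def split: if_splits)
    qed
    have "w i * of_nat ?k + w j * of_nat ?l = c"
      using assms(2) a(1) am by (metis (no_types, lifting) homog_def wdeg_add wdeg_single case_prod_conv)
    moreover have "x = 0 \<Longrightarrow> ?k = 0" "y = 0 \<Longrightarrow> ?l = 0"
      using nz[of i] nz[of j] assms(1) by (auto simp: pt_def in_keys_iff)
    ultimately have "(?k, ?l) \<in> T" by (rule T)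
    then show "a \<in> ?m ` T" using am by (metis (no_types, lifting) image_eqI)
  qed (use assms in simp)
  also have "\<dots> = (\<Sum>kl\<in>T. Poly_Mapping.lookup f (?m kl) * mpow (pt i j x y) (?m kl))"
    using inj by (simp add: sum.reindex)
  also have "\<dots> = (\<Sum>(k, l)\<in>T. Poly_Mapping.lookup f (Poly_Mapping.single i k + Poly_Mapping.single j l) * (x ^ k * y ^ l))"
    by (rule sum.cong) (use mp in \<open>auto split: prod.splits\<close>)
  finally show ?thesis .
qed

text \<open>The functional \<open>socle\<close> expressed through values of a quasi-homogeneous polynomial.\<close>
fun evf :: "ade \<Rightarrow> nat \<Rightarrow> nat \<Rightarrow> mpoly \<Rightarrow> complex" where
  "evf (TA d) i j f = ev (pt i j 1 0) f / (2 * of_nat d)"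
| "evf (TD d) i j f = ev (pt i j 1 0) f / (2 * of_nat d) - ev (pt i j 0 1) f / 2"
| "evf TE6 i j f = ev (pt i j 1 1) f / 12"
| "evf TE7 i j f = ev (pt i j 1 1) f / 9 - 4 / 9 * ev (pt i j 0 1) f"
| "evf TE8 i j f = ev (pt i j 1 1) f / 15"

lemma evf_scale:
  assumes "\<And>x y. ev (pt i j x y) f = c * ev (pt i j x y) g"
  shows "evf t i j f = c * evf t i j g"
  by (cases t) (simp_all add: assms algebra_simps)

lemma ev_TA:
  assumes "d \<ge> 2" "i \<noteq> j" "w i = wtx (TA d)" "homog w (2 * (1 - 2 / of_nat d)) f"
  shows "ev (pt i j z 0) f = Poly_Mapping.lookup f (Poly_Mapping.single i (d - 2)) * z ^ (d - 2)"
proof -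
  have "k = d - 2" if "2 / of_nat d * of_nat k = 2 * (1 - 2 / of_nat d :: rat)" for k
  proof -
    have "(of_nat k :: rat) = of_nat (d - 2)"
      using that assms(1) by (simp add: field_simps of_nat_diff)
    then show ?thesis by (simp only: of_nat_eq_iff)
  qed
  then have "ev (pt i j z 0) f = (\<Sum>(k, l)\<in>{(d - 2, 0)}. Poly_Mapping.lookup f (Poly_Mapping.single i k + Poly_Mapping.single j l) * (z ^ k * 0 ^ l))"
    by (intro ev_pt_homog[OF assms(2,4)]) (use assms(3) in auto)
  then show ?thesis by simp
qed

lemma evf_eq:
  assumes "valid t" and ij: "i \<noteq> j" and w: "w i = wtx t" "w j = wty t"
    and hom: "homog w (2 * (1 - 2 / of_nat (cox t))) f"
  shows "evf t i j f = (\<Sum>(c, k, l)\<leftarrow>socle t. c * Poly_Mapping.lookup f (Poly_Mapping.single i k + Poly_Mapping.single j l))"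
proof (cases t)
  case (TA d)
  then show ?thesis using ev_TA[OF _ ij, of d w f 1] assms by simp
next
  case (TD d)
  then have d: "d \<ge> 3" using assms(1) by simp
  have "k = d - 1" if "2 / of_nat d * of_nat k = (2 * (1 - 2 / of_nat (cox t)) :: rat)" for k
  proof -
    have "(of_nat k :: rat) = of_nat (d - 1)"
      using that d TD by (simp add: field_simps of_nat_diff)
    then show ?thesis by (simp only: of_nat_eq_iff)
  qed
  then have 1: "ev (pt i j 1 0) f = (\<Sum>(k, l)\<in>{(d - 1, 0)}. Poly_Mapping.lookup f (Poly_Mapping.single i k + Poly_Mapping.single j l) * (1 ^ k * 0 ^ l))"
    by (intro ev_pt_homog[OF ij hom]) (use w TD in auto)
  have "l = 2" if "(1 - 1 / of_nat d) * of_nat l = (2 * (1 - 2 / of_nat (cox t)) :: rat)" for l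
  proof -
    have "(1 - 1 / of_nat d) * of_nat l = (1 - 1 / of_nat d) * (2 :: rat)"
      using that TD by simp
    moreover have "1 - 1 / of_nat d \<noteq> (0 :: rat)" using d by (simp add: field_simps)
    ultimately have "of_nat l = (2 :: rat)" by (simp only: mult_cancel_left)  simp
    then show ?thesis by (metis of_nat_eq_iff of_nat_numeral)
  qed
  then have 2: "ev (pt i j 0 1) f = (\<Sum>(k, l)\<in>{(0, 2)}. Poly_Mapping.lookup f (Poly_Mapping.single i k + Poly_Mapping.single j l) * (0 ^ k * 1 ^ l))"
    by (intro ev_pt_homog[OF ij hom]) (use w TD in auto)
  show ?thesis by (simp add: TD 1 2)
next
  case TE6
  have "(k, l) \<in> {(1, 2)}" if "2 / 3 * of_nat k + 1 / 2 * of_nat l = (5 / 3 :: rat)" for k l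
  proof -
    have "of_nat (4 * k + 3 * l) = (of_nat 10 :: rat)" using that by simp
    then have "4 * k + 3 * l = 10" by (simp only: of_nat_eq_iff)
    then have "k = 1 \<and> l = 2" by presburger
    then show ?thesis by simp
  qed
  then have "ev (pt i j 1 1) f = (\<Sum>(k, l)\<in>{(1, 2)}. Poly_Mapping.lookup f (Poly_Mapping.single i k + Poly_Mapping.single j l) * (1 ^ k * 1 ^ l))"
    by (intro ev_pt_homog[OF ij hom]) (use w TE6 in auto)
  then show ?thesis by (simp add: TE6)
next
  case TE8
  have "(k, l) \<in> {(1, 3)}" if "2 / 3 * of_nat k + 2 / 5 * of_nat l = (28 / 15 :: rat)" for k l
  proof -
    have "of_nat (10 * k + 6 * l) = (of_nat 28 :: rat)" using that by simp
    then have "10 * k + 6 * l = 28" by (simp only: of_nat_eq_iff)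
    then have "k = 1 \<and> l = 3" by presburger
    then show ?thesis by simp
  qed
  then have "ev (pt i j 1 1) f = (\<Sum>(k, l)\<in>{(1, 3)}. Poly_Mapping.lookup f (Poly_Mapping.single i k + Poly_Mapping.single j l) * (1 ^ k * 1 ^ l))"
    by (intro ev_pt_homog[OF ij hom]) (use w TE8 in auto)
  then show ?thesis by (simp add: TE8)
next
  case TE7
  \<comment> \<open>Both socle monomials survive at \<open>(1, 1)\<close>, only \<open>y^4\<close>
    at \<open>(0, 1)\<close>; the factors \<open>1/9\<close> and \<open>- 4/9\<close> add up to
    \<open>- 1/3\<close> on \<open>y^4\<close>.\<close>
  have kl: "(k, l) \<in> {(0, 4), (2, 1)}" if "2 / 3 * of_nat k + 4 / 9 * of_nat l = (16 / 9 :: rat)" for k l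
  proof -
    have "of_nat (6 * k + 4 * l) = (of_nat 16 :: rat)" using that by simp
    then have "6 * k + 4 * l = 16" by (simp only: of_nat_eq_iff)
    then have "k = 0 \<and> l = 4 \<or> k = 2 \<and> l = 1" by presburger
    then show ?thesis by auto
  qed
  have 1: "ev (pt i j x y) f = (\<Sum>(k, l)\<in>{(0, 4), (2, 1)}. Poly_Mapping.lookup f (Poly_Mapping.single i k + Poly_Mapping.single j l) * (x ^ k * y ^ l))" for x y
    by (intro ev_pt_homog[OF ij hom]) (use w TE7 kl in auto)
  show ?thesis by (simp add: TE7 1 algebra_simps)
qed

definition wts :: "ade \<Rightarrow> ade \<Rightarrow> nat \<Rightarrow> rat" where
  "wts t1 t2 k = (if k = 0 then wtx t1 else if k = 1 then wty t1 else if k = 2 then wtx t2 else if k = 3 then wty t2 else 0)"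

lemma wts_simps [simp]: "wts t1 t2 0 = wtx t1" "wts t1 t2 (Suc 0) = wty t1" "wts t1 t2 2 = wtx t2" "wts t1 t2 3 = wty t2"
  by (simp_all add: wts_def)

text \<open>What orbifold equivalence requires once the Coxeter numbers agree: the residues are then
  constants, and \<open>evf\<close> computes them up to sign.\<close>

definition defect :: "ade \<Rightarrow> ade \<Rightarrow> bool" where
  "defect t1 t2 \<longleftrightarrow> (\<exists>r0 r q D. graded_mf 2 (PX t1) 2 (PX t2) (wts t1 t2) r0 r q D \<and>
     evf t2 2 3 (hmat r0 r D) \<noteq> 0 \<and> evf t1 0 1 (hmat r0 r D) \<noteq> 0)"

theorem defect_imp_orb_equiv:
  assumes v: "valid t1" "valid t2" and cox: "cox t1 = cox t2" and "defect t1 t2"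
  shows "orb_equiv 2 (PX t1) 2 (PX t2)"
proof -
  obtain r0 r q D where mf: "graded_mf 2 (PX t1) 2 (PX t2) (wts t1 t2) r0 r q D"
    and e: "evf t2 2 3 (hmat r0 r D) \<noteq> 0" "evf t1 0 1 (hmat r0 r D) \<noteq> 0"
    using assms(4) by (auto simp: defect_def)
  let ?w = "wts t1 t2"
  have r: "r0 \<le> r" using mf by (simp add: graded_mf_def)
  have "gmat ?w q r 1 D" using mf by (simp add: graded_mf_def gmat_def)
  from homog_hmat[OF this r] have hom: "homog ?w ((1 - 2 / of_nat (cox t1)) + (1 - 2 / of_nat (cox t2))) (hmat r0 r D)"
    using central_charge[OF v(1)] central_charge[OF v(2)] by simp
  have cc: "c + c = 2 * c" for c :: rat by simp
  note hom1 = hom[unfolded cox cc] and hom2 = hom[folded cox, unfolded cc]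
  have "Poly_Mapping.lookup (residue [2, 3] [pd 2 (PY t2), pd 3 (PY t2)] (hmat r0 r D)) 0 = evf t2 2 3 (hmat r0 r D)"
    using evf_eq[OF v(2) _ _ _ hom1, of 2 3] by (simp add: residue_pot[OF v(2)])
  then have "qdim_l 2 (PX t1) 2 (PX t2) r0 r D \<noteq> 0"
    using e(1) unfolding qdim_l_pot[OF r] by auto
  moreover have "Poly_Mapping.lookup (residue [0, 1] [pd 0 (PX t1), pd 1 (PX t1)] (hmat r0 r D)) 0 = evf t1 0 1 (hmat r0 r D)"
    using evf_eq[OF v(1) _ _ _ hom2, of 0 1] residue_pot[OF v(1), of 0 1 "hmat r0 r D" 0] by simp
  then have "qdim_r 2 (PX t1) 2 (PX t2) r0 r D \<noteq> 0"
    using e(2) unfolding qdim_r_pot[OF r] by auto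
  moreover have "\<forall>i<2 + 2. ?w i > 0" using wt_pos[OF v(1)] wt_pos[OF v(2)] by (auto simp: wts_def)
  moreover have "homog ?w 2 (PX t1)" "homog ?w 2 (shift 2 (PX t2))"
    unfolding shift_pot using homog_potI[OF v(1), of ?w 0 1] homog_potI[OF v(2), of ?w 2 3] by simp_all
  moreover have "vars (PX t1) \<subseteq> {..<2}" "vars (PX t2) \<subseteq> {..<2}"
    using vars_pot[of t1 0 1] vars_pot[of t2 0 1] by auto
  ultimately show ?thesis
    unfolding orb_equiv_def using mf by blast
qed

section \<open>Symmetry\<close>

definition swv :: "nat \<Rightarrow> nat" where
  "swv i = (if i = 0 then 2 else if i = 1 then 3 else if i = 2 then 0 else if i = 3 then 1 else i)"

abbreviation swap :: "mpoly \<Rightarrow> mpoly" where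
  "swap \<equiv> subst (\<lambda>i. Var (swv i))"

lemma pd_swap: "pd i (swap p) = swap (pd (swv i) p)"
  by (induction p rule: mpoly_induct) (auto simp: swv_def)

lemma matmul_hom:
  "matmul r (\<lambda>i j. c * subst s (X i j)) (\<lambda>i j. d * subst s (Y i j)) = (\<lambda>i j. (c * d) * subst s (matmul r X Y i j))"
  by (simp add: matmul_def fun_eq_iff sum_distrib_left mult_ac)

lemma str_hom: "str r0 r (\<lambda>i j. c * subst s (M i j)) = c * subst s (str r0 r M)"
  by (simp add: str_def sum_distrib_left right_diff_distrib)

lemma evenmat_odd_mult:
  assumes "\<And>i j. i < r \<Longrightarrow> j < r \<Longrightarrow> (i < r0) = (j < r0) \<Longrightarrow> X i j = 0"
    "\<And>i j. i < r \<Longrightarrow> j < r \<Longrightarrow> (i < r0) = (j < r0) \<Longrightarrow> Y i j = 0"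
  shows "evenmat r0 r (matmul r X Y)"
  unfolding evenmat_def matmul_def
proof (intro allI impI sum.neutral ballI)
  fix i j k assume "i < r" "j < r" "(i < r0) \<noteq> (j < r0)" "k \<in> {..<r}"
  then show "X i k * Y k j = 0" using assms(1)[of i k] assms(2)[of k j] by auto
qed

text \<open>Exchanging the two sets of variables in \<open>D\<close> gives a factorisation of the
  negative of the required difference; multiplying \<open>D\<close> by the imaginary unit corrects
  the sign. The fourth power of this factor, which enters the numerator, is 1.\<close>

theorem defect_sym:
  assumes "defect t1 t2"
  shows "defect t2 t1"
proof -
  obtain r0 r q D where mf: "graded_mf 2 (PX t1) 2 (PX t2) (wts t1 t2) r0 r q D"
    and e: "evf t2 2 3 (hmat r0 r D) \<noteq> 0" "evf t1 0 1 (hmat r0 r D) \<noteq> 0"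
    using assms by (auto simp: defect_def)
  define c where "c = Cst \<i>"
  have c2: "c * c = - 1" using Cst_minus[of 1] by (simp add: c_def flip: Cst_mult)
  define D' where "D' = (\<lambda>i j. c * swap (D i j))"
  have r: "r0 \<le> r" and D0: "\<And>i j. i < r \<Longrightarrow> j < r \<Longrightarrow> (i < r0) = (j < r0) \<Longrightarrow> D i j = 0"
    and hD: "\<And>i j. i < r \<Longrightarrow> j < r \<Longrightarrow> homog (wts t1 t2) (1 + q j - q i) (D i j)"
    and vD: "\<And>i j. i < r \<Longrightarrow> j < r \<Longrightarrow> vars (D i j) \<subseteq> {..<2 + 2}"
    and sq: "\<And>i j. i < r \<Longrightarrow> j < r \<Longrightarrow> matmul r D D i j = (if i = j then PY t2 - PX t1 else 0)"
    using mf unfolding graded_mf_def shift_pot by simp_all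
  have dm: "dmat v D' = (\<lambda>i j. c * swap (dmat (swv v) D i j))" for v
    by (simp add: dmat_def D'_def pd_swap c_def fun_eq_iff)
  have sw: "swv 0 = 2" "swv 1 = 3" "swv 2 = 0" "swv 3 = 1" by (simp_all add: swv_def)
  have mf': "graded_mf 2 (PX t2) 2 (PX t1) (wts t2 t1) r0 r q D'"
    unfolding graded_mf_def shift_pot
  proof (intro conjI allI impI)
    show "r0 \<le> r" by (rule r)
  next
    fix i j assume "i < r" "j < r"
    then show "vars (D' i j) \<subseteq> {..<2 + 2}"
      unfolding D'_def c_def using vD[of i j] by (intro vars_subI vars_subst_subI) (auto simp: swv_def)
  next
    fix i j assume "i < r" "j < r" "(i < r0) = (j < r0)"
    then show "D' i j = 0" using D0 by (simp add: D'_def)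
  next
    fix i j assume ij: "i < r" "j < r"
    have "homog (wts t2 t1) (1 + q j - q i) (swap (D i j))"
      by (rule homog_subst[OF hD[OF ij]], rule homog_Var) (simp add: wts_def swv_def)
    then show "homog (wts t2 t1) (1 + q j - q i) (D' i j)"
      unfolding D'_def c_def by (rule homog_mult[OF homog_Cst[OF refl]]) simp
  next
    fix i j assume ij: "i < r" "j < r"
    have "matmul r D' D' i j = - swap (matmul r D D i j)"
      unfolding D'_def matmul_hom c2 by simp
    also have "\<dots> = (if i = j then PY t1 - PX t2 else 0)"
      using sw by (simp add: sq[OF ij] subst_pot)
    finally show "matmul r D' D' i j = (if i = j then PY t1 - PX t2 else 0)" .
  qed
  let ?X = "matmul r (dmat 2 D) (dmat 3 D)" and ?Y = "matmul r (dmat 0 D) (dmat 1 D)"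
  have "hmat r0 r D' = (c * c) * (c * c) * swap (str r0 r (matmul r ?X ?Y))"
    unfolding hmat_def dm sw matmul_hom str_hom matmul_assoc by (simp add: mult_ac)
  \<comment> \<open>The exchange has put the derivatives by variables 2 and 3 first. A product of
    two odd matrices is even, so cyclicity restores the order.\<close>
  also have "\<dots> = swap (str r0 r (matmul r ?Y ?X))"
  proof -
    have "evenmat r0 r ?X"
      by (rule evenmat_odd_mult) (simp_all add: dmat_def D0)
    then show ?thesis by (simp add: c2 str_cyclic[OF r])
  qed
  also have "\<dots> = swap (hmat r0 r D)" by (simp add: hmat_def matmul_assoc)
  finally have H: "hmat r0 r D' = swap (hmat r0 r D)" .
  have p: "(\<lambda>i. pt 2 3 x y (swv i)) = pt 0 1 x y" "(\<lambda>i. pt 0 1 x y (swv i)) = pt 2 3 x y" for x y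
    by (auto simp: pt_def swv_def fun_eq_iff)
  have "evf t1 2 3 (hmat r0 r D') = evf t1 0 1 (hmat r0 r D)"
    by (cases t1) (simp_all add: H ev_subst p[unfolded One_nat_def])
  moreover have "evf t2 0 1 (hmat r0 r D') = evf t2 2 3 (hmat r0 r D)"
    by (cases t2) (simp_all add: H ev_subst p[unfolded One_nat_def])
  ultimately show ?thesis
    unfolding defect_def using mf' e by metis
qed

section \<open>Block matrices\<close>

definition blk :: "nat \<Rightarrow> (nat \<Rightarrow> nat \<Rightarrow> mpoly) \<Rightarrow> (nat \<Rightarrow> nat \<Rightarrow> mpoly) \<Rightarrow> (nat \<Rightarrow> nat \<Rightarrow> mpoly)
    \<Rightarrow> (nat \<Rightarrow> nat \<Rightarrow> mpoly) \<Rightarrow> nat \<Rightarrow> nat \<Rightarrow> mpoly" where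
  "blk n A B C E i j = (if i < n then (if j < n then A i j else B i (j - n))
     else (if j < n then C (i - n) j else E (i - n) (j - n)))"

definition tr :: "nat \<Rightarrow> (nat \<Rightarrow> nat \<Rightarrow> mpoly) \<Rightarrow> mpoly" where
  "tr n M = (\<Sum>i<n. M i i)"

lemma sum_lessThan_add: "(\<Sum>k<n + n. f k) = (\<Sum>k<n. f k) + (\<Sum>k<n. f (n + k :: nat) :: mpoly)"
  by (simp add: lessThan_atLeast0 sum.atLeastLessThan_concat[of 0 n "n + n", symmetric] sum.shift_bounds_nat_ivl[of f 0 n n, simplified] add.commute)

lemma matmul_blk:
  "matmul (n + n) (blk n A B C E) (blk n A' B' C' E') =
    blk n (\<lambda>i j. matmul n A A' i j + matmul n B C' i j) (\<lambda>i j. matmul n A B' i j + matmul n B E' i j)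
      (\<lambda>i j. matmul n C A' i j + matmul n E C' i j) (\<lambda>i j. matmul n C B' i j + matmul n E E' i j)"
  by (simp add: fun_eq_iff matmul_def sum_lessThan_add blk_def)

lemma dmat_blk: "dmat v (blk n A B C E) = blk n (dmat v A) (dmat v B) (dmat v C) (dmat v E)"
  by (simp add: fun_eq_iff dmat_def blk_def)

lemma str_blk: "str n (n + n) (blk n A B C E) = tr n A - tr n E"
proof -
  have "(\<Sum>i\<in>{n..<n + n}. blk n A B C E i i) = (\<Sum>i<n. E i i)"
    using sum.shift_bounds_nat_ivl[of "\<lambda>i. blk n A B C E i i" 0 n n]
    by (simp add: blk_def lessThan_atLeast0)
  then show ?thesis by (simp add: str_def tr_def blk_def)
qed

lemma tr_blk: "tr (n + n) (blk n A B C E) = tr n A + tr n E"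
  by (simp add: tr_def sum_lessThan_add blk_def)

abbreviation Zm :: "nat \<Rightarrow> nat \<Rightarrow> mpoly" where "Zm \<equiv> (\<lambda>i j. 0)"

lemma matmul_lin [simp]:
  "matmul n Zm B = Zm" "matmul n A Zm = Zm"
  "matmul n (\<lambda>i j. A i j + B i j) C = (\<lambda>i j. matmul n A C i j + matmul n B C i j)"
  "matmul n (\<lambda>i j. A i j - B i j) C = (\<lambda>i j. matmul n A C i j - matmul n B C i j)"
  "matmul n A (\<lambda>i j. B i j + C i j) = (\<lambda>i j. matmul n A B i j + matmul n A C i j)"
  "matmul n A (\<lambda>i j. B i j - C i j) = (\<lambda>i j. matmul n A B i j - matmul n A C i j)"
  "matmul n (\<lambda>i j. x * A i j) B = (\<lambda>i j. x * matmul n A B i j)"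
  "matmul n A (\<lambda>i j. x * B i j) = (\<lambda>i j. x * matmul n A B i j)"
  "matmul n (\<lambda>i j. - A i j) B = (\<lambda>i j. - matmul n A B i j)"
  "matmul n A (\<lambda>i j. - B i j) = (\<lambda>i j. - matmul n A B i j)"
  by (simp_all add: fun_eq_iff matmul_def algebra_simps sum.distrib sum_subtractf sum_negf sum_distrib_left)

lemma tr_lin:
  "tr n Zm = 0"
  "tr n (\<lambda>i j. A i j + B i j) = tr n A + tr n B"
  "tr n (\<lambda>i j. A i j - B i j) = tr n A - tr n B"
  "tr n (\<lambda>i j. x * A i j) = x * tr n A"
  "tr n (\<lambda>i j. - A i j) = - tr n A"
  by (simp_all add: tr_def sum.distrib sum_subtractf sum_distrib_left sum_negf)

lemma dmat_lin:
  "dmat v Zm = Zm"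
  "dmat v (\<lambda>i j. A i j + B i j) = (\<lambda>i j. dmat v A i j + dmat v B i j)"
  "dmat v (\<lambda>i j. A i j - B i j) = (\<lambda>i j. dmat v A i j - dmat v B i j)"
  "dmat v (\<lambda>i j. x * A i j) = (\<lambda>i j. pd v x * A i j + x * dmat v A i j)"
  "dmat v idmat = Zm"
  by (simp_all add: fun_eq_iff dmat_def idmat_def)

lemma idmat_matmul: "i < n \<Longrightarrow> matmul n idmat A i j = A i j"
  by (simp add: matmul_def idmat_def if_distrib[of "\<lambda>x. x * _"] cong: if_cong)

lemma matmul_idmat_matmul [simp]: "matmul n A (matmul n idmat B) = matmul n A B"
  by (simp add: fun_eq_iff matmul_def[of n A] idmat_matmul)

lemma pd_notin_vars: "i \<notin> vars p \<Longrightarrow> pd i p = 0"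
  unfolding pd_def by (intro sum.neutral) (auto simp: vars_def in_keys_iff)

lemma dmat_notin_vars: "(\<And>i j. v \<notin> vars (A i j)) \<Longrightarrow> dmat v A = Zm"
  by (simp add: fun_eq_iff dmat_def pd_notin_vars)

section \<open>Matrix factorisations linear in the second variable\<close>

text \<open>As \<open>R\<close> and \<open>T\<close> commute,
  \<open>(R - y T) (R + y T) = R^2 - y^2 T^2\<close> for \<open>y = Var 1\<close>. Taking
  \<open>T = 1\<close> accounts for the summand \<open>y^2\<close> of type A, and
  \<open>T^2 = Var 0\<close> for the summand \<open>x y^2\<close> of type D.\<close>

lemma defect_linear:
  fixes R T :: "nat \<Rightarrow> nat \<Rightarrow> mpoly"
  assumes vR: "\<And>i j. vars (R i j) \<subseteq> {0, 2, 3}" and vT: "\<And>i j. vars (T i j) \<subseteq> {0}"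
    and gR: "gmat (wts t1 t2) q n 1 R" and gT: "gmat (wts t1 t2) q n (1 - wty t1) T"
    and comm: "\<And>i j. i < n \<Longrightarrow> j < n \<Longrightarrow> matmul n R T i j = matmul n T R i j"
    and sq: "\<And>i j. i < n \<Longrightarrow> j < n \<Longrightarrow> matmul n R R i j - Var 1 ^ 2 * matmul n T T i j = (if i = j then PY t2 - PX t1 else 0)"
    and h: "h = tr n (matmul n (dmat 0 R) (matmul n T (matmul n (dmat 2 R) (dmat 3 R))))"
    and nz: "evf t2 2 3 h \<noteq> 0" "evf t1 0 1 h \<noteq> 0"
  shows "defect t1 t2"
proof -
  define A where "A = (\<lambda>i j. R i j - Var 1 * T i j)"
  define B where "B = (\<lambda>i j. R i j + Var 1 * T i j)"
  define D where "D = blk n Zm A B Zm"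
  have "dmat 1 R = Zm" "dmat 1 T = Zm" "dmat 2 T = Zm" "dmat 3 T = Zm"
    by (rule dmat_notin_vars; use vR vT in fastforce)+
  note z = this
  have d: "dmat 0 A = (\<lambda>i j. dmat 0 R i j - Var 1 * dmat 0 T i j)" "dmat 0 B = (\<lambda>i j. dmat 0 R i j + Var 1 * dmat 0 T i j)"
    "dmat 1 A = (\<lambda>i j. - T i j)" "dmat 1 B = T" "dmat 2 A = dmat 2 R" "dmat 2 B = dmat 2 R" "dmat 3 A = dmat 3 R" "dmat 3 B = dmat 3 R"
    unfolding A_def B_def dmat_lin z by (simp_all add: fun_eq_iff)
  \<comment> \<open>The two diagonal blocks contribute equally, except that the terms containing the
    derivative of \<open>T\<close> by \<open>Var 0\<close> cancel.\<close>
  have H: "hmat n (n + n) D = 2 * h"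
    unfolding hmat_def D_def dmat_blk dmat_lin d matmul_blk str_blk h
    by (simp add: tr_lin)
  have mf: "graded_mf 2 (PX t1) 2 (PX t2) (wts t1 t2) n (n + n) (\<lambda>i. q (if i < n then i else i - n)) D"
    unfolding graded_mf_def shift_pot
  proof (intro conjI allI impI)
    fix i j :: nat
    have "vars (A i j) \<subseteq> {..<2 + 2}" "vars (B i j) \<subseteq> {..<2 + 2}" for i j
      unfolding A_def B_def using vR[of i j] vT[of i j] by (intro vars_subI; fastforce)+
    then show "vars (D i j) \<subseteq> {..<2 + 2}"
      by (simp add: D_def blk_def)
    assume ij: "i < n + n" "j < n + n"
    then show "D i j = 0" if "(i < n) = (j < n)"
      using that by (simp add: D_def blk_def)
    have g: "homog (wts t1 t2) (1 + q j - q i) (A i j)" "homog (wts t1 t2) (1 + q j - q i) (B i j)" if "i < n" "j < n" for i j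
    proof -
      have "homog (wts t1 t2) (1 + q j - q i) (Var 1 * T i j)"
        using gT that by (intro homog_mult[OF homog_Var[OF refl], where d = "1 - wty t1 + q j - q i"]) (auto simp: gmat_def)
      then show "homog (wts t1 t2) (1 + q j - q i) (A i j)" "homog (wts t1 t2) (1 + q j - q i) (B i j)"
        unfolding A_def B_def using gR that by (auto simp: gmat_def intro: homog_add homog_diff)
    qed
    show "homog (wts t1 t2) (1 + q (if j < n then j else j - n) - q (if i < n then i else i - n)) (D i j)"
      using ij g by (auto simp: D_def blk_def homog_0)
    have AB: "matmul n A B i j = (if i = j then PY t2 - PX t1 else 0)" "matmul n B A i j = (if i = j then PY t2 - PX t1 else 0)" if "i < n" "j < n" for i j
      unfolding A_def B_def sq[OF that, symmetric] using comm[OF that] by (simp_all add: algebra_simps power2_eq_square)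
    show "matmul (n + n) D D i j = (if i = j then PY t2 - PX t1 else 0)"
      unfolding D_def matmul_blk using ij AB by (auto simp: blk_def)
  qed simp
  have "evf t i j (2 * h) = 2 * evf t i j h" for t i j
    by (rule evf_scale) simp
  then have "evf t2 2 3 (hmat n (n + n) D) \<noteq> 0" "evf t1 0 1 (hmat n (n + n) D) \<noteq> 0"
    unfolding H using nz by simp_all
  with mf show ?thesis
    unfolding defect_def by blast
qed

lemma homog_tr: "gmat w q n c M \<Longrightarrow> homog w c (tr n M)"
  using homog_str[of n n w q c M] by (simp add: str_def tr_def)

lemma homog_linear_trace:
  assumes "gmat (wts t1 t2) q n 1 R" "gmat (wts t1 t2) q n (1 - wty t1) T" "valid t1" "valid t2" "cox t1 = cox t2"
  shows "homog (wts t1 t2) (2 * (1 - 2 / of_nat (cox t1)))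
    (tr n (matmul n (dmat 0 R) (matmul n T (matmul n (dmat 2 R) (dmat 3 R)))))"
proof -
  note * = gmat_dmat[OF assms(1)]
  have "gmat (wts t1 t2) q n ((1 - wts t1 t2 0) + ((1 - wty t1) + ((1 - wts t1 t2 2) + (1 - wts t1 t2 3))))
     (matmul n (dmat 0 R) (matmul n T (matmul n (dmat 2 R) (dmat 3 R))))"
    by (intro gmat_matmul * assms(2))
  moreover have "(1 - wts t1 t2 0) + ((1 - wty t1) + ((1 - wts t1 t2 2) + (1 - wts t1 t2 3))) = 2 * (1 - 2 / of_nat (cox t1))"
    using central_charge[OF assms(3)] central_charge[OF assms(4)] assms(5) by simp
  ultimately show ?thesis by (simp only: homog_tr)
qed

text \<open>On the axis, \<open>f\<close> is a multiple of \<open>z^(d-2)\<close>, so any point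
  where it is non-zero detects the coefficient.\<close>

lemma evf_TA_nonzero:
  assumes "d \<ge> 2" "i \<noteq> j" "w i = wtx (TA d)" "homog w (2 * (1 - 2 / of_nat d)) f" "ev (pt i j z 0) f \<noteq> 0"
  shows "evf (TA d) i j f \<noteq> 0"
  using ev_TA[OF assms(1-4), of z] ev_TA[OF assms(1-4), of 1] assms(1,5) by auto

text \<open>Without the variable \<open>j\<close> in \<open>f\<close> the summand of the functional
  at \<open>y^2\<close> vanishes, and the coefficient of \<open>x^(d-1)\<close> is detected on the
  axis.\<close>

lemma evf_TD_nonzero:
  assumes d: "d \<ge> 3" and ij: "i \<noteq> j" and w: "w i = wtx (TD d)" "w j = wty (TD d)"
    and hom: "homog w (2 * (1 - 2 / of_nat (cox (TD d)))) f"
    and nz: "ev (pt i j z 0) f \<noteq> 0" and j: "j \<notin> vars f"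
  shows "evf (TD d) i j f \<noteq> 0"
proof -
  have "k = d - 1" if "2 / of_nat d * of_nat k = (2 * (1 - 2 / of_nat (cox (TD d))) :: rat)" for k
  proof -
    have "(of_nat k :: rat) = of_nat (d - 1)"
      using that d by (simp add: field_simps of_nat_diff)
    then show ?thesis by (simp only: of_nat_eq_iff)
  qed
  then have "ev (pt i j z 0) f = (\<Sum>(k, l)\<in>{(d - 1, 0)}. Poly_Mapping.lookup f (Poly_Mapping.single i k + Poly_Mapping.single j l) * (z ^ k * 0 ^ l))"
    by (intro ev_pt_homog[OF ij hom]) (use w in auto)
  then have 1: "Poly_Mapping.lookup f (Poly_Mapping.single i (d - 1)) \<noteq> 0" using nz by auto
  have "Poly_Mapping.lookup f (Poly_Mapping.single j 2) = 0"
  proof (rule ccontr)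
    assume "Poly_Mapping.lookup f (Poly_Mapping.single j 2) \<noteq> 0"
    then have "Poly_Mapping.single j 2 \<in> Poly_Mapping.keys f" by (simp add: in_keys_iff)
    then show False using j by (force simp: vars_def)
  qed
  then have "evf (TD d) i j f = Poly_Mapping.lookup f (Poly_Mapping.single i (d - 1)) / (2 * of_nat d)"
    using evf_eq[of "TD d", OF _ ij w hom] d by simp
  then show ?thesis using 1 d by simp
qed

section \<open>Matrix factorisations of A and D type\<close>

lemma cpow_root:
  assumes "z \<noteq> 0" "n > 0"
  obtains k :: complex where "k ^ n = z"
proof
  show "(rcis (root n (cmod z)) (Arg z / of_nat n)) ^ n = z"
    using assms by (simp add: DeMoivre2 rcis_cmod_Arg)
qed

text \<open>The part even in \<open>u\<close> of the product of the derivatives of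
  \<open>P0 + u P1\<close> by variables 2 and 3, where \<open>u^2 = Var 0\<close>; \<open>Z1\<close>
  is the odd part divided by \<open>u\<close>.\<close>

definition Z0 :: "nat \<Rightarrow> (nat \<Rightarrow> nat \<Rightarrow> mpoly) \<Rightarrow> (nat \<Rightarrow> nat \<Rightarrow> mpoly) \<Rightarrow> nat \<Rightarrow> nat \<Rightarrow> mpoly" where
  "Z0 n P0 P1 = (\<lambda>i j. matmul n (dmat 2 P0) (dmat 3 P0) i j + Var 0 * matmul n (dmat 2 P1) (dmat 3 P1) i j)"

definition Z1 :: "nat \<Rightarrow> (nat \<Rightarrow> nat \<Rightarrow> mpoly) \<Rightarrow> (nat \<Rightarrow> nat \<Rightarrow> mpoly) \<Rightarrow> nat \<Rightarrow> nat \<Rightarrow> mpoly" where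
  "Z1 n P0 P1 = (\<lambda>i j. matmul n (dmat 2 P0) (dmat 3 P1) i j + matmul n (dmat 2 P1) (dmat 3 P0) i j)"

text \<open>With \<open>P = P0 + u P1\<close> and \<open>u\<^sup>2 = Var 0\<close>, these are the even part of \<open>tr (\<partial>\<^sub>u P \<partial>\<^sub>2 P \<partial>\<^sub>3 P)\<close>
  and its odd part divided by \<open>u\<close>.\<close>
definition hE :: "nat \<Rightarrow> (nat \<Rightarrow> nat \<Rightarrow> mpoly) \<Rightarrow> (nat \<Rightarrow> nat \<Rightarrow> mpoly) \<Rightarrow> mpoly" where
  "hE n P0 P1 = tr n (matmul n P1 (Z0 n P0 P1)) + 2 * Var 0 * (tr n (matmul n (dmat 0 P1) (Z0 n P0 P1)) + tr n (matmul n (dmat 0 P0) (Z1 n P0 P1)))"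

definition hO :: "nat \<Rightarrow> (nat \<Rightarrow> nat \<Rightarrow> mpoly) \<Rightarrow> (nat \<Rightarrow> nat \<Rightarrow> mpoly) \<Rightarrow> mpoly" where
  "hO n P0 P1 = tr n (matmul n P1 (Z1 n P0 P1)) + 2 * tr n (matmul n (dmat 0 P0) (Z0 n P0 P1)) + 2 * Var 0 * tr n (matmul n (dmat 0 P1) (Z1 n P0 P1))"

definition smat :: "(nat \<Rightarrow> mpoly) \<Rightarrow> (nat \<Rightarrow> nat \<Rightarrow> mpoly) \<Rightarrow> nat \<Rightarrow> nat \<Rightarrow> mpoly" where
  "smat s A = (\<lambda>i j. subst s (A i j))"

lemma matmul_smat [simp]: "matmul n (smat s A) (smat s B) = smat s (matmul n A B)"
  by (simp add: smat_def matmul_def fun_eq_iff)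

lemma tr_smat [simp]: "tr n (smat s A) = subst s (tr n A)"
  by (simp add: smat_def tr_def)

lemma pd_subst_other:
  assumes "i \<noteq> 0" "\<And>j. pd i (s j) = (if j = i then 1 else 0)"
  shows "pd i (subst s p) = subst s (pd i p)"
  by (induction p rule: mpoly_induct) (use assms in \<open>auto simp: algebra_simps\<close>)

lemma pd_subst_0:
  assumes "\<And>j. j \<noteq> 0 \<Longrightarrow> pd 0 (s j) = 0"
  shows "pd 0 (subst s p) = pd 0 (s 0) * subst s (pd 0 p)"
  by (induction p rule: mpoly_induct) (use assms in \<open>auto simp: algebra_simps\<close>)

text \<open>In the basis \<open>1, u\<close> over the polynomials in \<open>u^2\<close>, the matrix
  \<open>Q0 + u Q1\<close> becomes \<open>R\<close> and multiplication by \<open>u\<close> becomes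
  \<open>T\<close>. The derivative of the factor \<open>Var 0\<close> in \<open>R\<close> produces
  the summand of \<open>hE\<close> that contains \<open>P1\<close> itself.\<close>

lemma tr_D_type:
  assumes "R = blk n Q0 (\<lambda>i j. Var 0 * Q1 i j) Q1 Q0" "T = blk n Zm (\<lambda>i j. Var 0 * idmat i j) idmat Zm"
  shows "tr (n + n) (matmul (n + n) (dmat 0 R) (matmul (n + n) T (matmul (n + n) (dmat 2 R) (dmat 3 R)))) = hE n Q0 Q1"
  unfolding assms dmat_blk dmat_lin matmul_blk tr_blk hE_def Z0_def Z1_def
  by (simp add: tr_lin algebra_simps)

text \<open>The substitution of \<open>\<kappa> u\<close> for \<open>u\<close>, which normalises the
  coefficient of \<open>u^h\<close>.\<close>

lemma hE_scale:
  fixes \<kappa> :: complex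
  defines "s \<equiv> (\<lambda>i. if i = 0 then Cst (\<kappa> ^ 2) * Var 0 else Var i)"
  shows "hE n (smat s P0) (\<lambda>i j. Cst \<kappa> * smat s P1 i j) = Cst \<kappa> * subst s (hE n P0 P1)"
proof -
  have 0: "dmat 0 (smat s P) = (\<lambda>i j. Cst (\<kappa> ^ 2) * smat s (dmat 0 P) i j)" for P
    by (simp add: fun_eq_iff dmat_def smat_def pd_subst_0 s_def)
  have 2: "dmat 2 (smat s P) = smat s (dmat 2 P)" "dmat 3 (smat s P) = smat s (dmat 3 P)" for P
    by (simp_all add: fun_eq_iff dmat_def smat_def pd_subst_other s_def)
  have s0: "s 0 = Cst \<kappa> * (Cst \<kappa> * Var 0)"
    by (simp add: s_def power2_eq_square Cst_mult mult.assoc)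
  have C: "Cst (\<kappa> ^ 2) = Cst \<kappa> * Cst \<kappa>" by (simp add: power2_eq_square Cst_mult)
  show ?thesis
    unfolding hE_def Z0_def Z1_def dmat_lin 0 2
    by (simp add: tr_lin s0 C algebra_simps)
qed

text \<open>The chain rule for \<open>u = U\<close>: both parities of the trace survive, in contrast
  to \<open>tr_D_type\<close>.\<close>

lemma tr_A_type:
  fixes \<kappa> :: complex
  defines "U \<equiv> Cst \<kappa> * Var 0"
  defines "s \<equiv> (\<lambda>i. if i = 0 then U ^ 2 else if i = 1 then 0 else Var i)"
  assumes P: "P = (\<lambda>i j. smat s P0 i j + U * smat s P1 i j)"
  shows "tr n (matmul n (dmat 0 P) (matmul n idmat (matmul n (dmat 2 P) (dmat 3 P))))
    = Cst \<kappa> * (subst s (hE n P0 P1) + U * subst s (hO n P0 P1))"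
proof -
  have s0: "s 0 = U * U"
    by (simp add: s_def power2_eq_square)
  have pU: "pd 0 U = Cst \<kappa>" "pd 2 U = 0" "pd 3 U = 0" by (simp_all add: U_def)
  have 0: "dmat 0 (smat s P) = (\<lambda>i j. 2 * U * Cst \<kappa> * smat s (dmat 0 P) i j)" for P
    by (simp add: fun_eq_iff dmat_def smat_def pd_subst_0 s_def pd_power pU)
  have 2: "dmat 2 (smat s P) = smat s (dmat 2 P)" "dmat 3 (smat s P) = smat s (dmat 3 P)" for P
    by (simp_all add: fun_eq_iff dmat_def smat_def pd_subst_other s_def pd_power pU)
  show ?thesis
    unfolding hE_def hO_def Z0_def Z1_def P dmat_lin 0 2 pU
    by (simp add: tr_lin s0 algebra_simps)
qed

lemma gmat_smat:
  assumes "gmat w q n c P" "\<And>i. homog w' (w i) (s i)"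
  shows "gmat w' q n c (smat s P)"
  using assms by (auto simp: gmat_def smat_def intro: homog_subst)

lemma gmat_scale: "gmat w q n c P \<Longrightarrow> homog w b x \<Longrightarrow> a = b + c \<Longrightarrow> gmat w q n a (\<lambda>i j. x * P i j)"
  unfolding gmat_def by (auto intro!: homog_mult)

lemma gmat_add: "gmat w q n c P \<Longrightarrow> gmat w q n c Q \<Longrightarrow> gmat w q n c (\<lambda>i j. P i j + Q i j)"
  unfolding gmat_def by (auto intro!: homog_add)

lemma gmat_idmat: "gmat w q n 0 idmat"
  by (auto simp: gmat_def idmat_def intro: homog_0 homog_1)

lemma smat_app: "smat s A i j = subst s (A i j)"
  by (simp add: smat_def)

text \<open>\<open>sq\<close> and \<open>ac\<close> are the even and odd parts of
  \<open>(P0 + u P1)^2 = W - K u^(2d)\<close> with \<open>u^2 = Var 0\<close>. The non-vanishing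
  assumptions are about \<open>hE\<close>, the part of the trace visible to type D.\<close>

context
  fixes P0 P1 :: "nat \<Rightarrow> nat \<Rightarrow> mpoly" and n d :: nat and q :: "nat \<Rightarrow> rat" and t :: ade and K :: complex
  assumes d: "d \<ge> 3" and K: "K \<noteq> 0" and t: "valid t" "cox t = 2 * d"
    and v0: "\<And>i j. vars (P0 i j) \<subseteq> {0, 2, 3}" and v1: "\<And>i j. vars (P1 i j) \<subseteq> {0, 2, 3}"
    and g0: "gmat (wts (TD d) t) q n 1 P0" and g1: "gmat (wts (TD d) t) q n (1 - 1 / of_nat d) P1"
    and sq: "\<And>i j. i < n \<Longrightarrow> j < n \<Longrightarrow> matmul n P0 P0 i j + Var 0 * matmul n P1 P1 i j
        = (if i = j then PY t - Cst K * Var 0 ^ d else 0)"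
    and ac: "\<And>i j. i < n \<Longrightarrow> j < n \<Longrightarrow> matmul n P0 P1 i j + matmul n P1 P0 i j = 0"
    and nzy: "evf t 2 3 (hE n P0 P1) \<noteq> 0" and nzx: "ev (pt 0 1 1 0) (hE n P0 P1) \<noteq> 0"
begin

lemma kappa_exists: "\<exists>\<kappa>. \<kappa> \<noteq> 0 \<and> \<kappa> ^ (2 * d) * K = 1"
proof -
  obtain \<kappa> where k: "\<kappa> ^ (2 * d) = 1 / K"
    by (rule cpow_root[of "1 / K" "2 * d"]) (use K d in auto)
  then have "\<kappa> \<noteq> 0" using K d by (auto simp: power_0_left)
  with k K show ?thesis by auto
qed

lemma defect_D_type: "defect (TD d) t"
proof -
  obtain \<kappa> where k: "\<kappa> \<noteq> 0" "\<kappa> ^ (2 * d) * K = 1" using kappa_exists by blast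
  define s where "s = (\<lambda>i. if i = 0 then Cst (\<kappa> ^ 2) * Var 0 else Var i)"
  define Q0 where "Q0 = smat s P0"
  define Q1 where "Q1 = (\<lambda>i j. Cst \<kappa> * smat s P1 i j)"
  define R where "R = blk n Q0 (\<lambda>i j. Var 0 * Q1 i j) Q1 Q0"
  define T where "T = blk n Zm (\<lambda>i j. Var 0 * idmat i j) idmat Zm"
  let ?w = "wts (TD d) t"
  \<comment> \<open>The second copy carries the basis vectors multiplied by \<open>u\<close>, which
    has degree \<open>1/d\<close>.\<close>
  define q' where "q' = (\<lambda>i. if i < n then q i else q (i - n) + 1 / of_nat d)"
  have hs: "homog ?w (?w i) (s i)" for i
    by (auto simp: s_def intro!: homog_mult[OF homog_Cst homog_Var] homog_Var)
  have gQ0: "gmat ?w q n 1 Q0" unfolding Q0_def by (rule gmat_smat[OF g0 hs])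
  have gQ1: "gmat ?w q n (1 - 1 / of_nat d) Q1"
    unfolding Q1_def by (rule gmat_scale[OF gmat_smat[OF g1 hs] homog_Cst[OF refl]]) simp
  have vs: "vars (s i) \<subseteq> {0, 2, 3}" if "i \<in> {0, 2, 3}" for i
    using that by (cases "i = 0") (simp_all add: s_def vars_subI)
  have vQ: "vars (Q0 i j) \<subseteq> {0, 2, 3}" "vars (Q1 i j) \<subseteq> {0, 2, 3}" for i j
    unfolding Q0_def Q1_def smat_def using v0[of i j] v1[of i j]
    by (intro vars_subI vars_subst_subI vs; blast)+
  have comm: "matmul n Q0 Q1 i j + matmul n Q1 Q0 i j = 0" if "i < n" "j < n" for i j
  proof -
    have "matmul n Q0 Q1 i j + matmul n Q1 Q0 i j = Cst \<kappa> * subst s (matmul n P0 P1 i j + matmul n P1 P0 i j)"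
      by (simp add: Q0_def Q1_def) (simp add: smat_app algebra_simps)
    then show ?thesis by (simp only: ac[OF that]) simp
  qed
  have kd: "Cst K * (Cst (\<kappa>\<^sup>2) * Var 0) ^ d = Var 0 ^ d"
  proof -
    have "Cst K * (Cst (\<kappa>\<^sup>2) * Var 0) ^ d = Cst (\<kappa> ^ (2 * d) * K) * Var 0 ^ d"
      by (simp add: power_mult_distrib Cst_mult Cst_power mult_ac flip: power_mult)
    then show ?thesis by (simp add: k)
  qed
  have sqQ: "matmul n Q0 Q0 i j + Var 0 * matmul n Q1 Q1 i j = (if i = j then PY t - Var 0 ^ d else 0)" if "i < n" "j < n" for i j
  proof -
    have "matmul n Q0 Q0 i j + Var 0 * matmul n Q1 Q1 i j = subst s (matmul n P0 P0 i j + Var 0 * matmul n P1 P1 i j)"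
      by (simp add: Q0_def Q1_def) (simp add: smat_app s_def power2_eq_square Cst_mult algebra_simps)
    also have "\<dots> = (if i = j then PY t - Var 0 ^ d else 0)"
      unfolding sq[OF that] using kd by (simp add: subst_pot s_def)
    finally show ?thesis .
  qed
  have idid: "matmul n idmat idmat i j = (if i = j then 1 else 0)" if "i < n" for i j
    using that by (simp add: idmat_matmul) (simp add: idmat_def)
  show ?thesis
  proof (rule defect_linear[where R = R and T = T and n = "n + n" and q = q'])
    show vR: "vars (R i j) \<subseteq> {0, 2, 3}" for i j
      using vQ by (simp add: R_def blk_def vars_subI)
    show vT: "vars (T i j) \<subseteq> {0}" for i j
      by (simp add: T_def blk_def idmat_def vars_subI)
    show gR: "gmat ?w q' (n + n) 1 R"
      unfolding gmat_def
    proof (intro allI impI)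
      fix i j assume ij: "i < n + n" "j < n + n"
      have 1: "homog ?w (1 + q j - q i) (Q0 i j)" if "i < n" "j < n" for i j
        using gQ0 that by (simp add: gmat_def)
      have 2: "homog ?w (1 + q j - q i - 1 / of_nat d) (Q1 i j)" if "i < n" "j < n" for i j
        using gQ1 that by (simp add: gmat_def algebra_simps)
      have 3: "homog ?w (1 + q j - q i + 1 / of_nat d) (Var 0 * Q1 i j)" if "i < n" "j < n" for i j
        by (rule homog_mult[OF homog_Var[OF refl] 2[OF that]]) simp
      show "homog ?w (1 + q' j - q' i) (R i j)"
        using ij 1[of i j] 2[of "i - n" j] 3[of i "j - n"] 1[of "i - n" "j - n"]
        by (auto simp: R_def blk_def q'_def algebra_simps)
    qed
    show gT: "gmat ?w q' (n + n) (1 - wty (TD d)) T"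
      using d by (auto simp: gmat_def T_def blk_def q'_def idmat_def intro!: homog_0 homog_1 homog_Var)
    show "matmul (n + n) R T i j = matmul (n + n) T R i j" if "i < n + n" "j < n + n" for i j
      unfolding R_def T_def matmul_blk using that by (simp add: blk_def matmul_idmat idmat_matmul)
    show "matmul (n + n) R R i j - Var 1 ^ 2 * matmul (n + n) T T i j = (if i = j then PY t - PX (TD d) else 0)"
      if "i < n + n" "j < n + n" for i j
      unfolding R_def T_def matmul_blk
      using that sqQ[of i j] sqQ[of "i - n" "j - n"] comm[of i "j - n"] comm[of "i - n" j]
      by (auto simp: blk_def idid algebra_simps simp flip: distrib_left split: if_splits)
    have h: "tr (n + n) (matmul (n + n) (dmat 0 R) (matmul (n + n) T (matmul (n + n) (dmat 2 R) (dmat 3 R))))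
        = Cst \<kappa> * subst s (hE n P0 P1)"
      unfolding tr_D_type[OF R_def T_def] Q0_def Q1_def s_def by (rule hE_scale)
    show "Cst \<kappa> * subst s (hE n P0 P1) = tr (n + n) (matmul (n + n) (dmat 0 R) (matmul (n + n) T (matmul (n + n) (dmat 2 R) (dmat 3 R))))"
      by (rule h[symmetric])
    have p: "(\<lambda>i. ev (pt 2 3 x y) (s i)) = pt 2 3 x y" for x y
      by (simp add: fun_eq_iff s_def pt_def)
    have "evf t 2 3 (Cst \<kappa> * subst s (hE n P0 P1)) = \<kappa> * evf t 2 3 (hE n P0 P1)"
      by (rule evf_scale) (simp add: ev_subst p)
    then show "evf t 2 3 (Cst \<kappa> * subst s (hE n P0 P1)) \<noteq> 0" using nzy k by simp
    show "evf (TD d) 0 1 (Cst \<kappa> * subst s (hE n P0 P1)) \<noteq> 0"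
    proof (rule evf_TD_nonzero[OF d, of _ _ ?w])
      show "homog ?w (2 * (1 - 2 / of_nat (cox (TD d)))) (Cst \<kappa> * subst s (hE n P0 P1))"
        unfolding h[symmetric] using d t by (intro homog_linear_trace[OF gR gT]) auto
      have "(\<lambda>i. ev (pt 0 1 (1 / \<kappa> ^ 2) 0) (s i)) = pt 0 1 1 0"
        using k by (simp add: fun_eq_iff s_def pt_def)
      then show "ev (pt 0 1 (1 / \<kappa> ^ 2) 0) (Cst \<kappa> * subst s (hE n P0 P1)) \<noteq> 0"
        using nzx k by (simp add: ev_subst)
      have dR: "vars (dmat v R i j) \<subseteq> {0, 2, 3}" for v i j
        unfolding dmat_def using vars_pd vR by blast
      have "vars (T i j) \<subseteq> {0, 2, 3}" for i j using vT[of i j] by auto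
      then have "vars (Cst \<kappa> * subst s (hE n P0 P1)) \<subseteq> {0, 2, 3}"
        unfolding h[symmetric] tr_def by (intro vars_sum_subI vars_matmul dR) auto
      then show "1 \<notin> vars (Cst \<kappa> * subst s (hE n P0 P1))" by auto
    qed simp_all
  qed
qed

lemma defect_A_type: "defect (TA (2 * d)) t"
proof -
  obtain \<kappa> where k: "\<kappa> \<noteq> 0" "\<kappa> ^ (2 * d) * K = 1" using kappa_exists by blast
  define U where "U = Cst \<kappa> * Var 0"
  define s where "s = (\<lambda>i. if i = 0 then U ^ 2 else if i = 1 then 0 else Var i)"
  define P where "P = (\<lambda>i j. smat s P0 i j + U * smat s P1 i j)"
  let ?w = "wts (TA (2 * d)) t" and ?w' = "wts (TD d) t"
  have hU: "homog ?w (1 / of_nat d) U"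
    unfolding U_def by (rule homog_mult[OF homog_Cst[OF refl] homog_Var[OF refl]]) simp
  have hs: "homog ?w (?w' i) (s i)" for i
  proof (cases "i = 0")
    case True
    then show ?thesis by (auto simp: s_def intro!: homog_power[OF hU])
  next
    case False
    then show ?thesis by (auto simp: s_def wts_def intro!: homog_0 homog_Var)
  qed
  have gP: "gmat ?w q n 1 P" unfolding P_def
    by (intro gmat_add gmat_smat[OF g0 hs] gmat_scale[OF gmat_smat[OF g1 hs] hU]) simp
  have gT: "gmat ?w q n (1 - wty (TA (2 * d))) idmat" by (simp add: gmat_idmat)
  have vs: "vars (s i) \<subseteq> {0, 2, 3}" if "i \<in> {0, 2, 3}" for i
    using that by (cases "i = 0") (simp_all add: s_def U_def vars_subI vars_power_subI)
  have kd: "Cst K * (U ^ 2) ^ d = Var 0 ^ (2 * d)"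
  proof -
    have "Cst K * (U ^ 2) ^ d = Cst (\<kappa> ^ (2 * d) * K) * Var 0 ^ (2 * d)"
      by (simp add: U_def power_mult_distrib Cst_mult Cst_power mult_ac flip: power_mult)
    then show ?thesis by (simp add: k)
  qed
  let ?h = "Cst \<kappa> * (subst s (hE n P0 P1) + U * subst s (hO n P0 P1))"
  have h: "?h = tr n (matmul n (dmat 0 P) (matmul n idmat (matmul n (dmat 2 P) (dmat 3 P))))"
    using tr_A_type[of P \<kappa> P0 P1 n, folded U_def, folded s_def, OF P_def] by simp
  show ?thesis
  proof (rule defect_linear[OF _ _ gP gT _ _ h])
    show "vars (P i j) \<subseteq> {0, 2, 3}" for i j
      unfolding P_def smat_def U_def using v0[of i j] v1[of i j]
      by (intro vars_subI vars_subst_subI vs; blast)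
    show "vars (idmat i j) \<subseteq> {0}" for i j by (simp add: idmat_def)
    show "matmul n P idmat i j = matmul n idmat P i j" if "i < n" "j < n" for i j
      using that by (simp add: matmul_idmat idmat_matmul)
    show "matmul n P P i j - Var 1 ^ 2 * matmul n idmat idmat i j = (if i = j then PY t - PX (TA (2 * d)) else 0)"
      if "i < n" "j < n" for i j
    proof -
      have "matmul n P P i j = subst s (matmul n P0 P0 i j + Var 0 * matmul n P1 P1 i j)
          + U * subst s (matmul n P0 P1 i j + matmul n P1 P0 i j)"
        by (simp add: P_def) (simp add: smat_app s_def power2_eq_square algebra_simps)
      also have "\<dots> = (if i = j then PY t - Var 0 ^ (2 * d) else 0)"
        unfolding sq[OF that] ac[OF that] using kd by (simp add: subst_pot s_def)
      finally show ?thesis using that by (simp add: matmul_idmat) (simp add: idmat_def)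
    qed
    have p: "(\<lambda>i. ev (pt 2 3 x y) (s i)) = pt 2 3 x y" for x y
      by (simp add: fun_eq_iff s_def U_def pt_def)
    have "evf t 2 3 ?h = \<kappa> * evf t 2 3 (hE n P0 P1)"
      by (rule evf_scale) (simp add: ev_subst p, simp add: U_def pt_def)
    then show "evf t 2 3 ?h \<noteq> 0" using nzy k by simp
    have hom: "homog ?w (2 * (1 - 2 / of_nat (2 * d))) ?h"
      unfolding h using homog_linear_trace[OF gP gT _ t(1)] d t by simp
    have "(\<lambda>i. ev (pt 0 1 (e / \<kappa>) 0) (s i)) = pt 0 1 1 0" if "e ^ 2 = 1" for e
      using k that by (simp add: fun_eq_iff s_def U_def pt_def power_divide)
    then have e: "ev (pt 0 1 (e / \<kappa>) 0) ?h = \<kappa> * (ev (pt 0 1 1 0) (hE n P0 P1) + e * ev (pt 0 1 1 0) (hO n P0 P1))" if "e ^ 2 = 1" for e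
      using that k by (simp add: ev_subst) (simp add: U_def pt_def)
    \<comment> \<open>The two points are the square roots \<open>u = 1\<close> and
      \<open>u = - 1\<close> of \<open>p = 1\<close>. Their values add up to a multiple of
      \<open>hE\<close>, so they cannot both vanish.\<close>
    have "ev (pt 0 1 (1 / \<kappa>) 0) ?h \<noteq> 0 \<or> ev (pt 0 1 (- 1 / \<kappa>) 0) ?h \<noteq> 0"
    proof (rule ccontr)
      assume "\<not> ?thesis"
      then have "ev (pt 0 1 1 0) (hE n P0 P1) + ev (pt 0 1 1 0) (hO n P0 P1) = 0"
        "ev (pt 0 1 1 0) (hE n P0 P1) - ev (pt 0 1 1 0) (hO n P0 P1) = 0"
        using e[of 1] e[of "- 1"] k by simp_all
      then have "2 * ev (pt 0 1 1 0) (hE n P0 P1) = 0" by simp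
      with nzx show False by simp
    qed
    then obtain z where "ev (pt 0 1 z 0) ?h \<noteq> 0" by blast
    then show "evf (TA (2 * d)) 0 1 ?h \<noteq> 0"
      using evf_TA_nonzero[of "2 * d" 0 1 ?w ?h z] hom d by simp
  qed
qed

end

section \<open>Explicit matrices\<close>

definition lmat :: "'a::zero list list \<Rightarrow> nat \<Rightarrow> nat \<Rightarrow> 'a" where
  "lmat L i j = (if i < length L \<and> j < length (L ! i) then L ! i ! j else 0)"

lemma vars_lmat: "\<forall>r\<in>set L. \<forall>p\<in>set r. vars p \<subseteq> S \<Longrightarrow> vars (lmat L i j) \<subseteq> S"
  by (cases "i < length L \<and> j < length (L ! i)") (auto simp: lmat_def dest!: bspec[OF _ nth_mem])

lemma dmat_lmat: "dmat v (lmat L) = lmat (map (map (pd v)) L)"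
  by (auto simp: fun_eq_iff dmat_def lmat_def)

lemma ev_lmat: "ev s (lmat L i j) = lmat (map (map (ev s)) L) i j"
  by (auto simp: lmat_def)

definition tr3 :: "nat \<Rightarrow> (nat \<Rightarrow> nat \<Rightarrow> complex) \<Rightarrow> (nat \<Rightarrow> nat \<Rightarrow> complex) \<Rightarrow> (nat \<Rightarrow> nat \<Rightarrow> complex) \<Rightarrow> complex" where
  "tr3 n A B C = (\<Sum>i<n. \<Sum>j<n. A i j * (\<Sum>k<n. B j k * C k i))"

abbreviation evm :: "(nat \<Rightarrow> complex) \<Rightarrow> (nat \<Rightarrow> nat \<Rightarrow> mpoly) \<Rightarrow> nat \<Rightarrow> nat \<Rightarrow> complex" where
  "evm s A \<equiv> (\<lambda>i j. ev s (A i j))"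

lemma ev_tr3: "ev s (tr n (matmul n A (matmul n B C))) = tr3 n (evm s A) (evm s B) (evm s C)"
  by (simp add: tr_def matmul_def tr3_def)

lemma ev_hE_0:
  assumes "s 0 = 0"
  shows "ev s (hE n P0 P1) = tr3 n (evm s P1) (evm s (dmat 2 P0)) (evm s (dmat 3 P0))"
  unfolding hE_def Z0_def Z1_def by (simp add: tr_lin ev_tr3 assms)

lemma ev_hE_1:
  assumes "s 0 = 1"
  shows "ev s (hE n P0 P1) = tr3 n (evm s P1) (evm s (dmat 2 P0)) (evm s (dmat 3 P0))
    + tr3 n (evm s P1) (evm s (dmat 2 P1)) (evm s (dmat 3 P1))
    + 2 * tr3 n (evm s (dmat 0 P1)) (evm s (dmat 2 P0)) (evm s (dmat 3 P0))
    + 2 * tr3 n (evm s (dmat 0 P1)) (evm s (dmat 2 P1)) (evm s (dmat 3 P1))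
    + 2 * tr3 n (evm s (dmat 0 P0)) (evm s (dmat 2 P0)) (evm s (dmat 3 P1))
    + 2 * tr3 n (evm s (dmat 0 P0)) (evm s (dmat 2 P1)) (evm s (dmat 3 P0))"
  unfolding hE_def Z0_def Z1_def by (simp add: tr_lin ev_tr3 assms algebra_simps)

lemma tr3_2: "tr3 2 (lmat [[a0, a1], [a2, a3]]) (lmat [[b0, b1], [b2, b3]]) (lmat [[c0, c1], [c2, c3]])
  = a0 * (b0 * c0 + b1 * c2) + a1 * (b2 * c0 + b3 * c2) + a2 * (b0 * c1 + b1 * c3) + a3 * (b2 * c1 + b3 * c3)"
  by (simp add: tr3_def lmat_def numeral_2_eq_2 lessThan_Suc algebra_simps)

lemma all_less_2: "(\<forall>i<2::nat. Q i) \<longleftrightarrow> Q 0 \<and> Q 1"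
  by (auto simp: less_2_cases_iff)

lemma all_less_4: "(\<forall>i<4::nat. Q i) \<longleftrightarrow> Q 0 \<and> Q 1 \<and> Q 2 \<and> Q 3"
  by (auto simp: numeral_eq_Suc less_Suc_eq)

lemma sum_less_2: "(\<Sum>i<2::nat. f i) = f 0 + (f 1 :: mpoly)"
  by (simp add: numeral_2_eq_2)

lemma sum_less_4: "(\<Sum>i<4::nat. f i) = f 0 + f 1 + f 2 + (f 3 :: mpoly)"
  by (simp add: numeral_eq_Suc)

lemmas homog_intros = homog_0 homog_1 homog_numeral homog_Cst homog_Var homog_uminus homog_add homog_diff
  homog_mult homog_power

lemmas vars_intros = vars_subI vars_power_subI

section \<open>Type A with itself and type D\<close>

definition geo :: "nat \<Rightarrow> mpoly \<Rightarrow> mpoly \<Rightarrow> mpoly" where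
  "geo d Y U = (\<Sum>i<d. U ^ (d - Suc i) * Y ^ i)"

lemma geo_mult: "(Y - U) * geo d Y U = Y ^ d - U ^ d"
  by (simp add: geo_def power_diff_sumr2)

lemma vars_geo: "vars Y \<subseteq> S \<Longrightarrow> vars U \<subseteq> S \<Longrightarrow> vars (geo d Y U) \<subseteq> S"
  unfolding geo_def by (intro vars_sum_subI vars_subI vars_power_subI)

lemma homog_geo:
  assumes "homog w c Y" "homog w c U" "e = (of_nat d - 1) * c"
  shows "homog w e (geo d Y U)"
  unfolding geo_def
proof (rule homog_sum)
  fix i assume "i \<in> {..<d}"
  then show "homog w e (U ^ (d - Suc i) * Y ^ i)"
    using assms by (auto intro!: homog_mult[OF homog_power[OF _ refl] homog_power[OF _ refl]] simp: of_nat_diff algebra_simps)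
qed

lemma pd_geo_notin: "pd v Y = 0 \<Longrightarrow> pd v U = 0 \<Longrightarrow> pd v (geo d Y U) = 0"
  by (simp add: geo_def pd_sum pd_power)

text \<open>The derivatives of \<open>geo\<close> at the points where one argument vanishes, from differentiating
  \<open>(Y - U) * geo d Y U = Y ^ d - U ^ d\<close>.\<close>
lemma ev_pd_geo:
  assumes "d \<ge> 2"
  shows "s 0 = 0 \<Longrightarrow> s 2 = 1 \<Longrightarrow> ev s (pd 2 (geo d (Var 2) (Var 0))) + ev s (pd 0 (geo d (Var 2) (Var 0))) = of_nat d"
    and "s 0 = 1 \<Longrightarrow> s 2 = 0 \<Longrightarrow> ev s (pd 2 (geo d (Var 2) (Var 0))) + ev s (pd 0 (geo d (Var 2) (Var 0))) = of_nat d"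
proof -
  let ?g = "geo d (Var 2) (Var 0)"
  have on: "ev s (of_nat d) = of_nat d" for s
    using id_hom.ins_Cst[of s "of_nat d"] by (simp add: Cst_of_nat flip: ev_def)
  have m: "(Var 2 - Var 0) * ?g = Var 2 ^ d - Var 0 ^ d" by (rule geo_mult)
  have m0: "(s 2 - s 0) * ev s ?g = s 2 ^ d - s 0 ^ d"
    using arg_cong[OF m, of "ev s"] by simp
  have m2: "ev s ?g + (s 2 - s 0) * ev s (pd 2 ?g) = of_nat d * s 2 ^ (d - 1)"
    using arg_cong[OF m, of "\<lambda>p. ev s (pd 2 p)"] by (simp add: pd_power on)
  have m1: "- ev s ?g + (s 2 - s 0) * ev s (pd 0 ?g) = - of_nat d * s 0 ^ (d - 1)"
    using arg_cong[OF m, of "\<lambda>p. ev s (pd 0 p)"] by (simp add: pd_power on)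
  have z: "(0::complex) ^ d = 0" "(0::complex) ^ (d - 1) = 0" using assms by (simp_all add: power_0_left)
  show "ev s (pd 2 ?g) + ev s (pd 0 ?g) = of_nat d" if "s 0 = 0" "s 2 = 1"
    using m0 m1 m2 unfolding that z by (simp add: algebra_simps)
  show "ev s (pd 2 ?g) + ev s (pd 0 ?g) = of_nat d" if "s 0 = 1" "s 2 = 0"
    using m0 m1 m2 unfolding that z by (simp add: algebra_simps)
qed

theorem defect_A_A:
  assumes d: "d \<ge> 2"
  shows "defect (TA d) (TA d)"
proof -
  let ?g = "geo d (Var 2) (Var 0)"
  define P where "P = lmat [[Var 3, Var 2 - Var 0], [?g, - Var 3]]"
  let ?w = "wts (TA d) (TA d)"
  define q :: "nat \<Rightarrow> rat" where "q = (\<lambda>i. if i = 0 then 0 else 2 / of_nat d - 1)"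
  have g3: "pd 3 ?g = 0" by (rule pd_geo_notin) simp_all
  have gP: "gmat ?w q 2 1 P"
  proof -
    have "homog ?w (2 - 2 / of_nat d) ?g"
      by (rule homog_geo[OF homog_Var[OF refl]]) (use d in \<open>auto intro!: homog_Var simp: field_simps\<close>)
    then show ?thesis
      unfolding gmat_def all_less_2 P_def q_def
      by (simp add: lmat_def homog_uminus homog_diff homog_Var)
  qed
  have gT: "gmat ?w q 2 (1 - wty (TA d)) idmat" by (simp add: gmat_idmat)
  let ?h = "tr 2 (matmul 2 (dmat 0 P) (matmul 2 idmat (matmul 2 (dmat 2 P) (dmat 3 P))))"
  have ev: "ev s ?h = - (ev s (pd 2 ?g) + ev s (pd 0 ?g))" for s
    unfolding matmul_idmat_matmul ev_tr3 P_def dmat_lmat ev_lmat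
    by (simp add: tr3_2 g3)
  note ev = ev[unfolded matmul_idmat_matmul]
  show ?thesis
  proof (rule defect_linear[OF _ _ gP gT _ _ refl])
    show "vars (P i j) \<subseteq> {0, 2, 3}" for i j
      unfolding P_def by (intro vars_lmat) (simp add: vars_geo vars_subI)
    show "vars (idmat i j) \<subseteq> {0}" for i j by (simp add: idmat_def)
    show "matmul 2 P idmat i j = matmul 2 idmat P i j" if "i < 2" "j < 2" for i j
      using that by (simp add: matmul_idmat idmat_matmul)
    have "\<forall>i<2. \<forall>j<2. matmul 2 P P i j - Var 1 ^ 2 * idmat i j = (if i = j then PY (TA d) - PX (TA d) else 0)"
      using geo_mult[of "Var 2" "Var 0" d]
      unfolding all_less_2 by (simp add: matmul_def sum_less_2 P_def lmat_def idmat_def power2_eq_square algebra_simps)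
    then show "matmul 2 P P i j - Var 1 ^ 2 * matmul 2 idmat idmat i j = (if i = j then PY (TA d) - PX (TA d) else 0)"
      if "i < 2" "j < 2" for i j
      using that by (simp add: matmul_idmat)
    show "evf (TA d) 2 3 ?h \<noteq> 0"
      using ev_pd_geo(1)[OF d, of "pt 2 3 1 0"] d by (simp add: ev pt_def)
    show "evf (TA d) 0 1 ?h \<noteq> 0"
      using ev_pd_geo(2)[OF d, of "pt 0 1 1 0"] d by (simp add: ev pt_def)
  qed
qed

text \<open>At \<open>x = p\<close> the potential \<open>x^d + x y^2\<close> equals
  \<open>p^d + (u y)^2\<close>, so \<open>l = p\<close> and \<open>Q = u y\<close> form a section
  with \<open>K = 1\<close>.\<close>

theorem defect_AD_D:
  assumes d: "d \<ge> 3"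
  shows "defect (TA (2 * d)) (TD d)" "defect (TD d) (TD d)"
proof -
  let ?g = "geo d (Var 2) (Var 0)"
  define P0 where "P0 = lmat [[0, Var 2 - Var 0], [?g + Var 3 ^ 2, 0]]"
  define P1 where "P1 = lmat [[Var 3, 0], [0, - Var 3 :: mpoly]]"
  define q :: "nat \<Rightarrow> rat" where "q = (\<lambda>i. if i = 0 then 0 else 2 / of_nat d - 1)"
  let ?w = "wts (TD d) (TD d)"
  have g3: "pd 3 ?g = 0" by (rule pd_geo_notin) simp_all
  have "homog ?w (2 - 2 / of_nat d) ?g"
    by (rule homog_geo[OF homog_Var[OF refl]]) (use d in \<open>auto intro!: homog_Var simp: field_simps\<close>)
  moreover have "homog ?w (2 - 2 / of_nat d) (Var 3 ^ 2)"
    by (rule homog_power[OF homog_Var[OF refl]]) simp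
  ultimately have g0: "gmat ?w q 2 1 P0"
    unfolding gmat_def all_less_2 P0_def q_def
    by (simp add: lmat_def homog_add homog_diff homog_Var homog_0)
  have g1: "gmat ?w q 2 (1 - 1 / of_nat d) P1"
    unfolding gmat_def all_less_2 P1_def q_def
    by (simp add: lmat_def homog_uminus homog_Var homog_0)
  have v0: "vars (P0 i j) \<subseteq> {0, 2, 3}" for i j
    unfolding P0_def by (intro vars_lmat) (simp add: vars_geo vars_intros)
  have v1: "vars (P1 i j) \<subseteq> {0, 2, 3}" for i j
    unfolding P1_def by (intro vars_lmat) (simp add: vars_intros)
  have "\<forall>i<2. \<forall>j<2. matmul 2 P0 P0 i j + Var 0 * matmul 2 P1 P1 i j
        = (if i = j then PY (TD d) - Cst 1 * Var 0 ^ d else 0)"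
    using geo_mult[of "Var 2" "Var 0" d]
    unfolding all_less_2 by (simp add: matmul_def sum_less_2 P0_def P1_def lmat_def power2_eq_square algebra_simps)
  then have sq: "matmul 2 P0 P0 i j + Var 0 * matmul 2 P1 P1 i j
        = (if i = j then PY (TD d) - Cst 1 * Var 0 ^ d else 0)" if "i < 2" "j < 2" for i j
    using that by blast
  have "\<forall>i<2. \<forall>j<2. matmul 2 P0 P1 i j + matmul 2 P1 P0 i j = 0"
    unfolding all_less_2 by (simp add: matmul_def sum_less_2 P0_def P1_def lmat_def)
  then have ac: "matmul 2 P0 P1 i j + matmul 2 P1 P0 i j = 0" if "i < 2" "j < 2" for i j
    using that by blast
  have nzy: "evf (TD d) 2 3 (hE 2 P0 P1) \<noteq> 0"
    by (simp add: ev_hE_0 pt_def P0_def P1_def dmat_lmat ev_lmat tr3_2 g3 pd_power)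
  have "ev (pt 0 1 1 0) (hE 2 P0 P1) = - 2 * (ev (pt 0 1 1 0) (pd 2 ?g) + ev (pt 0 1 1 0) (pd 0 ?g))"
    unfolding P0_def P1_def by (subst ev_hE_1) (simp_all add: pt_def dmat_lmat ev_lmat tr3_2 g3 pd_power)
  also have "\<dots> = - 2 * of_nat d"
    using ev_pd_geo(2)[of d "pt 0 1 1 0"] d by (simp add: pt_def)
  finally have nzx: "ev (pt 0 1 1 0) (hE 2 P0 P1) \<noteq> 0" using d by simp
  show "defect (TA (2 * d)) (TD d)" "defect (TD d) (TD d)"
    by (rule defect_A_type[OF d _ _ _ v0 v1 g0 g1 sq ac nzy nzx] defect_D_type[OF d _ _ _ v0 v1 g0 g1 sq ac nzy nzx];
        use d in simp)+
qed

section \<open>Type \<open>E\<^sub>6\<close>\<close>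

text \<open>The section is \<open>l = u y + b u^4\<close>,
  \<open>Q = y^2 + y u^3 / 2 + 3 b^2 u^6\<close>. In \<open>l^3 + y^4 - K u^12 = Q^2\<close> the
  coefficient of \<open>y^2\<close> gives the quadratic equation for \<open>b\<close>, and the
  constant term gives \<open>K\<close>. \<open>P0\<close> and \<open>P1\<close> collect the even and
  odd powers of \<open>u\<close>.\<close>

theorem defect_AD_E6:
  "defect (TA 12) TE6" "defect (TD 6) TE6"
proof -
  obtain r :: complex where r: "r * r = 3" by (metis power2_csqrt power2_eq_square)
  define b where "b = (3 + r) / 12"
  have b: "6 * b * b = 3 * b - 1 / 4" using r by (simp add: b_def field_simps)
  let ?p = "Var 0" and ?x = "Var 2" and ?y = "Var 3"
  define P0 where "P0 = lmat [[?y ^ 2 + Cst (3 * b * b) * ?p ^ 3, ?x - Cst b * ?p ^ 2],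
     [?x ^ 2 + Cst b * ?x * ?p ^ 2 + Cst (b * b) * ?p ^ 4 + ?p * ?y ^ 2, - (?y ^ 2 + Cst (3 * b * b) * ?p ^ 3)]]"
  define P1 where "P1 = lmat [[Cst (1 / 2) * ?y * ?p, - ?y], [?x * ?y + Cst (2 * b) * ?p ^ 2 * ?y, - (Cst (1 / 2) * ?y * ?p)]]"
  define q :: "nat \<Rightarrow> rat" where "q = (\<lambda>i. if i = 0 then 0 else - (1 / 3))"
  let ?w = "wts (TD 6) TE6"
  let ?K = "b * b * b - 9 * b * b * b * b"
  have g0: "gmat ?w q 2 1 P0"
    unfolding gmat_def all_less_2 P0_def q_def lmat_def
    by (simp, intro conjI; (rule homog_intros | rule refl | simp)+)
  have g1: "gmat ?w q 2 (1 - 1 / of_nat 6) P1"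
    unfolding gmat_def all_less_2 P1_def q_def lmat_def
    by (simp, intro conjI; (rule homog_intros | rule refl | simp)+)
  have v0: "vars (P0 i j) \<subseteq> {0, 2, 3}" for i j
    unfolding P0_def by (intro vars_lmat) (simp add: vars_intros)
  have v1: "vars (P1 i j) \<subseteq> {0, 2, 3}" for i j
    unfolding P1_def by (intro vars_lmat) (simp add: vars_intros)
  define B where "B = Cst b"
  define H where "H = Cst (1 / 2)"
  have H: "2 * H = 1" by (simp add: H_def flip: Cst_numeral Cst_mult)
  have "H * H = Cst (1 / 4)" by (simp add: H_def flip: Cst_mult)
  then have BB: "6 * B * B = 3 * B - H * H"
    using arg_cong[OF b, of Cst] by (simp add: B_def Cst_mult Cst_diff)
  have C: "Cst (3 * b * b) = 3 * B * B" "Cst (b * b) = B * B" "Cst (2 * b) = 2 * B" "Cst ?K = B * B * B - 9 * B * B * B * B"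
    by (simp_all add: Cst_mult Cst_diff B_def)
  have "\<forall>i<2. \<forall>j<2. matmul 2 P0 P0 i j + Var 0 * matmul 2 P1 P1 i j
        = (if i = j then PY TE6 - Cst ?K * Var 0 ^ 6 else 0)"
    unfolding all_less_2 matmul_def sum_less_2 P0_def P1_def C B_def[symmetric] H_def[symmetric] lmat_def
    by simp (intro conjI; (algebra | (use H BB in algebra)))
  then have sq: "matmul 2 P0 P0 i j + Var 0 * matmul 2 P1 P1 i j
        = (if i = j then PY TE6 - Cst ?K * Var 0 ^ 6 else 0)" if "i < 2" "j < 2" for i j
    using that by blast
  have "\<forall>i<2. \<forall>j<2. matmul 2 P0 P1 i j + matmul 2 P1 P0 i j = 0"
    unfolding all_less_2 matmul_def sum_less_2 P0_def P1_def C B_def[symmetric] H_def[symmetric] lmat_def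
    by simp (intro conjI; (algebra | (use H BB in algebra)))
  then have ac: "matmul 2 P0 P1 i j + matmul 2 P1 P0 i j = 0" if "i < 2" "j < 2" for i j
    using that by blast
  have nzy: "evf TE6 2 3 (hE 2 P0 P1) \<noteq> 0"
    by (simp add: ev_hE_0 pt_def P0_def P1_def dmat_lmat ev_lmat tr3_2 pd_power)
  have b0: "b \<noteq> 0" using b by auto
  have b9: "9 * b \<noteq> 1"
  proof
    assume "9 * b = 1"
    then have "b = 1 / 9" by (simp add: field_simps)
    with b show False by simp
  qed
  \<comment> \<open>The value is \<open>6 b^2 (9 b - 1)\<close>, while
    \<open>K = b^3 (1 - 9 b)\<close>; hence \<open>b0\<close> and \<open>b9\<close> settle
    both.\<close>
  have nzx: "ev (pt 0 1 1 0) (hE 2 P0 P1) \<noteq> 0"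
    unfolding P0_def P1_def by (subst ev_hE_1) (simp_all add: pt_def dmat_lmat ev_lmat tr3_2 pd_power b0 b9)
  have K: "?K \<noteq> 0"
    using b0 b9 by simp
  have "defect (TA (2 * 6)) TE6" "defect (TD 6) TE6"
    by (rule defect_A_type[OF _ K _ _ v0 v1 g0 g1 sq ac nzy nzx] defect_D_type[OF _ K _ _ v0 v1 g0 g1 sq ac nzy nzx]; simp)+
  then show "defect (TA 12) TE6" "defect (TD 6) TE6" by simp_all
qed

section \<open>Type \<open>E\<^sub>7\<close>\<close>

text \<open>With the section \<open>x = l\<close>, \<open>v = u Q\<close> the condition is
  \<open>l^3 + l y^3 - K p^9 = p Q^2\<close>. The coefficient of \<open>y^3\<close> explains
  \<open>2 c - 1\<close> in \<open>l\<close>, that of \<open>y^2\<close> gives \<open>e\<close>, and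
  that of \<open>y\<close> gives \<open>ce\<close>. Eliminating \<open>e\<close> leaves the cubic
  equation for \<open>c\<close>.\<close>

theorem defect_AD_E7:
  "defect (TA 18) TE7" "defect (TD 9) TE7"
proof -
  have "\<exists>c\<ge>-8. c \<le> 0 \<and> c ^ 3 + 6 * c ^ 2 - 9 * c + 3 = (0::real)"
    by (rule IVT') (auto intro!: continuous_intros)
  then obtain c0 :: real where "c0 ^ 3 + 6 * c0 ^ 2 - 9 * c0 + 3 = 0" by blast
  then have "complex_of_real (c0 ^ 3 + 6 * c0 ^ 2 - 9 * c0 + 3) = 0" by simp
  then obtain c :: complex where c: "c ^ 3 + 6 * c ^ 2 - 9 * c + 3 = 0"
    by (intro that[of "complex_of_real c0"]) simp
  define e where "e = (6 * c - 3 - c ^ 2) / 2"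
  have e: "2 * e = 6 * c - 3 - c * c" by (simp add: e_def power2_eq_square)
  have ce: "3 * (2 * c - 1) * (2 * c - 1) = 2 * c * e"
    using c unfolding e_def by (simp add: field_simps power2_eq_square power3_eq_cube) algebra
  let ?p = "Var 0" and ?x = "Var 2" and ?y = "Var 3"
  define l where "l = ?y * ?p + Cst (2 * c - 1) * ?p ^ 3"
  define Q where "Q = ?y ^ 2 + Cst c * ?y * ?p ^ 2 + Cst e * ?p ^ 4"
  define P0 where "P0 = lmat [[0, ?x - l], [?x ^ 2 + ?x * l + l ^ 2 + ?y ^ 3, 0]]"
  define P1 where "P1 = lmat [[Q, 0], [0, - Q]]"
  define q :: "nat \<Rightarrow> rat" where "q = (\<lambda>i. if i = 0 then 0 else - (1 / 3))"
  let ?w = "wts (TD 9) TE7"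
  let ?K = "(2 * c - 1) * (2 * c - 1) * (2 * c - 1) - e * e"
  have g0: "gmat ?w q 2 1 P0"
    unfolding gmat_def all_less_2 P0_def q_def lmat_def l_def
    by (simp, intro conjI; (rule homog_intros | rule refl | simp)+)
  have g1: "gmat ?w q 2 (1 - 1 / of_nat 9) P1"
    unfolding gmat_def all_less_2 P1_def q_def lmat_def Q_def
    by (simp, intro conjI; (rule homog_intros | rule refl | simp)+)
  have v0: "vars (P0 i j) \<subseteq> {0, 2, 3}" for i j
    unfolding P0_def l_def by (intro vars_lmat) (simp add: vars_intros)
  have v1: "vars (P1 i j) \<subseteq> {0, 2, 3}" for i j
    unfolding P1_def Q_def by (intro vars_lmat) (simp add: vars_intros)
  define C where "C = Cst c"
  define E where "E = Cst e"
  have E: "2 * E = 6 * C - 3 - C * C" and CE: "3 * (2 * C - 1) * (2 * C - 1) = 2 * C * E"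
    using arg_cong[OF e, of Cst] arg_cong[OF ce, of Cst] by (simp_all add: C_def E_def Cst_mult Cst_diff)
  have CC: "Cst (2 * c - 1) = 2 * C - 1" "Cst ?K = (2 * C - 1) * (2 * C - 1) * (2 * C - 1) - E * E"
    by (simp_all add: Cst_mult Cst_diff C_def E_def)
  have "(?x - l) * (?x ^ 2 + ?x * l + l ^ 2 + ?y ^ 3) + ?p * (Q * Q) = ?x ^ 3 + ?x * ?y ^ 3 - Cst ?K * ?p ^ 9"
    unfolding l_def Q_def CC C_def[symmetric] E_def[symmetric] using E CE by algebra
  then have "\<forall>i<2. \<forall>j<2. matmul 2 P0 P0 i j + Var 0 * matmul 2 P1 P1 i j
        = (if i = j then PY TE7 - Cst ?K * Var 0 ^ 9 else 0)"
    unfolding all_less_2 matmul_def sum_less_2 P0_def P1_def lmat_def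
    by (simp add: mult_ac)
  then have sq: "matmul 2 P0 P0 i j + Var 0 * matmul 2 P1 P1 i j
        = (if i = j then PY TE7 - Cst ?K * Var 0 ^ 9 else 0)" if "i < 2" "j < 2" for i j
    using that by blast
  have "\<forall>i<2. \<forall>j<2. matmul 2 P0 P1 i j + matmul 2 P1 P0 i j = 0"
    unfolding all_less_2 matmul_def sum_less_2 P0_def P1_def lmat_def by (simp add: algebra_simps)
  then have ac: "matmul 2 P0 P1 i j + matmul 2 P1 P0 i j = 0" if "i < 2" "j < 2" for i j
    using that by blast
  have nzy: "evf TE7 2 3 (hE 2 P0 P1) \<noteq> 0"
    by (simp add: ev_hE_0 pt_def P0_def P1_def l_def Q_def dmat_lmat ev_lmat tr3_2 pd_power)
  have c2: "2 * c - 1 \<noteq> 0"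
  proof
    assume "2 * c - 1 = 0"
    then have "c = 1 / 2" by (simp add: field_simps)
    with c show False by (simp add: power3_eq_cube power2_eq_square)
  qed
  \<comment> \<open>Otherwise \<open>c\<close> would be a common root of the cubic and a quadratic
    polynomial; division with remainder leaves one candidate, which fails.\<close>
  have "3 * e - 2 * c * (2 * c - 1) \<noteq> 0"
  proof
    assume "3 * e - 2 * c * (2 * c - 1) = 0"
    then have 1: "11 * c ^ 2 - 22 * c + 9 = 0" using e by algebra
    then have "68 * c = 39" using c by algebra
    then have "c = 39 / 68" by (simp add: field_simps)
    with 1 show False by (simp add: power2_eq_square)
  qed
  moreover have "ev (pt 0 1 1 0) (hE 2 P0 P1) = 9 * (2 * c - 1) * (3 * e - 2 * c * (2 * c - 1))"
    unfolding P0_def P1_def l_def Q_def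
    by (subst ev_hE_1) (simp_all add: pt_def dmat_lmat ev_lmat tr3_2 pd_power algebra_simps)
  ultimately have nzx: "ev (pt 0 1 1 0) (hE 2 P0 P1) \<noteq> 0" using c2 by simp
  \<comment> \<open>Squaring \<open>ce\<close> turns \<open>e^2 = (2 c - 1)^3\<close> into an
    equation in \<open>c\<close> alone, which is again incompatible with the cubic.\<close>
  have K: "?K \<noteq> 0"
  proof
    assume "?K = 0"
    then have "(2 * c - 1) ^ 3 * (9 * (2 * c - 1) - 4 * c ^ 2) = 0" using ce by algebra
    then have "9 * (2 * c - 1) - 4 * c ^ 2 = 0" using c2 by (simp only: mult_eq_0_iff power_eq_0_iff) simp
    then have 1: "4 * c ^ 2 - 18 * c + 9 = 0" by algebra
    then have "288 * c = 165" using c by algebra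
    then have "c = 165 / 288" by (simp add: field_simps)
    with 1 show False by (simp add: power2_eq_square)
  qed
  have "defect (TA (2 * 9)) TE7" "defect (TD 9) TE7"
    by (rule defect_A_type[OF _ K _ _ v0 v1 g0 g1 sq ac nzy nzx] defect_D_type[OF _ K _ _ v0 v1 g0 g1 sq ac nzy nzx]; simp)+
  then show "defect (TA 18) TE7" "defect (TD 9) TE7" by simp_all
qed

section \<open>Type \<open>E\<^sub>8\<close>\<close>

lemma tr3_4: "tr3 4 A B C = (\<Sum>i\<in>{0,1,2,3}. \<Sum>j\<in>{0,1,2,3}. A i j * (\<Sum>k\<in>{0,1,2,3}. B j k * C k i))"
proof -
  have "{..<4} = {0, 1, 2, 3 :: nat}" by auto
  then show ?thesis by (simp add: tr3_def)
qed

text \<open>Together with \<open>s\<close> and \<open>a\<close> themselves, these rules bring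
  right-nested products into the basis \<open>1, s, a, s a\<close> of the number field. Here
  \<open>s\<close> is a square root of 5, not the coordinate \<open>y / u\<close>.\<close>

lemma E8_reduce:
  fixes a s x :: complex
  assumes s: "s * s = 5" and a: "a * a = (s - 1) * a + s / 5"
  shows "s * (s * x) = 5 * x" "a * (a * x) = (s - 1) * (a * x) + s / 5 * x"
  unfolding mult.assoc[symmetric] s a by (simp_all only: distrib_right mult.assoc)

text \<open>The section \<open>x = s\<^sup>2 + a s w + b w\<^sup>2\<close>, \<open>v = s\<^sup>3 + \<dots>\<close> of the elliptic fibration
  \<open>v\<^sup>2 = x\<^sup>3 + y\<^sup>5 - K u\<^sup>3\<^sup>0\<close>, where \<open>w = u\<^sup>5\<close> and \<open>y = u s\<close>, is defined over a quartic number field.\<close>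
lemma E8_constants:
  obtains a b e f g s :: complex where
    "s * s = 5" "a * a = (s - 1) * a + s / 5"
    "b = - 1 / 4 + 13 / 60 * s - 23 / 12 * a + 17 / 12 * s * a"
    "e = 5 / 4 - 1 / 4 * s + 29 / 4 * a - 47 / 20 * s * a"
    "g = - 1 / 2 + 3 / 10 * s - 4 * a + 2 * s * a"
    "2 * f = a + 1" "2 * g + f * f + 2 * a = 3 * b" "g * g + 2 * f * e + a * a * a = 3 * b * b"
    "2 * f * g + 2 * e - 2 * a * g = 3 * a * a" "2 * e * g - a * g * g = a * a * a * a"
proof -
  obtain s :: complex where s: "s * s = 5" by (metis power2_csqrt power2_eq_square)
  \<comment> \<open>The square root of the discriminant of the quadratic equation for
    \<open>a\<close>.\<close>
  obtain r :: complex where r: "r * r = (s - 1) * (s - 1) + 4 * s / 5" by (metis power2_csqrt power2_eq_square)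
  define a where "a = ((s - 1) + r) / 2"
  have a: "a * a = (s - 1) * a + s / 5"
    unfolding a_def using r by (simp add: field_simps) algebra
  note R = s a E8_reduce[OF s a]
  define b where "b = - 1 / 4 + 13 / 60 * s - 23 / 12 * a + 17 / 12 * s * a"
  define e where "e = 5 / 4 - 1 / 4 * s + 29 / 4 * a - 47 / 20 * s * a"
  define g where "g = - 1 / 2 + 3 / 10 * s - 4 * a + 2 * s * a"
  define f where "f = (a + 1) / 2"
  show ?thesis
  proof (rule that[OF s a b_def e_def g_def])
    show "2 * f = a + 1" by (simp add: f_def)
    show "2 * g + f * f + 2 * a = 3 * b"
      unfolding f_def g_def b_def by (simp add: R field_simps)
    show "g * g + 2 * f * e + a * a * a = 3 * b * b"
      unfolding f_def g_def b_def e_def by (simp add: R field_simps)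
    show "2 * f * g + 2 * e - 2 * a * g = 3 * a * a"
      unfolding f_def g_def b_def e_def by (simp add: R field_simps)
    show "2 * e * g - a * g * g = a * a * a * a"
      unfolding f_def g_def b_def e_def by (simp add: R field_simps)
  qed
qed

text \<open>The polynomial on the left is the trace value met in \<open>defect_AD_E8\<close>; in the
  basis \<open>1, s, a, s a\<close> its non-vanishing can be certified.\<close>

lemma E8_trace_value:
  fixes a b e f g s :: complex
  assumes s: "s * s = 5" and a: "a * a = (s - 1) * a + s / 5"
    and b: "b = - 1 / 4 + 13 / 60 * s - 23 / 12 * a + 17 / 12 * s * a"
    and e: "e = 5 / 4 - 1 / 4 * s + 29 / 4 * a - 47 / 20 * s * a"
    and g: "g = - 1 / 2 + 3 / 10 * s - 4 * a + 2 * s * a"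
    and f: "f = (a + 1) / 2"
  shows "15 * (7 * (a * a * a) * b - 4 * a * (b * b) - 3 * (a * a) * b * f - b * b * f - 5 * (a * a) * e + 5 * b * e
    - 6 * a * b * g + 3 * (a * a * a) * g - 2 * (a * a * a) * (a * a) + 2 * (a * a) * (a * a) * f) = (40513 * s * a - 91495 * a + 5829 * s - 13307) / 8"
  unfolding b e f g by (simp add: s a E8_reduce[OF s a] algebra_simps) (simp add: field_simps)

text \<open>Let \<open>S\<close> be multiplication by \<open>y / u\<close> on the section and
  \<open>w = u^5\<close>. With \<open>X = x - b w^2\<close> the section satisfies
  \<open>S^2 = X - a w S\<close>, so in the basis \<open>1, S\<close> it is the matrix with rows
  \<open>(0, X)\<close> and \<open>(1, - a w)\<close>. Its third coordinate is
  \<open>v = S B1 + w B0\<close>. The blocks of \<open>P\<close> are \<open>v\<close>,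
  \<open>y - u S\<close>, the sum of \<open>y^(4-i) (u S)^i\<close>, and \<open>- v\<close>; thus
  \<open>P^2 = v^2 + y^5 - (u S)^5\<close>.\<close>

theorem defect_AD_E8:
  "defect (TA 30) TE8" "defect (TD 15) TE8"
proof -
  obtain a b e f g s :: complex where s: "s * s = 5" and a: "a * a = (s - 1) * a + s / 5"
    and b: "b = - 1 / 4 + 13 / 60 * s - 23 / 12 * a + 17 / 12 * s * a"
    and e: "e = 5 / 4 - 1 / 4 * s + 29 / 4 * a - 47 / 20 * s * a"
    and g: "g = - 1 / 2 + 3 / 10 * s - 4 * a + 2 * s * a"
    and r: "2 * f = a + 1" "2 * g + f * f + 2 * a = 3 * b" "g * g + 2 * f * e + a * a * a = 3 * b * b"
    "2 * f * g + 2 * e - 2 * a * g = 3 * a * a" "2 * e * g - a * g * g = a * a * a * a"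
    by (rule E8_constants)
  let ?K = "b * b * b - e * e"
  let ?p = "Var 0" and ?x = "Var 2" and ?y = "Var 3"
  define X where "X = ?x - Cst b * ?p ^ 5"
  define B1 where "B1 = X + Cst g * ?p ^ 5"
  define B0 where "B0 = Cst f * X + Cst e * ?p ^ 5"
  \<comment> \<open>\<open>T = u S\<close> satisfies \<open>T^2 = h T + p X\<close>. Reducing the
    powers of \<open>T\<close> by this rule writes the geometric sum as
    \<open>G0 + G1 T\<close>.\<close>
  define h where "h = - (Cst a * ?p ^ 3)"
  define G0 where "G0 = ?y ^ 4 + ?y ^ 2 * (?p * X) + ?y * h * (?p * X) + (?p * X) ^ 2 + h ^ 2 * (?p * X)"
  define G1 where "G1 = ?y ^ 3 + ?y ^ 2 * h + ?y * (?p * X + h ^ 2) + 2 * h * (?p * X) + h ^ 3"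
  define P0 where "P0 = lmat [[0, B1 * X, ?y, 0], [B1, 0, 0, ?y - h], [G0, 0, 0, - (B1 * X)], [0, G0 + h * G1, - B1, 0]]"
  define P1 where "P1 = lmat [[?p ^ 2 * B0, 0, 0, - X], [0, ?p ^ 2 * B0 - Cst a * ?p ^ 2 * B1, - 1, 0],
    [0, X * G1, - (?p ^ 2 * B0), 0], [G1, 0, 0, - (?p ^ 2 * B0 - Cst a * ?p ^ 2 * B1)]]"
  \<comment> \<open>\<open>S\<close> has degree \<open>2/5 - 1/15 = 1/3\<close>, and the second pair
    of basis vectors is shifted by \<open>2/5 - 1 = - 3/5\<close>.\<close>
  define q :: "nat \<Rightarrow> rat" where "q = (\<lambda>i. if i = 0 then 0 else if i = 1 then 1 / 3 else if i = 2 then - (3 / 5) else - (4 / 15))"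
  let ?w = "wts (TD 15) TE8"
  note defs = X_def B1_def B0_def h_def G0_def G1_def
  have g0: "gmat ?w q 4 1 P0"
    unfolding gmat_def all_less_4 P0_def q_def lmat_def defs
    by (simp, intro conjI; (rule homog_intros | rule refl | simp)+)
  have g1: "gmat ?w q 4 (1 - 1 / of_nat 15) P1"
    unfolding gmat_def all_less_4 P1_def q_def lmat_def defs
    by (simp, intro conjI; (rule homog_intros | rule refl | simp)+)
  have v: "vars X \<subseteq> {0, 2, 3}" "vars B1 \<subseteq> {0, 2, 3}" "vars B0 \<subseteq> {0, 2, 3}" "vars h \<subseteq> {0, 2, 3}"
     "vars G0 \<subseteq> {0, 2, 3}" "vars G1 \<subseteq> {0, 2, 3}"
    unfolding defs by (simp_all add: vars_intros)
  have v0: "vars (P0 i j) \<subseteq> {0, 2, 3}" for i j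
    unfolding P0_def by (intro vars_lmat) (simp add: vars_intros v)
  have v1: "vars (P1 i j) \<subseteq> {0, 2, 3}" for i j
    unfolding P1_def by (intro vars_lmat) (simp add: vars_intros v)
  define A where "A = Cst a"
  define B where "B = Cst b"
  define E where "E = Cst e"
  define F where "F = Cst f"
  define G where "G = Cst g"
  have R: "2 * F = A + 1" "2 * G + F * F + 2 * A = 3 * B" "G * G + 2 * F * E + A * A * A = 3 * B * B"
    "2 * F * G + 2 * E - 2 * A * G = 3 * A * A" "2 * E * G - A * G * G = A * A * A * A" "Cst ?K = B * B * B - E * E"
    using r[THEN arg_cong[of _ _ Cst]] by (simp_all add: A_def B_def E_def F_def G_def Cst_mult Cst_diff Cst_add)
  \<comment> \<open>\<open>F1\<close> and \<open>F2\<close> say that \<open>v^2 - T^5\<close> has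
    component \<open>x^3 - K p^15\<close> along \<open>1\<close> and component 0 along
    \<open>S\<close>. The equations \<open>R\<close> are the comparison of coefficients.\<close>
  have F1: "B1 * B1 * X + ?p ^ 5 * (B0 * B0) + 2 * A * ?p ^ 5 * X * X + A * A * A * ?p ^ 10 * X
      = ?x ^ 3 - Cst ?K * ?p ^ 15"
  proof -
    have "B1 * B1 * X + ?p ^ 5 * (B0 * B0) + 2 * A * ?p ^ 5 * X * X + A * A * A * ?p ^ 10 * X
      = X ^ 3 + (2 * G + F * F + 2 * A) * X ^ 2 * ?p ^ 5 + (G * G + 2 * F * E + A * A * A) * X * ?p ^ 10 + E * E * ?p ^ 15"
      unfolding B1_def B0_def E_def[symmetric] F_def[symmetric] G_def[symmetric] by algebra
    also have "\<dots> = ?x ^ 3 - Cst ?K * ?p ^ 15"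
      unfolding R(2,3,6) X_def B_def[symmetric] by algebra
    finally show ?thesis .
  qed
  have F2: "2 * B0 * B1 - A * B1 * B1 = X * X + 3 * A * A * ?p ^ 5 * X + A * A * A * A * ?p ^ 10"
  proof -
    have "2 * B0 * B1 - A * B1 * B1 = (2 * F - A) * X * X + (2 * F * G + 2 * E - 2 * A * G) * ?p ^ 5 * X
       + (2 * E * G - A * G * G) * ?p ^ 10"
      unfolding B1_def B0_def E_def[symmetric] F_def[symmetric] G_def[symmetric] by algebra
    then show ?thesis unfolding R(4,5) unfolding R(1) by simp
  qed
  have hA: "h = - (A * ?p ^ 3)" by (simp add: h_def A_def)
  \<comment> \<open>Each diagonal block of \<open>P^2\<close> is \<open>d0 + u z S\<close>: this has
    diagonal entries \<open>d0\<close> and \<open>d1 = d0 - a p^3 z\<close>, and its part odd in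
    \<open>u\<close> is a multiple of \<open>z\<close>.\<close>
  define d0 where "d0 = B1 * B1 * X + ?y * G0 + ?p * ((?p ^ 2 * B0) ^ 2 - X * G1)"
  define d1 where "d1 = B1 * B1 * X + (?y + A * ?p ^ 3) * (G0 - A * ?p ^ 3 * G1)
    + ?p * ((?p ^ 2 * B0 - A * ?p ^ 2 * B1) ^ 2 - X * G1)"
  define z where "z = ?p ^ 2 * B1 * (2 * B0 - A * B1) + ?y * G1 - G0 + A * ?p ^ 3 * G1"
  have d0: "d0 = PY TE8 - Cst ?K * ?p ^ 15"
  proof -
    have "d0 = (B1 * B1 * X + ?p ^ 5 * (B0 * B0) + 2 * A * ?p ^ 5 * X * X + A * A * A * ?p ^ 10 * X) + ?y ^ 5"
      unfolding d0_def G0_def G1_def hA by algebra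
    then show ?thesis unfolding F1 by simp
  qed
  have z: "z = 0"
  proof -
    have "z = ?p ^ 2 * ((2 * B0 * B1 - A * B1 * B1) - (X * X + 3 * A * A * ?p ^ 5 * X + A * A * A * A * ?p ^ 10))"
      unfolding z_def G0_def G1_def hA by algebra
    then show ?thesis unfolding F2 by simp
  qed
  have "d1 = d0 - A * ?p ^ 3 * z"
    unfolding d0_def d1_def z_def by algebra
  then have d1: "d1 = PY TE8 - Cst ?K * ?p ^ 15" using d0 z by simp
  have "\<forall>i<4. \<forall>j<4. matmul 4 P0 P0 i j + Var 0 * matmul 4 P1 P1 i j
        = (if i = j then (if i = 0 \<or> i = 2 then d0 else d1) else 0)"
    unfolding all_less_4 matmul_def sum_less_4 P0_def P1_def lmat_def A_def[symmetric] hA d0_def d1_def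
    by simp (intro conjI; algebra)
  then have "\<forall>i<4. \<forall>j<4. matmul 4 P0 P0 i j + Var 0 * matmul 4 P1 P1 i j
        = (if i = j then PY TE8 - Cst ?K * Var 0 ^ 15 else 0)"
    unfolding d0 d1 by simp
  then have sq: "matmul 4 P0 P0 i j + Var 0 * matmul 4 P1 P1 i j
        = (if i = j then PY TE8 - Cst ?K * Var 0 ^ 15 else 0)" if "i < 4" "j < 4" for i j
    using that by blast
  have "\<forall>i<4. \<forall>j<4. matmul 4 P0 P1 i j + matmul 4 P1 P0 i j
      = (if (i, j) = (0, 1) \<or> (i, j) = (2, 3) then X * z else if (i, j) = (1, 0) \<or> (i, j) = (3, 2) then z else 0)"
    unfolding all_less_4 matmul_def sum_less_4 P0_def P1_def lmat_def A_def[symmetric] hA z_def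
    by simp (intro conjI; algebra)
  then have "\<forall>i<4. \<forall>j<4. matmul 4 P0 P1 i j + matmul 4 P1 P0 i j = 0"
    unfolding z by simp
  then have ac: "matmul 4 P0 P1 i j + matmul 4 P1 P0 i j = 0" if "i < 4" "j < 4" for i j
    using that by blast
  have nzy: "evf TE8 2 3 (hE 4 P0 P1) \<noteq> 0"
    by (simp add: ev_hE_0 pt_def P0_def P1_def defs dmat_lmat ev_lmat tr3_4 pd_power) (simp add: lmat_def)
  have f: "f = (a + 1) / 2" using r(1) by (simp add: field_simps)
  note red = s a E8_reduce[OF s a]
  have "ev (pt 0 1 1 0) (hE 4 P0 P1) = 15 * (7 * (a * a * a) * b - 4 * a * (b * b) - 3 * (a * a) * b * f - b * b * f
    - 5 * (a * a) * e + 5 * b * e - 6 * a * b * g + 3 * (a * a * a) * g - 2 * (a * a * a) * (a * a) + 2 * (a * a) * (a * a) * f)"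
    unfolding P0_def P1_def defs
    by (subst ev_hE_1) (simp_all add: pt_def dmat_lmat ev_lmat pd_power, simp add: tr3_4 lmat_def, algebra)
  also note E8_trace_value[OF s a b e g f]
  finally have "ev (pt 0 1 1 0) (hE 4 P0 P1) = (40513 * s * a - 91495 * a + 5829 * s - 13307) / 8" .
  \<comment> \<open>The cofactor is a rational multiple of the inverse in the number field, so the
    product certifies that the first factor is non-zero.\<close>
  moreover have "(40513 * s * a - 91495 * a + 5829 * s - 13307) *
      (237261097 - 106106389 * s + 76748645 * a - 34323037 * s * a) = 16"
    by (simp add: red algebra_simps)
  ultimately have nzx: "ev (pt 0 1 1 0) (hE 4 P0 P1) \<noteq> 0" by auto
  have "?K = (27311 * s * a - 61473 * a + 3937 * s - 8924) / 180"
    unfolding b e by (simp add: red algebra_simps) (simp add: field_simps)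
  moreover have "(27311 * s * a - 61473 * a + 3937 * s - 8924) *
      (577711870 - 258360603 * s + 186876835 * a - 83573861 * s * a) = 3"
    by (simp add: red algebra_simps)
  ultimately have K: "?K \<noteq> 0" by auto
  have "defect (TA (2 * 15)) TE8" "defect (TD 15) TE8"
    by (rule defect_A_type[OF _ K _ _ v0 v1 g0 g1 sq ac nzy nzx] defect_D_type[OF _ K _ _ v0 v1 g0 g1 sq ac nzy nzx]; simp)+
  then show "defect (TA 30) TE8" "defect (TD 15) TE8" by simp_all
qed

section \<open>Reflexivity for the exceptional types\<close>

text \<open>The numerator for the Koszul factorisation of \<open>a1 b1 + a2 b2\<close>, whose odd
  blocks are \<open>F\<close> and \<open>G\<close>.\<close>

definition koszul_trace :: "mpoly \<Rightarrow> mpoly \<Rightarrow> mpoly \<Rightarrow> mpoly \<Rightarrow> mpoly" where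
  "koszul_trace a1 b1 a2 b2 = (let F = lmat [[a1, a2], [- b2, b1]]; G = lmat [[b1, - a2], [b2, a1]] in
     tr 2 (matmul 2 (dmat 0 F) (matmul 2 (dmat 1 G) (matmul 2 (dmat 2 F) (dmat 3 G))))
   - tr 2 (matmul 2 (dmat 0 G) (matmul 2 (dmat 1 F) (matmul 2 (dmat 2 G) (dmat 3 F)))))"

lemma defect_koszul:
  assumes v: "vars a1 \<subseteq> {..<4}" "vars b1 \<subseteq> {..<4}" "vars a2 \<subseteq> {..<4}" "vars b2 \<subseteq> {..<4}"
    and h: "homog (wts t t) \<alpha> a1" "homog (wts t t) (2 - \<alpha>) b1" "homog (wts t t) \<beta> a2" "homog (wts t t) (2 - \<beta>) b2"
    and sq: "a1 * b1 + a2 * b2 = PY t - PX t"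
    and nz: "evf t 2 3 (koszul_trace a1 b1 a2 b2) \<noteq> 0" "evf t 0 1 (koszul_trace a1 b1 a2 b2) \<noteq> 0"
  shows "defect t t"
proof -
  define F where "F = lmat [[a1, a2], [- b2, b1]]"
  define G where "G = lmat [[b1, - a2], [b2, a1]]"
  define D where "D = blk 2 Zm F G Zm"
  define q :: "nat \<Rightarrow> rat" where "q = (\<lambda>i. if i = 0 then 0 else if i = 1 then \<alpha> + \<beta> - 2 else if i = 2 then \<alpha> - 1 else \<beta> - 1)"
  have H: "hmat 2 (2 + 2) D = koszul_trace a1 b1 a2 b2"
    unfolding hmat_def D_def dmat_blk dmat_lin matmul_blk str_blk koszul_trace_def
    by (simp add: F_def G_def tr_lin Let_def)
  have FG: "\<forall>i<2. \<forall>j<2. matmul 2 F G i j = (if i = j then PY t - PX t else 0)"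
    "\<forall>i<2. \<forall>j<2. matmul 2 G F i j = (if i = j then PY t - PX t else 0)"
    unfolding all_less_2 sq[symmetric] by (simp_all add: F_def G_def matmul_def sum_less_2 lmat_def algebra_simps)
  have "graded_mf 2 (PX t) 2 (PX t) (wts t t) 2 (2 + 2) q D"
    unfolding graded_mf_def shift_pot
  proof (intro conjI allI impI)
    fix i j :: nat
    show "vars (D i j) \<subseteq> {..<2 + 2}"
      using vars_lmat[of "[[a1, a2], [- b2, b1]]" "{..<4}"] vars_lmat[of "[[b1, - a2], [b2, a1]]" "{..<4}"] v
      by (simp add: D_def F_def G_def blk_def)
    assume ij: "i < 2 + 2" "j < 2 + 2"
    then show "D i j = 0" if "(i < 2) = (j < 2)" using that by (simp add: D_def blk_def)
    have "\<forall>i<4. \<forall>j<4. homog (wts t t) (1 + q j - q i) (D i j)"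
      unfolding all_less_4 using h by (simp add: D_def F_def G_def blk_def lmat_def q_def homog_0 homog_uminus)
    then show "homog (wts t t) (1 + q j - q i) (D i j)" using ij by simp
    show "matmul (2 + 2) D D i j = (if i = j then PY t - PX t else 0)"
      unfolding D_def matmul_blk using ij FG by (auto simp: blk_def)
  qed simp
  then show ?thesis unfolding defect_def using nz H by metis
qed

text \<open>\<open>a1\<close> and \<open>a2\<close> generate the ideal of the diagonal; the
  factorisations are Koszul models of the identity defect.\<close>

theorem defect_E_E: "defect TE6 TE6" "defect TE7 TE7" "defect TE8 TE8"
proof -
  let ?x = "Var 0" and ?y = "Var 1" and ?X = "Var 2" and ?Y = "Var 3"
  let ?a1 = "?X - ?x" and ?a2 = "?Y - ?y"
  note ks = koszul_trace_def Let_def tr_def matmul_def sum_less_2 dmat_lmat lmat_def pd_power pt_def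
  show "defect TE6 TE6"
  proof -
    let ?b1 = "?X ^ 2 + ?X * ?x + ?x ^ 2" and ?b2 = "?Y ^ 3 + ?Y ^ 2 * ?y + ?Y * ?y ^ 2 + ?y ^ 3"
    have v: "vars ?a1 \<subseteq> {..<4}" "vars ?b1 \<subseteq> {..<4}" "vars ?a2 \<subseteq> {..<4}" "vars ?b2 \<subseteq> {..<4}"
      by (simp_all add: vars_intros)
    have h: "homog (wts TE6 TE6) (2 / 3) ?a1" "homog (wts TE6 TE6) (2 - 2 / 3) ?b1"
        "homog (wts TE6 TE6) (1 / 2) ?a2" "homog (wts TE6 TE6) (2 - 1 / 2) ?b2"
      by (rule homog_intros | rule refl | simp; fail)+
    have sq: "?a1 * ?b1 + ?a2 * ?b2 = PY TE6 - PX TE6"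
      unfolding pot.simps by algebra
    have nz: "evf TE6 2 3 (koszul_trace ?a1 ?b1 ?a2 ?b2) \<noteq> 0" "evf TE6 0 1 (koszul_trace ?a1 ?b1 ?a2 ?b2) \<noteq> 0"
      by (simp_all add: ks)
    show ?thesis by (rule defect_koszul[OF v h sq nz])
  qed
  show "defect TE7 TE7"
  proof -
    \<comment> \<open>The difference is split by moving \<open>?X\<close> to \<open>?x\<close> with
      \<open>?Y\<close> fixed, and then \<open>?Y\<close> to \<open>?y\<close> with
      \<open>?x\<close> fixed.\<close>
    let ?b1 = "?X ^ 2 + ?X * ?x + ?x ^ 2 + ?Y ^ 3" and ?b2 = "?x * (?Y ^ 2 + ?Y * ?y + ?y ^ 2)"
    have v: "vars ?a1 \<subseteq> {..<4}" "vars ?b1 \<subseteq> {..<4}" "vars ?a2 \<subseteq> {..<4}" "vars ?b2 \<subseteq> {..<4}"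
      by (simp_all add: vars_intros)
    have h: "homog (wts TE7 TE7) (2 / 3) ?a1" "homog (wts TE7 TE7) (2 - 2 / 3) ?b1"
        "homog (wts TE7 TE7) (4 / 9) ?a2" "homog (wts TE7 TE7) (2 - 4 / 9) ?b2"
      by (rule homog_intros | rule refl | simp; fail)+
    have sq: "?a1 * ?b1 + ?a2 * ?b2 = PY TE7 - PX TE7"
      unfolding pot.simps by algebra
    have nz: "evf TE7 2 3 (koszul_trace ?a1 ?b1 ?a2 ?b2) \<noteq> 0" "evf TE7 0 1 (koszul_trace ?a1 ?b1 ?a2 ?b2) \<noteq> 0"
      by (simp_all add: ks)
    show ?thesis by (rule defect_koszul[OF v h sq nz])
  qed
  show "defect TE8 TE8"
  proof -
    let ?b1 = "?X ^ 2 + ?X * ?x + ?x ^ 2" and ?b2 = "?Y ^ 4 + ?Y ^ 3 * ?y + ?Y ^ 2 * ?y ^ 2 + ?Y * ?y ^ 3 + ?y ^ 4"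
    have v: "vars ?a1 \<subseteq> {..<4}" "vars ?b1 \<subseteq> {..<4}" "vars ?a2 \<subseteq> {..<4}" "vars ?b2 \<subseteq> {..<4}"
      by (simp_all add: vars_intros)
    have h: "homog (wts TE8 TE8) (2 / 3) ?a1" "homog (wts TE8 TE8) (2 - 2 / 3) ?b1"
        "homog (wts TE8 TE8) (2 / 5) ?a2" "homog (wts TE8 TE8) (2 - 2 / 5) ?b2"
      by (rule homog_intros | rule refl | simp; fail)+
    have sq: "?a1 * ?b1 + ?a2 * ?b2 = PY TE8 - PX TE8"
      unfolding pot.simps by algebra
    have nz: "evf TE8 2 3 (koszul_trace ?a1 ?b1 ?a2 ?b2) \<noteq> 0" "evf TE8 0 1 (koszul_trace ?a1 ?b1 ?a2 ?b2) \<noteq> 0"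
      by (simp_all add: ks)
    show ?thesis by (rule defect_koszul[OF v h sq nz])
  qed
qed

section \<open>The classification\<close>

lemma valid_cox_cases:
  assumes "valid t"
  shows "t = TA (cox t) \<or> even (cox t) \<and> cox t \<ge> 6 \<and> t = TD (cox t div 2) \<or> cox t = 12 \<and> t = TE6
    \<or> cox t = 18 \<and> t = TE7 \<or> cox t = 30 \<and> t = TE8"
  using assms by (cases t) auto

text \<open>The exceptional Coxeter numbers 12, 18 and 30 are distinct, so different E types never
  meet; each other pair, up to order, has been constructed.\<close>

lemma defect_cox_eq:
  assumes "valid t1" "valid t2" "cox t1 = cox t2"
  shows "defect t1 t2"
proof -
  define h where "h = cox t1"
  have AA: "defect (TA h) (TA h)" if "h \<ge> 2" using defect_A_A[OF that] .
  have "defect (TA h) (TD (h div 2)) \<and> defect (TD (h div 2)) (TA h) \<and> defect (TD (h div 2)) (TD (h div 2))"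
    if "even h" "h \<ge> 6"
    using defect_AD_D[of "h div 2"] that defect_sym[of "TA h" "TD (h div 2)"] by simp
  note AD = this
  note E = defect_E_E defect_AD_E6 defect_AD_E7 defect_AD_E8
    defect_AD_E6[THEN defect_sym] defect_AD_E7[THEN defect_sym] defect_AD_E8[THEN defect_sym]
  have h2: "h \<ge> 2" using assms(1) unfolding h_def by (cases t1) auto
  show ?thesis
    using valid_cox_cases[OF assms(1)] valid_cox_cases[OF assms(2)] AA[OF h2] AD E
    unfolding assms(3)[symmetric] h_def[symmetric] by auto
qed

lemma orb_equiv_iff:
  assumes "valid t1" "valid t2"
  shows "orb_equiv 2 (PX t1) 2 (PX t2) \<longleftrightarrow> cox t1 = cox t2"
  using orb_equiv_imp_cox_eq[OF assms] defect_imp_orb_equiv[OF assms _ defect_cox_eq[OF assms]] by blast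

lemma ADE_set_eq: "ADE_set = PX ` {t. valid t}"
proof -
  have "t \<in> range TA \<or> t \<in> range TD \<or> t \<in> {TE6, TE7, TE8}" for t by (cases t) auto
  then have "{t. valid t} = TA ` {d. d \<ge> 2} \<union> TD ` {d. d \<ge> 3} \<union> {TE6, TE7, TE8}"
    by (force elim: valid.elims)
  moreover have "{VA d |d. d \<ge> 2} = PX ` TA ` {d. d \<ge> 2}" "{VD d |d. d \<ge> 3} = PX ` TD ` {d. d \<ge> 3}"
    "{VE6, VE7, VE8} = PX ` {TE6, TE7, TE8}"
    by (simp_all add: set_eq_iff image_image image_iff VA_def VD_def VE6_def VE7_def VE8_def) auto
  ultimately show ?thesis
    unfolding ADE_set_def by (simp only: image_Un)
qed

section \<open>Classes indexed by the Coxeter number\<close>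

definition cls :: "nat \<Rightarrow> mpoly set" where
  "cls h = PX ` {t. valid t \<and> cox t = h}"

lemma cls_eq:
  assumes "h \<ge> 2"
  shows "cls h = {VA h} \<union> (if even h \<and> h \<ge> 6 then {VD (h div 2)} else {})
    \<union> (if h = 12 then {VE6} else {}) \<union> (if h = 18 then {VE7} else {}) \<union> (if h = 30 then {VE8} else {})"
proof -
  have "{t. valid t \<and> cox t = h} = {TA h} \<union> (if even h \<and> h \<ge> 6 then {TD (h div 2)} else {})
    \<union> (if h = 12 then {TE6} else {}) \<union> (if h = 18 then {TE7} else {}) \<union> (if h = 30 then {TE8} else {})" (is "?L = ?R")
  proof
    show "?L \<subseteq> ?R"
    proof
      fix t assume "t \<in> ?L"
      then show "t \<in> ?R" using valid_cox_cases[of t] by auto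
    qed
    show "?R \<subseteq> ?L" using assms by auto
  qed
  then show ?thesis
    by (simp add: cls_def image_Un VA_def VD_def VE6_def VE7_def VE8_def)
qed

lemma cls_odd: "h \<ge> 2 \<Longrightarrow> odd h \<Longrightarrow> cls h = {VA h}"
proof -
  assume h: "h \<ge> 2" "odd h"
  then have "h \<noteq> 12" "h \<noteq> 18" "h \<noteq> 30" by auto
  with h show ?thesis by (simp add: cls_eq)
qed

lemma cls_even: "even h \<Longrightarrow> h \<ge> 6 \<Longrightarrow> h \<notin> {12, 18, 30} \<Longrightarrow> cls h = {VA h, VD (h div 2)}"
  by (simp add: cls_eq insert_commute)

lemma cls_exceptional: "cls 12 = {VA 12, VD 6, VE6}" "cls 18 = {VA 18, VD 9, VE7}" "cls 30 = {VA 30, VD 15, VE8}"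
  by (simp_all add: cls_eq insert_commute)

lemma ADE_classes_eq: "ADE_classes = cls ` {h. h \<ge> 2}"
proof
  show "cls ` {h. h \<ge> 2} \<subseteq> ADE_classes"
  proof
    fix S assume "S \<in> cls ` {h. h \<ge> 2}"
    then obtain h where h: "h \<ge> 2" and S: "S = cls h" by auto
    \<comment> \<open>Type D begins at Coxeter number 6, so type A is alone at 2 and 4.\<close>
    have "odd h \<or> h = 2 \<or> h = 4 \<or> even h \<and> h \<ge> 6" using h by presburger
    then consider "odd h" | "h = 2" | "h = 4" | "h = 12" | "h = 18" | "h = 30" | "even h" "h \<ge> 6" "h \<notin> {12, 18, 30}"
      by auto
    then show "S \<in> ADE_classes"
    proof cases
      case 1
      with h have "S \<in> {{VA d} |d. d \<ge> 2 \<and> odd d}" using cls_odd S by blast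
      then show ?thesis unfolding ADE_classes_def by simp
    next
      case 7
      then have "S \<in> {{VA d, VD (d div 2)} |d. even d \<and> d \<ge> 6 \<and> d \<notin> {12, 18, 30}}" unfolding S by (intro CollectI exI[of _ h]) (simp add: cls_even)
      then show ?thesis unfolding ADE_classes_def by simp
    qed (simp_all add: S cls_eq cls_exceptional ADE_classes_def)
  qed
  have "S \<in> cls ` {h. h \<ge> 2}" if "h \<ge> 2" "S = cls h" for S h using that by auto
  then show "ADE_classes \<subseteq> cls ` {h. h \<ge> 2}"
    unfolding ADE_classes_def
  proof (intro subsetI, elim UnE)
    fix S assume H: "\<And>h S. h \<ge> 2 \<Longrightarrow> S = cls h \<Longrightarrow> S \<in> cls ` {h. h \<ge> 2}"
    show "S \<in> cls ` {h. h \<ge> 2}" if "S \<in> {{VA d} |d. d \<ge> 2 \<and> odd d}"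
    proof -
      from that obtain d where d: "S = {VA d}" "d \<ge> 2" "odd d" by blast
      then show ?thesis using cls_odd[of d] H[of d S] by simp
    qed
    show "S \<in> cls ` {h. h \<ge> 2}" if "S \<in> {{VA 2}, {VA 4}}"
      using that H[of 2 S] H[of 4 S] by (auto simp: cls_eq)
    show "S \<in> cls ` {h. h \<ge> 2}" if "S \<in> {{VA d, VD (d div 2)} |d. even d \<and> d \<ge> 6 \<and> d \<notin> {12, 18, 30}}"
    proof -
      from that obtain d where d: "S = {VA d, VD (d div 2)}" "even d \<and> d \<ge> 6 \<and> d \<notin> {12, 18, 30}"
        unfolding mem_Collect_eq by (elim exE conjE) (rule that; simp)
      then have "S = cls d" using cls_even[of d] by simp
      then show ?thesis using H[of d S] d(2) by simp
    qed
    show "S \<in> cls ` {h. h \<ge> 2}" if "S \<in> {{VA 12, VD 6, VE6}, {VA 18, VD 9, VE7}, {VA 30, VD 15, VE8}}"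
    proof -
      from that have "S = cls 12 \<or> S = cls 18 \<or> S = cls 30"
        unfolding cls_exceptional by simp
      then show ?thesis by (elim disjE) (erule H[rotated], simp)+
    qed
  qed
qed

theorem theorem1p5:
  shows "(\<lambda>V. {W \<in> ADE_set. orb_equiv 2 V 2 W}) ` ADE_set = ADE_classes"
proof -
  have "{W \<in> ADE_set. orb_equiv 2 (PX t) 2 W} = cls (cox t)" if "valid t" for t
    unfolding ADE_set_eq cls_def using orb_equiv_iff[OF that] by force
  then have "(\<lambda>V. {W \<in> ADE_set. orb_equiv 2 V 2 W}) ` ADE_set = (\<lambda>t. cls (cox t)) ` {t. valid t}"
    unfolding ADE_set_eq image_image by (intro image_cong) simp_all
  also have "\<dots> = cls ` cox ` {t. valid t}" by (simp add: image_image)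
  also have "cox ` {t. valid t} = {h. h \<ge> 2}"
  proof
    show "cox ` {t. valid t} \<subseteq> {h. h \<ge> 2}" by (auto elim: valid.elims)
    show "{h. h \<ge> 2} \<subseteq> cox ` {t. valid t}" using image_eqI[of _ cox "TA _"] by fastforce
  qed
  finally show ?thesis by (simp add: ADE_classes_eq)
qed

end
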